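(* Let $X$ and $Y$ be metric spaces, and $\mathbb{F}$ a field. (1) Let $X\times Y$ denote the $\ell^\infty$-product of $X$ and $Y$. Then $$\mathrm{PH}_*(\mathrm{VR}_*(X\times Y);\mathbb{F})\cong\mathrm{PH}_*(\mathrm{VR}_*(X);\mathbb{F})\otimes\mathrm{PH}_*(\mathrm{VR}_*(Y);\mathbb{F}).$$ (2) Let $p$ and $q$ be points in $X$ and $Y$ respectively, and let $X\vee Y$ denote the metric gluing of $X$ and $Y$ along $p$ and $q$. Then, using reduced homology, $$\mathrm{PH}_*(\mathrm{VR}_*(X\vee Y);\mathbb{F})\cong\mathrm{PH}_*(\mathrm{VR}_*(X);\mathbb{F})\oplus\mathrm{PH}_*(\mathrm{VR}_*(Y);\mathbb{F}).$$
   Context: For a metric space $X$ and $r>0$, $\mathrm{VR}_r(X)$ is the simplicial complex whose vertices are the points of $X$ and whose simplices are the nonempty finite subsets of $X$ of diameter strictly less than $r$. $\mathrm{PH}_*(\mathrm{VR}_*(X);\mathbb{F})$ is the graded persistence module over $(0,\infty)$ whose degree-$k$ part is $(\mathrm{H}_k(\mathrm{VR}_r(X);\mathbb{F}))_{r>0}$ with maps induced by inclusions. Isomorphisms are isomorphisms of graded persistence modules; tensor products and direct sums are taken pointwise in $r$, with the usual grading on the tensor product (the degree-$k$ part is $\bigoplus_{i+j=k}$ of the tensor products of the degree-$i$ and degree-$j$ parts). The $\ell^\infty$-product has metric $d((x,y),(x',y'))=\max\{d_X(x,x'),d_Y(y,y')\}$. The metric gluing $X\vee Y$ is $X\sqcup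 Y/(p\sim q)$ with the metric equal to $d_X$ on $X$, to $d_Y$ on $Y$, and $d(z,z')=d_X(z,p)+d_Y(z',q)$ for $z\in X$, $z'\in Y$. *)

theory Defs
  imports "HOL-Analysis.Analysis" "HOL-Combinatorics.Permutations"
    "HOL-Algebra.Algebraic_Closure_Type"
begin

no_notation var (\<open>X\<index>\<close>)

section \<open>Metric constructions\<close>

definition linf_product :: "'a metric \<Rightarrow> 'b metric \<Rightarrow> ('a \<times> 'b) metric" where
  "linf_product X Y = metric (mspace X \<times> mspace Y,
     \<lambda>(x, y) (x', y'). max (mdist X x x') (mdist Y y y'))"

lemma Metric_space_linf_product:
  "Metric_space (mspace X \<times> mspace Y) (\<lambda>(x, y) (x', y'). max (mdist X x x') (mdist Y y y'))"
proof -
  have tri: "max (mdist X x x'') (mdist Y y y'')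
      \<le> max (mdist X x x') (mdist Y y y') + max (mdist X x' x'') (mdist Y y' y'')"
    if "x \<in> mspace X" "x' \<in> mspace X" "x'' \<in> mspace X"
       "y \<in> mspace Y" "y' \<in> mspace Y" "y'' \<in> mspace Y" for x x' x'' y y' y''
    using mdist_triangle[OF that(1-3)] mdist_triangle[OF that(4-6)] by linarith
  have zero: "max (mdist X x x') (mdist Y y y') = 0 \<longleftrightarrow> x = x' \<and> y = y'"
    if "x \<in> mspace X" "x' \<in> mspace X" "y \<in> mspace Y" "y' \<in> mspace Y" for x x' y y'
    using mdist_nonneg[of X x x'] mdist_nonneg[of Y y y'] mdist_zero[OF that(1,2)]
      mdist_zero[OF that(3,4)] by linarith
  show ?thesis
  proof (unfold_locales, goal_cases)
    case (4 u v w)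
    then show ?case
      by (cases u; cases v; cases w) (simp add: tri del: max.bounded_iff)
  qed (auto simp: mdist_commute zero le_max_iff_disj)
qed

lemma mspace_linf_product [simp]: "mspace (linf_product X Y) = mspace X \<times> mspace Y"
  unfolding linf_product_def
  by (rule Metric_space.mspace_metric[OF Metric_space_linf_product])

lemma mdist_linf_product [simp]:
  "mdist (linf_product X Y) = (\<lambda>(x, y) (x', y'). max (mdist X x x') (mdist Y y y'))"
  unfolding linf_product_def
  by (rule Metric_space.mdist_metric[OF Metric_space_linf_product])

text \<open>The gluing is carried by the quotient of the disjoint union by the equivalence relation
  that identifies \<open>Inl p\<close> with \<open>Inr q\<close>.\<close>

definition glue_rel :: "'a metric \<Rightarrow> 'a \<Rightarrow> 'b metric \<Rightarrow> 'b \<Rightarrow> (('a + 'b) \<times> ('a + 'b)) set" where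
  "glue_rel X p Y q =
     {(z, z'). z \<in> Sum_Type.Plus (mspace X) (mspace Y) \<and> z' \<in> Sum_Type.Plus (mspace X) (mspace Y) \<and>
        (z = z' \<or> (z = Inl p \<and> z' = Inr q) \<or> (z = Inr q \<and> z' = Inl p))}"

definition glue_space :: "'a metric \<Rightarrow> 'a \<Rightarrow> 'b metric \<Rightarrow> 'b \<Rightarrow> ('a + 'b) set set" where
  "glue_space X p Y q = Sum_Type.Plus (mspace X) (mspace Y) // glue_rel X p Y q"

fun glue_predist :: "'a metric \<Rightarrow> 'a \<Rightarrow> 'b metric \<Rightarrow> 'b \<Rightarrow> 'a + 'b \<Rightarrow> 'a + 'b \<Rightarrow> real" where
  "glue_predist X p Y q (Inl x) (Inl x') = mdist X x x'"
| "glue_predist X p Y q (Inr y) (Inr y') = mdist Y y y'"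
| "glue_predist X p Y q (Inl x) (Inr y) = mdist X x p + mdist Y y q"
| "glue_predist X p Y q (Inr y) (Inl x) = mdist X x p + mdist Y y q"

text \<open>The choice of representatives is immaterial, see \<open>glue_dist_eq\<close> below.\<close>

definition glue_dist ::
    "'a metric \<Rightarrow> 'a \<Rightarrow> 'b metric \<Rightarrow> 'b \<Rightarrow> ('a + 'b) set \<Rightarrow> ('a + 'b) set \<Rightarrow> real" where
  "glue_dist X p Y q A B = glue_predist X p Y q (SOME z. z \<in> A) (SOME z. z \<in> B)"

definition metric_gluing :: "'a metric \<Rightarrow> 'a \<Rightarrow> 'b metric \<Rightarrow> 'b \<Rightarrow> ('a + 'b) set metric" where
  "metric_gluing X p Y q = metric (glue_space X p Y q, glue_dist X p Y q)"

lemma equiv_glue_rel: "equiv (Sum_Type.Plus (mspace X) (mspace Y)) (glue_rel X p Y q)"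
  by (rule equivI) (auto simp: glue_rel_def refl_on_def sym_def trans_def)

lemma glue_predist_nonneg: "0 \<le> glue_predist X p Y q z z'"
  by (cases z; cases z') auto

lemma glue_predist_commute: "glue_predist X p Y q z z' = glue_predist X p Y q z' z"
  by (cases z; cases z') (auto simp: mdist_commute)

lemma glue_predist_triangle:
  assumes "p \<in> mspace X" "q \<in> mspace Y"
    and "z \<in> Sum_Type.Plus (mspace X) (mspace Y)" "z' \<in> Sum_Type.Plus (mspace X) (mspace Y)"
      "z'' \<in> Sum_Type.Plus (mspace X) (mspace Y)"
  shows "glue_predist X p Y q z z'' \<le> glue_predist X p Y q z z' + glue_predist X p Y q z' z''"
proof -
  have X: "mdist X a c \<le> mdist X a b + mdist X b c"
    if "a \<in> mspace X" "b \<in> mspace X" "c \<in> mspace X" for a b c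
    using that by (rule mdist_triangle)
  have Y: "mdist Y a c \<le> mdist Y a b + mdist Y b c"
    if "a \<in> mspace Y" "b \<in> mspace Y" "c \<in> mspace Y" for a b c
    using that by (rule mdist_triangle)
  have X': "mdist X a c \<le> mdist X a b + mdist X c b"
    if "a \<in> mspace X" "b \<in> mspace X" "c \<in> mspace X" for a b c
    using X[OF that] by (simp add: mdist_commute)
  have Y': "mdist Y a c \<le> mdist Y a b + mdist Y c b"
    if "a \<in> mspace Y" "b \<in> mspace Y" "c \<in> mspace Y" for a b c
    using Y[OF that] by (simp add: mdist_commute)
  have nn: "0 \<le> mdist X a b" "0 \<le> mdist Y c d" for a b c d
    by auto
  show ?thesis
    using assms(3-5)
  proof (elim PlusE, goal_cases)
    case (1 a b c) then show ?case using X[of a b c] by simp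
  next
    case (2 a b c) then show ?case using X[of a b p] assms by simp
  next
    case (3 a b c) then show ?case using X'[of a p c] nn(2)[of b q] assms by (auto simp del: mdist_nonneg)
  next
    case (4 a b c) then show ?case using Y[of c b q] assms by (simp add: mdist_commute)
  next
    case (5 a b c) then show ?case using X[of c b p] assms by (simp add: mdist_commute)
  next
    case (6 a b c) then show ?case using Y'[of a q c] nn(1)[of b p] assms by (auto simp del: mdist_nonneg)
  next
    case (7 a b c) then show ?case using Y[of a b q] assms by simp
  next
    case (8 a b c) then show ?case using Y[of a b c] by simp
  qed
qed

lemma glue_predist_zero:
  assumes "p \<in> mspace X" "q \<in> mspace Y"
    and "z \<in> Sum_Type.Plus (mspace X) (mspace Y)" "z' \<in> Sum_Type.Plus (mspace X) (mspace Y)"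
  shows "glue_predist X p Y q z z' = 0 \<longleftrightarrow> (z, z') \<in> glue_rel X p Y q"
  using assms
  by (cases z; cases z')
    (auto simp: glue_rel_def add_nonneg_eq_0_iff)

lemma glue_predist_cong:
  assumes pq: "p \<in> mspace X" "q \<in> mspace Y"
    and zz: "(z, z') \<in> glue_rel X p Y q" and w: "w \<in> Sum_Type.Plus (mspace X) (mspace Y)"
  shows "glue_predist X p Y q z w = glue_predist X p Y q z' w"
proof -
  have mem: "z \<in> Sum_Type.Plus (mspace X) (mspace Y)" "z' \<in> Sum_Type.Plus (mspace X) (mspace Y)"
    using zz by (auto simp: glue_rel_def)
  have "glue_predist X p Y q z z' = 0"
    using glue_predist_zero[OF pq mem] zz by simp
  moreover have "glue_predist X p Y q z' z = 0"
    using calculation by (simp add: glue_predist_commute)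
  ultimately show ?thesis
    using glue_predist_triangle[OF pq mem(1) mem(2) w] glue_predist_triangle[OF pq mem(2) mem(1) w]
    by linarith
qed

lemma glue_dist_eq:
  assumes pq: "p \<in> mspace X" "q \<in> mspace Y"
    and A: "A \<in> glue_space X p Y q" "z \<in> A" and B: "B \<in> glue_space X p Y q" "w \<in> B"
  shows "glue_dist X p Y q A B = glue_predist X p Y q z w"
proof -
  let ?S = "Sum_Type.Plus (mspace X) (mspace Y)" and ?R = "glue_rel X p Y q"
  define a b where "a = (SOME z. z \<in> A)" and "b = (SOME z. z \<in> B)"
  have a: "a \<in> A" and b: "b \<in> B"
    using A B by (auto simp: a_def b_def intro: someI)
  have az: "(a, z) \<in> ?R" and bw: "(b, w) \<in> ?R"
    using A B a b quotient_eq_iff[OF equiv_glue_rel[of X Y p q]]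
    by (auto simp: glue_space_def)
  have S: "a \<in> ?S" "z \<in> ?S" "b \<in> ?S" "w \<in> ?S"
    using az bw by (auto simp: glue_rel_def)
  have "glue_predist X p Y q a b = glue_predist X p Y q z b"
    by (rule glue_predist_cong[OF pq az S(3)])
  also have "\<dots> = glue_predist X p Y q z w"
    using glue_predist_cong[OF pq bw S(2)] by (simp add: glue_predist_commute)
  finally show ?thesis
    by (simp add: glue_dist_def a_def b_def)
qed

lemma Metric_space_gluing:
  assumes pq: "p \<in> mspace X" "q \<in> mspace Y"
  shows "Metric_space (glue_space X p Y q) (glue_dist X p Y q)"
proof
  let ?S = "Sum_Type.Plus (mspace X) (mspace Y)" and ?R = "glue_rel X p Y q"
  have rep: "\<exists>z. z \<in> A \<and> z \<in> ?S" if "A \<in> glue_space X p Y q" for A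
    using that in_quotient_imp_non_empty[OF equiv_glue_rel, of A X Y p q]
      in_quotient_imp_subset[OF equiv_glue_rel, of A X Y p q]
    unfolding glue_space_def by blast
  show "0 \<le> glue_dist X p Y q A B" for A B
    by (simp add: glue_dist_def glue_predist_nonneg)
  show "glue_dist X p Y q A B = glue_dist X p Y q B A" for A B
    by (simp add: glue_dist_def glue_predist_commute)
  show "glue_dist X p Y q A B = 0 \<longleftrightarrow> A = B"
    if A: "A \<in> glue_space X p Y q" and B: "B \<in> glue_space X p Y q" for A B
  proof -
    obtain z w where z: "z \<in> A" "z \<in> ?S" and w: "w \<in> B" "w \<in> ?S"
      using rep[OF A] rep[OF B] by blast
    have "glue_dist X p Y q A B = 0 \<longleftrightarrow> (z, w) \<in> ?R"
      using glue_dist_eq[OF pq A z(1) B w(1)] glue_predist_zero[OF pq z(2) w(2)] by simp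
    also have "\<dots> \<longleftrightarrow> A = B"
      using quotient_eq_iff[OF equiv_glue_rel[of X Y p q], of A B z w] A B z w
      by (simp add: glue_space_def)
    finally show ?thesis .
  qed
  show "glue_dist X p Y q A C \<le> glue_dist X p Y q A B + glue_dist X p Y q B C"
    if A: "A \<in> glue_space X p Y q" and B: "B \<in> glue_space X p Y q"
      and C: "C \<in> glue_space X p Y q" for A B C
  proof -
    obtain z w v where "z \<in> A" "z \<in> ?S" "w \<in> B" "w \<in> ?S" "v \<in> C" "v \<in> ?S"
      using rep[OF A] rep[OF B] rep[OF C] by blast
    then show ?thesis
      using glue_predist_triangle[OF pq] by (simp add: glue_dist_eq[OF pq] A B C)
  qed
qed

lemma mspace_metric_gluing:
  "p \<in> mspace X \<Longrightarrow> q \<in> mspace Y \<Longrightarrow> mspace (metric_gluing X p Y q) = glue_space X p Y q"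
  unfolding metric_gluing_def
  by (rule Metric_space.mspace_metric[OF Metric_space_gluing])

lemma mdist_metric_gluing:
  "p \<in> mspace X \<Longrightarrow> q \<in> mspace Y \<Longrightarrow> mdist (metric_gluing X p Y q) = glue_dist X p Y q"
  unfolding metric_gluing_def
  by (rule Metric_space.mdist_metric[OF Metric_space_gluing])


section \<open>Vietoris--Rips complexes\<close>

definition mdiam :: "'a metric \<Rightarrow> 'a set \<Rightarrow> real" where
  "mdiam X S = (SUP (x, y)\<in>S \<times> S. mdist X x y)"

definition VR :: "real \<Rightarrow> 'a metric \<Rightarrow> 'a set set" where
  "VR r X = {\<sigma>. \<sigma> \<noteq> {} \<and> finite \<sigma> \<and> \<sigma> \<subseteq> mspace X \<and> mdiam X \<sigma> < r}"


section \<open>Vector spaces\<close>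

text \<open>Vector spaces over a type \<open>'f\<close> of class \<open>field\<close> are represented by the records
  of HOL-Algebra for modules, with the coefficient ring \<open>ring_of_type_algebra :: 'f ring\<close>.
  These records also have fields for a multiplication, which modules do not use; they are
  left unspecified.\<close>

definition mk_module ::
    "'v set \<Rightarrow> 'v \<Rightarrow> ('v \<Rightarrow> 'v \<Rightarrow> 'v) \<Rightarrow> ('f \<Rightarrow> 'v \<Rightarrow> 'v) \<Rightarrow> ('f, 'v) module" where
  "mk_module V z pl sc =
     \<lparr>carrier = V, mult = undefined, one = undefined, zero = z, add = pl, smult = sc\<rparr>"

definition fun_module :: "('b \<Rightarrow> 'f::field) set \<Rightarrow> ('f, 'b \<Rightarrow> 'f) module" where
  "fun_module V = mk_module V (\<lambda>_. 0) (\<lambda>c d x. c x + d x) (\<lambda>a c x. a * c x)"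

definition free_module :: "'b set \<Rightarrow> ('f::field, 'b \<Rightarrow> 'f) module" where
  "free_module S = fun_module {c. finite {x. c x \<noteq> 0} \<and> {x. c x \<noteq> 0} \<subseteq> S}"

definition quot_module :: "('f::field, 'v) module \<Rightarrow> 'v set \<Rightarrow> ('f, 'v set) module" where
  "quot_module M N = mk_module (a_rcosets\<^bsub>M\<^esub> N) N (\<lambda>A B. A <+>\<^bsub>M\<^esub> B)
     (\<lambda>a A. \<Union>x\<in>A. N +>\<^bsub>M\<^esub> (a \<odot>\<^bsub>M\<^esub> x))"

definition quot_map :: "('f::field, 'w) module \<Rightarrow> 'w set \<Rightarrow> ('v \<Rightarrow> 'w) \<Rightarrow> 'v set \<Rightarrow> 'w set" where
  "quot_map M' N' f A = (\<Union>x\<in>A. N' +>\<^bsub>M'\<^esub> f x)"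

definition submodule_generated :: "('f::field, 'v) module \<Rightarrow> 'v set \<Rightarrow> 'v set" where
  "submodule_generated M S = \<Inter>{H. submodule H ring_of_type_algebra M \<and> S \<subseteq> H}"

definition linear_iso :: "('f::field, 'v) module \<Rightarrow> ('f, 'w) module \<Rightarrow> ('v \<Rightarrow> 'w) \<Rightarrow> bool" where
  "linear_iso M N f \<longleftrightarrow> f \<in> iso (add_monoid M) (add_monoid N) \<and>
     (\<forall>a. \<forall>x\<in>carrier M. f (a \<odot>\<^bsub>M\<^esub> x) = a \<odot>\<^bsub>N\<^esub> f x)"

definition direct_sum2 :: "('f::field, 'v) module \<Rightarrow> ('f, 'w) module \<Rightarrow> ('f, 'v \<times> 'w) module" where
  "direct_sum2 M N = mk_module (carrier M \<times> carrier N) (\<zero>\<^bsub>M\<^esub>, \<zero>\<^bsub>N\<^esub>)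
     (\<lambda>(x, y) (x', y'). (x \<oplus>\<^bsub>M\<^esub> x', y \<oplus>\<^bsub>N\<^esub> y')) (\<lambda>a (x, y). (a \<odot>\<^bsub>M\<^esub> x, a \<odot>\<^bsub>N\<^esub> y))"

definition direct_sum :: "'i set \<Rightarrow> ('i \<Rightarrow> ('f::field, 'v) module) \<Rightarrow> ('f, 'i \<Rightarrow> 'v) module" where
  "direct_sum I M = mk_module
     {x \<in> \<Pi>\<^sub>E i\<in>I. carrier (M i). finite {i \<in> I. x i \<noteq> \<zero>\<^bsub>M i\<^esub>}}
     (\<lambda>i\<in>I. \<zero>\<^bsub>M i\<^esub>)
     (\<lambda>x y. \<lambda>i\<in>I. x i \<oplus>\<^bsub>M i\<^esub> y i)
     (\<lambda>a x. \<lambda>i\<in>I. a \<odot>\<^bsub>M i\<^esub> x i)"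


subsection \<open>Tensor products\<close>

text \<open>The tensor product is the free vector space on the pairs of vectors, modulo the
  bilinearity relations.\<close>

definition gen :: "'b \<Rightarrow> 'b \<Rightarrow> 'f::field" where
  "gen b = (\<lambda>x. if x = b then 1 else 0)"

abbreviation tensor_free ::
    "('f::field, 'v) module \<Rightarrow> ('f, 'w) module \<Rightarrow> ('f, 'v \<times> 'w \<Rightarrow> 'f) module" where
  "tensor_free M N \<equiv> free_module (carrier M \<times> carrier N)"

definition tensor_relators ::
    "('f::field, 'v) module \<Rightarrow> ('f, 'w) module \<Rightarrow> ('v \<times> 'w \<Rightarrow> 'f) set" where
  "tensor_relators M N =
     {\<lambda>z. gen (x \<oplus>\<^bsub>M\<^esub> x', y) z - gen (x, y) z - gen (x', y) z | x x' y.
        x \<in> carrier M \<and> x' \<in> carrier M \<and> y \<in> carrier N} \<union>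
     {\<lambda>z. gen (x, y \<oplus>\<^bsub>N\<^esub> y') z - gen (x, y) z - gen (x, y') z | x y y'.
        x \<in> carrier M \<and> y \<in> carrier N \<and> y' \<in> carrier N} \<union>
     {\<lambda>z. gen (a \<odot>\<^bsub>M\<^esub> x, y) z - a * gen (x, y) z | a x y.
        x \<in> carrier M \<and> y \<in> carrier N} \<union>
     {\<lambda>z. gen (x, a \<odot>\<^bsub>N\<^esub> y) z - a * gen (x, y) z | a x y.
        x \<in> carrier M \<and> y \<in> carrier N}"

definition tensor_null ::
    "('f::field, 'v) module \<Rightarrow> ('f, 'w) module \<Rightarrow> ('v \<times> 'w \<Rightarrow> 'f) set" where
  "tensor_null M N = submodule_generated (tensor_free M N) (tensor_relators M N)"

definition tensor_module ::
    "('f::field, 'v) module \<Rightarrow> ('f, 'w) module \<Rightarrow> ('f, ('v \<times> 'w \<Rightarrow> 'f) set) module" where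
  "tensor_module M N = quot_module (tensor_free M N) (tensor_null M N)"

definition free_map :: "('b \<Rightarrow> 'c) \<Rightarrow> ('b \<Rightarrow> 'f::field) \<Rightarrow> 'c \<Rightarrow> 'f" where
  "free_map h c = (\<lambda>y. \<Sum>x | c x \<noteq> 0 \<and> h x = y. c x)"

text \<open>\<open>tensor_map M' N' f g\<close> is the map into \<open>tensor_module M' N'\<close> with
  \<open>x \<otimes> y \<mapsto> f x \<otimes> g y\<close>.\<close>

definition tensor_map ::
    "('f::field, 'v') module \<Rightarrow> ('f, 'w') module \<Rightarrow> ('v \<Rightarrow> 'v') \<Rightarrow> ('w \<Rightarrow> 'w')
      \<Rightarrow> ('v \<times> 'w \<Rightarrow> 'f) set \<Rightarrow> ('v' \<times> 'w' \<Rightarrow> 'f) set" where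
  "tensor_map M' N' f g =
     quot_map (tensor_free M' N') (tensor_null M' N') (free_map (map_prod f g))"


section \<open>Simplicial homology\<close>

text \<open>A simplicial complex is given by the set \<open>K\<close> of its simplices.  An oriented \<open>k\<close>-chain
  is a finitely supported function on orderings of \<open>k\<close>-simplices that changes sign under odd
  permutations of the ordering.  The elementary chain \<open>[v\<^sub>0, \<dots>, v\<^sub>k]\<close> is the function with value
  \<open>sign \<pi>\<close> at the \<open>\<pi>\<close>-permuted ordering and 0 elsewhere.\<close>

definition chains :: "'a set set \<Rightarrow> nat \<Rightarrow> ('a list \<Rightarrow> 'f::field) set" where
  "chains K k = {c. finite {vs. c vs \<noteq> 0} \<and>
     (\<forall>vs. c vs \<noteq> 0 \<longrightarrow> length vs = Suc k \<and> distinct vs \<and> set vs \<in> K) \<and>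
     (\<forall>vs \<pi>. \<pi> permutes {..<length vs} \<longrightarrow> c (permute_list \<pi> vs) = of_int (sign \<pi>) * c vs)}"

text \<open>The linear map \<open>[v\<^sub>0, \<dots>, v\<^sub>k] \<mapsto> \<Sum>\<^sub>i (-1)^i [v\<^sub>0, \<dots>, v\<^sub>i\<^sub>-\<^sub>1, v\<^sub>i\<^sub>+\<^sub>1, \<dots>, v\<^sub>k]\<close>, because
  \<open>[v\<^sub>i, v\<^sub>0, \<dots>, v\<^sub>i\<^sub>-\<^sub>1, v\<^sub>i\<^sub>+\<^sub>1, \<dots>, v\<^sub>k] = (-1)^i [v\<^sub>0, \<dots>, v\<^sub>k]\<close>.  On a 0-chain \<open>c\<close>, its value at
  the empty list is the augmentation of \<open>c\<close>.\<close>

definition boundary :: "('a list \<Rightarrow> 'f::field) \<Rightarrow> 'a list \<Rightarrow> 'f" where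
  "boundary c = (\<lambda>vs. \<Sum>v | c (v # vs) \<noteq> 0. c (v # vs))"

definition cycles :: "'a set set \<Rightarrow> nat \<Rightarrow> ('a list \<Rightarrow> 'f::field) set" where
  "cycles K k = {c \<in> chains K k. k = 0 \<or> boundary c = (\<lambda>_. 0)}"

definition reduced_cycles :: "'a set set \<Rightarrow> nat \<Rightarrow> ('a list \<Rightarrow> 'f::field) set" where
  "reduced_cycles K k = {c \<in> chains K k. boundary c = (\<lambda>_. 0)}"

definition boundaries :: "'a set set \<Rightarrow> nat \<Rightarrow> ('a list \<Rightarrow> 'f::field) set" where
  "boundaries K k = boundary ` chains K (Suc k)"

definition homology :: "'a set set \<Rightarrow> nat \<Rightarrow> ('f::field, ('a list \<Rightarrow> 'f) set) module" where
  "homology K k = quot_module (fun_module (cycles K k)) (boundaries K k)"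

definition reduced_homology ::
    "'a set set \<Rightarrow> nat \<Rightarrow> ('f::field, ('a list \<Rightarrow> 'f) set) module" where
  "reduced_homology K k = quot_module (fun_module (reduced_cycles K k)) (boundaries K k)"

text \<open>The maps induced by the inclusion of a subcomplex into \<open>K'\<close>; on chains, the inclusion is
  the identity function.\<close>

definition homology_incl ::
    "'a set set \<Rightarrow> nat \<Rightarrow> ('a list \<Rightarrow> 'f::field) set \<Rightarrow> ('a list \<Rightarrow> 'f) set" where
  "homology_incl K' k = quot_map (fun_module (cycles K' k)) (boundaries K' k) id"

definition reduced_homology_incl ::
    "'a set set \<Rightarrow> nat \<Rightarrow> ('a list \<Rightarrow> 'f::field) set \<Rightarrow> ('a list \<Rightarrow> 'f) set" where
  "reduced_homology_incl K' k = quot_map (fun_module (reduced_cycles K' k)) (boundaries K' k) id"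


section \<open>Graded persistence modules\<close>

text \<open>\<open>pm_obj P k r\<close> is the degree-\<open>k\<close> part at parameter \<open>r\<close>, and \<open>pm_map P k r s\<close> is the
  structure map from \<open>r\<close> to \<open>s\<close>.  Only parameters \<open>0 < r \<le> s\<close> are meaningful.\<close>

record ('f, 'v) pers_module =
  pm_obj :: "nat \<Rightarrow> real \<Rightarrow> ('f, 'v) module"
  pm_map :: "nat \<Rightarrow> real \<Rightarrow> real \<Rightarrow> 'v \<Rightarrow> 'v"

definition pm_isomorphic ::
    "('f::field, 'v) pers_module \<Rightarrow> ('f, 'w) pers_module \<Rightarrow> bool" (infix "\<cong>\<^sub>P\<^sub>M" 50) where
  "P \<cong>\<^sub>P\<^sub>M Q \<longleftrightarrow> (\<exists>\<Phi>.
     (\<forall>k r. 0 < r \<longrightarrow> linear_iso (pm_obj P k r) (pm_obj Q k r) (\<Phi> k r)) \<and>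
     (\<forall>k r s. 0 < r \<and> r \<le> s \<longrightarrow> (\<forall>x\<in>carrier (pm_obj P k r).
        \<Phi> k s (pm_map P k r s x) = pm_map Q k r s (\<Phi> k r x))))"

definition pm_direct_sum ::
    "('f::field, 'v) pers_module \<Rightarrow> ('f, 'w) pers_module \<Rightarrow> ('f, 'v \<times> 'w) pers_module"
    (infixl "\<oplus>\<^sub>P\<^sub>M" 65) where
  "P \<oplus>\<^sub>P\<^sub>M Q = \<lparr>
     pm_obj = (\<lambda>k r. direct_sum2 (pm_obj P k r) (pm_obj Q k r)),
     pm_map = (\<lambda>k r s. map_prod (pm_map P k r s) (pm_map Q k r s))\<rparr>"

definition pm_tensor ::
    "('f::field, 'v) pers_module \<Rightarrow> ('f, 'w) pers_module
      \<Rightarrow> ('f, nat \<times> nat \<Rightarrow> ('v \<times> 'w \<Rightarrow> 'f) set) pers_module"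
    (infixl "\<otimes>\<^sub>P\<^sub>M" 70) where
  "P \<otimes>\<^sub>P\<^sub>M Q = \<lparr>
     pm_obj = (\<lambda>k r. direct_sum {(i, j). i + j = k}
        (\<lambda>(i, j). tensor_module (pm_obj P i r) (pm_obj Q j r))),
     pm_map = (\<lambda>k r s x. \<lambda>(i, j)\<in>{(i, j). i + j = k}.
        tensor_map (pm_obj P i s) (pm_obj Q j s) (pm_map P i r s) (pm_map Q j r s) (x (i, j)))\<rparr>"

text \<open>The first argument of \<open>PH\<close> and \<open>reduced_PH\<close> only serves to name the field.  For nonempty
  spaces the reduced homology in degree \<open>-1\<close> vanishes, so degrees are natural numbers.\<close>

definition PH ::
    "'f::field itself \<Rightarrow> 'a metric \<Rightarrow> ('f, ('a list \<Rightarrow> 'f) set) pers_module" where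
  "PH F X = \<lparr>
     pm_obj = (\<lambda>k r. homology (VR r X) k),
     pm_map = (\<lambda>k r s. homology_incl (VR s X) k)\<rparr>"

definition reduced_PH ::
    "'f::field itself \<Rightarrow> 'a metric \<Rightarrow> ('f, ('a list \<Rightarrow> 'f) set) pers_module" where
  "reduced_PH F X = \<lparr>
     pm_obj = (\<lambda>k r. reduced_homology (VR r X) k),
     pm_map = (\<lambda>k r s. reduced_homology_incl (VR s X) k)\<rparr>"

end

theory Submission
  imports Defs "HOL-Library.Poly_Mapping"
begin

text \<open>Orienting every finite set by an arbitrary ordering identifies alternating chains with finitely
  supported functions on simplices, so that chain maps can be defined on basis elements.

  For the product, the Vietoris--Rips complex of a product consists of the finite sets
  whose two projections are simplices.  The method of acyclic carriers, applied to the complexes of all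
  finite sets, gives Eilenberg--Zilber maps and homotopies that respect the carriers and hence restrict
  to every pair of subcomplexes; this makes the cross product natural.  It is an isomorphism
  for each parameter because over a field a generalised inverse \<open>s\<close> of the boundary operator
  (\<open>d s d = d\<close>) deforms each factor to its homology.  The same formula for the homotopy on a tensor
  product shows that tensor products of full simplices are acyclic.

  For the gluing, a simplex that meets both sides away from the base point remains a simplex after
  adding the base point, since the distance to it is at most the distance to the other side.  Coning
  with apex the base point therefore moves every cycle into the union of the two sides, which
  share only the base point.

  An isomorphism of persistence modules is obtained from two surjections with equal
  kernels from a common space of representatives that increases with the parameter.\<close>

section \<open>Free vector spaces\<close>

text \<open>Generalised inverses of the boundary at different parameters need not be compatible:
  they can prove bijectivity at a fixed parameter but cannot define a natural map. The map has to be
  constructed before any parameter is chosen. For the same reason the orientation of a finite set is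
  chosen once for the whole vertex type; an inclusion of complexes is then the identity on
  coefficients, and a representing cycle can be kept while the parameter grows. Elements of a tensor
  product of homology spaces are represented by formal combinations of pairs of cycles. Such a
  combination represents zero exactly when all bilinear maps that vanish on boundaries in either
  argument send it to zero. Injectivity of the cross product thus becomes a statement on bilinear
  maps, proved without bases of homology. The glued space and its two sides have different vertex
  types, so their chains are compared through injections of vertices. A positive parameter makes the
  base point a vertex of every complex; in degree 0 reduced homology is what removes its class,
  which both sides share.\<close>

abbreviation lookup :: "('b \<Rightarrow>\<^sub>0 'f::zero) \<Rightarrow> 'b \<Rightarrow> 'f" where
  "lookup \<equiv> Poly_Mapping.lookup"

abbreviation keys :: "('b \<Rightarrow>\<^sub>0 'f::zero) \<Rightarrow> 'b set" where
  "keys \<equiv> Poly_Mapping.keys"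

definition smul :: "'f::field \<Rightarrow> ('b \<Rightarrow>\<^sub>0 'f) \<Rightarrow> ('b \<Rightarrow>\<^sub>0 'f)" where
  "smul a p = Poly_Mapping.map ((*) a) p"

lemma lookup_smul [simp]: "lookup (smul a p) b = a * lookup p b"
  unfolding smul_def by transfer (simp add: when_def)

global_interpretation fv: vector_space "smul :: 'f::field \<Rightarrow> ('b \<Rightarrow>\<^sub>0 'f) \<Rightarrow> _"
  by unfold_locales (auto intro!: poly_mapping_eqI simp: lookup_add algebra_simps)

global_interpretation fvp: vector_space_pair
  "smul :: 'f::field \<Rightarrow> ('b \<Rightarrow>\<^sub>0 'f) \<Rightarrow> _" "smul :: 'f::field \<Rightarrow> ('c \<Rightarrow>\<^sub>0 'f) \<Rightarrow> _"
  by unfold_locales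

abbreviation lin :: "(('b \<Rightarrow>\<^sub>0 'f::field) \<Rightarrow> ('c \<Rightarrow>\<^sub>0 'f)) \<Rightarrow> bool" where
  "lin \<equiv> Vector_Spaces.linear smul smul"

abbreviation delta :: "'b \<Rightarrow> ('b \<Rightarrow>\<^sub>0 'f::field)" where
  "delta b \<equiv> Poly_Mapping.single b 1"

definition fsub :: "'b set \<Rightarrow> ('b \<Rightarrow>\<^sub>0 'f::field) set" where
  "fsub S = {p. keys p \<subseteq> S}"

lemma linI:
  assumes "\<And>x y. f (x + y) = f x + f y" "\<And>a x. f (smul a x) = smul a (f x)"
  shows "lin f"
  using assms by (simp add: Vector_Spaces.linear_iff fv.vector_space_axioms)

lemmas lin_add = fvp.linear_add and lin_scale = fvp.linear_scale and lin_0 = fvp.linear_0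
  and lin_diff = fvp.linear_diff and lin_neg = fvp.linear_neg and lin_sum = fvp.linear_sum

lemma lin_comp: "lin f \<Longrightarrow> lin g \<Longrightarrow> lin (\<lambda>x. f (g x))"
  by (rule linI) (simp_all add: lin_add lin_scale)

lemma lin_plus: "lin f \<Longrightarrow> lin g \<Longrightarrow> lin (\<lambda>x. f x + g x)"
  by (rule linI) (simp_all add: lin_add lin_scale fv.scale_right_distrib)

lemma lin_minus: "lin f \<Longrightarrow> lin g \<Longrightarrow> lin (\<lambda>x. f x - g x)"
  by (rule linI) (simp_all add: lin_add lin_scale fv.scale_right_diff_distrib)

lemma lin_ident: "lin (\<lambda>x. x)"
  by (rule linI) simp_all

lemma lin_zero: "lin (\<lambda>x. 0)"
  by (rule linI) simp_all

lemma lin_smul: "lin (smul a)"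
  by (rule linI) (simp_all add: fv.scale_right_distrib mult.commute)

lemma fsubI: "(\<And>b. lookup p b \<noteq> 0 \<Longrightarrow> b \<in> S) \<Longrightarrow> p \<in> fsub S"
  by (auto simp: fsub_def in_keys_iff)

lemma fsubD: "p \<in> fsub S \<Longrightarrow> lookup p b \<noteq> 0 \<Longrightarrow> b \<in> S"
  by (auto simp: fsub_def in_keys_iff)

lemma subspace_fsub: "fv.subspace (fsub S)"
  by (auto simp: fv.subspace_def lookup_add intro!: fsubI dest: fsubD) (metis add.left_neutral fsubD)

lemmas fsub_add = fv.subspace_add[OF subspace_fsub]
  and fsub_diff = fv.subspace_diff[OF subspace_fsub]
  and fsub_smul = fv.subspace_scale[OF subspace_fsub]

lemma fsub_0 [simp]: "0 \<in> fsub S"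
  by (simp add: fsub_def)

lemma fsub_mono: "p \<in> fsub S \<Longrightarrow> S \<subseteq> T \<Longrightarrow> p \<in> fsub T"
  by (auto simp: fsub_def)

lemma fsub_empty_iff: "p \<in> fsub {} \<longleftrightarrow> p = 0"
  by (auto simp: fsub_def)

lemma delta_fsub [simp]: "delta b \<in> fsub S \<longleftrightarrow> b \<in> S"
  by (simp add: fsub_def)

lemma fsub_singleton: "p \<in> fsub {b} \<longleftrightarrow> p = smul (lookup p b) (delta b)"
proof
  assume "p \<in> fsub {b}"
  then show "p = smul (lookup p b) (delta b)"
    by (intro poly_mapping_eqI) (auto simp: lookup_single when_def dest: fsubD)
next
  assume "p = smul (lookup p b) (delta b)"
  then show "p \<in> fsub {b}"
    by (metis fsub_smul delta_fsub insertI1)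
qed

lemma fsub_UNIV [simp]: "p \<in> fsub UNIV"
  by (simp add: fsub_def)

lemma poly_mapping_expand: "p = (\<Sum>b\<in>keys p. smul (lookup p b) (delta b))"
  by (rule poly_mapping_eqI)
     (auto simp: lookup_sum lookup_single when_def in_keys_iff if_distrib[of "\<lambda>z. _ * z"]
       cong: if_cong)

text \<open>By the finite expansion in basis vectors. Most identities between chain maps below are
  reduced in this way to single simplices or pairs of simplices.\<close>

lemma lin_mem:
  assumes "lin f" "fv.subspace W" "\<And>b. b \<in> S \<Longrightarrow> f (delta b) \<in> W" "p \<in> fsub S"
  shows "f p \<in> W"
proof -
  have "f p = (\<Sum>b\<in>keys p. smul (lookup p b) (f (delta b)))"
    by (subst poly_mapping_expand) (simp add: lin_sum[OF assms(1)] lin_scale[OF assms(1)])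
  also have "\<dots> \<in> W"
    using assms by (intro fv.subspace_sum fv.subspace_scale) (auto simp: fsub_def)
  finally show ?thesis .
qed

lemma lin_fsub:
  assumes "lin f" "\<And>b. b \<in> S \<Longrightarrow> f (delta b) \<in> fsub T" "p \<in> fsub S"
  shows "f p \<in> fsub T"
  using lin_mem[OF assms(1) subspace_fsub assms(2,3)] .

lemma lin_eq_on:
  assumes "lin f" "lin g" "\<And>b. b \<in> S \<Longrightarrow> f (delta b) = g (delta b)" "p \<in> fsub S"
  shows "f p = g p"
proof -
  have "f p - g p \<in> {0}"
    by (rule lin_mem[of "\<lambda>p. f p - g p" _ S]) (use assms in \<open>auto intro: lin_minus fv.subspace_single_0\<close>)
  then show ?thesis by simp
qed

lemma lin_eq:
  assumes "lin f" "lin g" "\<And>b. f (delta b) = g (delta b)"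
  shows "f p = g p"
  by (rule lin_eq_on[of f g UNIV]) (use assms in auto)

text \<open>The universal property of the free vector space: the linear extension of a map given on
  the basis.\<close>

definition lext :: "('b \<Rightarrow> ('c \<Rightarrow>\<^sub>0 'f::field)) \<Rightarrow> ('b \<Rightarrow>\<^sub>0 'f) \<Rightarrow> ('c \<Rightarrow>\<^sub>0 'f)" where
  "lext g p = (\<Sum>b\<in>keys p. smul (lookup p b) (g b))"

lemma lext_superset:
  assumes "finite A" "keys p \<subseteq> A"
  shows "lext g p = (\<Sum>b\<in>A. smul (lookup p b) (g b))"
  unfolding lext_def by (rule sum.mono_neutral_left) (use assms in \<open>auto simp: in_keys_iff\<close>)

lemma lin_lext: "lin (lext (g :: 'b \<Rightarrow> ('c \<Rightarrow>\<^sub>0 'f::field)))"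
proof (rule linI)
  fix p q :: "'b \<Rightarrow>\<^sub>0 'f" and a :: 'f
  let ?A = "keys p \<union> keys q"
  have "keys (p + q) \<subseteq> ?A" by (rule keys_add)
  then show "lext g (p + q) = lext g p + lext g q"
    by (simp add: lext_superset[of ?A] lookup_add fv.scale_left_distrib sum.distrib)
  have "keys (smul a p) \<subseteq> keys p" by (auto simp: in_keys_iff)
  then show "lext g (smul a p) = smul a (lext g p)"
    by (simp add: lext_superset[of "keys p"] fv.scale_sum_right)
qed

lemma lext_delta [simp]: "lext g (delta b) = g b"
  by (simp add: lext_def)

lemma lext_cong: "p \<in> fsub S \<Longrightarrow> (\<And>b. b \<in> S \<Longrightarrow> g b = h b) \<Longrightarrow> lext g p = lext h p"
  by (auto simp: lext_def fsub_def intro!: sum.cong)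

lemma lext_lin: "lin f \<Longrightarrow> f (lext g p) = lext (\<lambda>b. f (g b)) p"
  by (simp add: lext_def lin_sum lin_scale)

definition restr :: "'b set \<Rightarrow> ('b \<Rightarrow>\<^sub>0 'f::field) \<Rightarrow> ('b \<Rightarrow>\<^sub>0 'f)" where
  "restr S = lext (\<lambda>b. if b \<in> S then delta b else 0)"

lemma lookup_lext: "lookup (lext g p) c = (\<Sum>b\<in>keys p. lookup p b * lookup (g b) c)"
  by (simp add: lext_def lookup_sum)

lemma lookup_restr: "lookup (restr S p) b = (if b \<in> S then lookup p b else 0)"
proof -
  have "lookup p x * lookup (if x \<in> S then delta x else 0) b =
      (if x = b then (if b \<in> S then lookup p b else 0) else 0)" for x
    by (auto simp: lookup_single when_def)
  then show ?thesis
    by (simp add: restr_def lookup_lext in_keys_iff)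
qed

lemma lin_restr: "lin (restr S)"
  unfolding restr_def by (rule lin_lext)

lemma restr_fsub: "restr S p \<in> fsub S"
  by (rule fsubI) (auto simp: lookup_restr split: if_splits)

lemma restr_fsub': "p \<in> fsub T \<Longrightarrow> restr S p \<in> fsub (T \<inter> S)"
  by (rule fsubI) (auto simp: lookup_restr split: if_splits dest: fsubD)

lemma restr_id: "p \<in> fsub S \<Longrightarrow> restr S p = p"
  by (rule poly_mapping_eqI) (auto simp: lookup_restr dest: fsubD)

lemma restr_delta: "restr S (delta b) = (if b \<in> S then delta b else 0)"
  by (simp add: restr_def)

lemma restr_split: "p = restr S p + restr (- S) p"
  by (rule poly_mapping_eqI) (auto simp: lookup_restr lookup_add)

text \<open>If \<open>g\<close> projects onto \<open>N\<close>, then \<open>x - g x\<close> vanishes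
  exactly on \<open>N\<close>. The values stay in the same free space, so membership in
  \<open>N\<close> can be tested by a linear map without forming a quotient.\<close>

lemma subspace_kernel:
  fixes N :: "('b \<Rightarrow>\<^sub>0 'f::field) set"
  assumes "fv.subspace N"
  obtains \<rho> :: "('b \<Rightarrow>\<^sub>0 'f) \<Rightarrow> ('b \<Rightarrow>\<^sub>0 'f)" where "lin \<rho>" "\<And>x. \<rho> x = 0 \<longleftrightarrow> x \<in> N"
proof -
  obtain g :: "('b \<Rightarrow>\<^sub>0 'f) \<Rightarrow> ('b \<Rightarrow>\<^sub>0 'f)" where g: "range g \<subseteq> N" "lin g" "\<forall>v\<in>N. g v = v"
    using fvp.linear_exists_left_inverse_on[OF lin_ident assms] by auto
  show thesis
  proof
    show "lin (\<lambda>x. x - g x)" using g(2) by (intro lin_minus lin_ident)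
    show "x - g x = 0 \<longleftrightarrow> x \<in> N" for x using g by auto
  qed
qed

text \<open>The tensor product of free spaces, modelled as the free space on pairs of basis
  elements. It is used for chains; the tensor products of homology spaces are those of
  \<open>tensor_module\<close>.\<close>

definition tens :: "('b \<Rightarrow>\<^sub>0 'f::field) \<Rightarrow> ('c \<Rightarrow>\<^sub>0 'f) \<Rightarrow> ('b \<times> 'c \<Rightarrow>\<^sub>0 'f)" where
  "tens p q = lext (\<lambda>b. lext (\<lambda>c. delta (b, c)) q) p"

lemma lookup_tens: "lookup (tens p q) (b, c) = lookup p b * lookup q c"
proof -
  have "lookup (lext (\<lambda>c. delta (b', c)) q) (b, c) = (lookup q c when b' = b)" for b'
    by (cases "b' = b")
       (auto simp: lookup_lext lookup_single when_def in_keys_iff if_distrib[of "\<lambda>z. _ * z"]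
        cong: if_cong)
  then show ?thesis
    by (auto simp: tens_def lookup_lext when_def in_keys_iff if_distrib[of "\<lambda>z. _ * z"] cong: if_cong)
qed

lemma tens_delta [simp]: "tens (delta b) (delta c) = delta (b, c)"
  by (simp add: tens_def)

lemma lin_tens_left: "lin (\<lambda>p. tens p q)"
  unfolding tens_def by (rule lin_lext)

lemma lin_tens_right: "lin (tens p)"
  by (rule linI) (auto intro!: poly_mapping_eqI simp: lookup_tens lookup_add algebra_simps)

lemmas tens_add_left = lin_add[OF lin_tens_left] and tens_add_right = lin_add[OF lin_tens_right]
  and tens_smul_left = lin_scale[OF lin_tens_left] and tens_smul_right = lin_scale[OF lin_tens_right]
  and tens_diff_left = lin_diff[OF lin_tens_left] and tens_diff_right = lin_diff[OF lin_tens_right]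
  and tens_0_left [simp] = lin_0[OF lin_tens_left] and tens_0_right [simp] = lin_0[OF lin_tens_right]
  and tens_neg_left = lin_neg[OF lin_tens_left]

lemma tens_fsub: "p \<in> fsub S \<Longrightarrow> q \<in> fsub T \<Longrightarrow> tens p q \<in> fsub (S \<times> T)"
  by (rule fsubI) (auto simp: lookup_tens split: prod.splits dest: fsubD)

lemma lext_tens:
  assumes "\<And>q. lin (\<lambda>p. g p q)" "\<And>p. lin (g p)"
  shows "lext (\<lambda>(b, c). g (delta b) (delta c)) (tens p q) = g p q"
proof -
  let ?h = "lext (\<lambda>(b, c). g (delta b) (delta c))"
  have *: "?h (tens (delta b) q) = g (delta b) q" for b
    by (rule lin_eq[OF lin_comp[OF lin_lext lin_tens_right] assms(2)]) simp
  show ?thesis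
    by (rule lin_eq[OF lin_comp[OF lin_lext lin_tens_left] assms(1)]) (rule *)
qed

definition tmap ::
    "(('b \<Rightarrow>\<^sub>0 'f::field) \<Rightarrow> ('c \<Rightarrow>\<^sub>0 'f)) \<Rightarrow> (('d \<Rightarrow>\<^sub>0 'f) \<Rightarrow> ('e \<Rightarrow>\<^sub>0 'f)) \<Rightarrow> ('b \<times> 'd \<Rightarrow>\<^sub>0 'f) \<Rightarrow> ('c \<times> 'e \<Rightarrow>\<^sub>0 'f)"
  where "tmap f g = lext (\<lambda>(b, c). tens (f (delta b)) (g (delta c)))"

lemma lin_tmap: "lin (tmap f g)"
  unfolding tmap_def by (rule lin_lext)

lemma tmap_tens: "lin f \<Longrightarrow> lin g \<Longrightarrow> tmap f g (tens p q) = tens (f p) (g q)"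
  unfolding tmap_def
  by (rule lext_tens) (auto intro: lin_comp[OF lin_tens_left] lin_comp[OF lin_tens_right])


section \<open>Quotients of function spaces\<close>

text \<open>Linear subspaces of a full function space, a form common to alternating chains on lists
  and to the elements of \<open>free_module\<close>.\<close>

definition fspace :: "('b \<Rightarrow> 'f::field) set \<Rightarrow> bool" where
  "fspace V \<longleftrightarrow> (\<lambda>_. 0) \<in> V \<and> (\<forall>x\<in>V. \<forall>y\<in>V. (\<lambda>t. x t + y t) \<in> V) \<and> (\<forall>a. \<forall>x\<in>V. (\<lambda>t. a * x t) \<in> V)"

lemma fspaceI:
  assumes "(\<lambda>_. 0) \<in> V" "\<And>x y. x \<in> V \<Longrightarrow> y \<in> V \<Longrightarrow> (\<lambda>t. x t + y t) \<in> V"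
    "\<And>a x. x \<in> V \<Longrightarrow> (\<lambda>t. a * x t) \<in> V"
  shows "fspace V"
  using assms by (simp add: fspace_def)

lemma
  assumes "fspace V"
  shows fspace_zero: "(\<lambda>_. 0) \<in> V"
    and fspace_add: "x \<in> V \<Longrightarrow> y \<in> V \<Longrightarrow> (\<lambda>t. x t + y t) \<in> V"
    and fspace_smult: "x \<in> V \<Longrightarrow> (\<lambda>t. a * x t) \<in> V"
    and fspace_neg: "x \<in> V \<Longrightarrow> (\<lambda>t. - x t) \<in> V"
    and fspace_diff: "x \<in> V \<Longrightarrow> y \<in> V \<Longrightarrow> (\<lambda>t. x t - y t) \<in> V"
proof -
  show 1: "(\<lambda>_. 0) \<in> V" "x \<in> V \<Longrightarrow> y \<in> V \<Longrightarrow> (\<lambda>t. x t + y t) \<in> V"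
    "x \<in> V \<Longrightarrow> (\<lambda>t. a * x t) \<in> V" for x y a
    using assms by (auto simp: fspace_def)
  show 2: "x \<in> V \<Longrightarrow> (\<lambda>t. - x t) \<in> V" for x
    using 1(3)[of x "-1"] by simp
  show "x \<in> V \<Longrightarrow> y \<in> V \<Longrightarrow> (\<lambda>t. x t - y t) \<in> V"
    using 1(2)[OF _ 2, of x y] by simp
qed

definition fcoset :: "('b \<Rightarrow> 'f::field) set \<Rightarrow> ('b \<Rightarrow> 'f) \<Rightarrow> ('b \<Rightarrow> 'f) set" where
  "fcoset N x = (\<lambda>n t. n t + x t) ` N"

lemma fun_module_simps:
  "carrier (fun_module V) = V" "zero (fun_module V) = (\<lambda>_. 0)"
  "x \<oplus>\<^bsub>fun_module V\<^esub> y = (\<lambda>t. x t + y t)" "a \<odot>\<^bsub>fun_module V\<^esub> x = (\<lambda>t. a * x t)"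
  by (simp_all add: fun_module_def mk_module_def)

lemma a_r_coset_fun_module: "N +>\<^bsub>fun_module V\<^esub> x = fcoset N x"
  by (auto simp: a_r_coset_def' fun_module_simps fcoset_def)

context
  fixes V N :: "('b \<Rightarrow> 'f::field) set"
  assumes V: "fspace V" and N: "fspace N" and NV: "N \<subseteq> V"
begin

lemma mem_fcoset_iff: "y \<in> fcoset N x \<longleftrightarrow> (\<lambda>t. y t - x t) \<in> N"
proof
  assume "(\<lambda>t. y t - x t) \<in> N"
  then show "y \<in> fcoset N x"
    unfolding fcoset_def by (intro image_eqI[of _ _ "\<lambda>t. y t - x t"]) auto
qed (auto simp: fcoset_def)

lemma mem_fcoset_self: "x \<in> fcoset N x"
  using fspace_zero[OF N] by (simp add: mem_fcoset_iff)

lemma fcoset_eq_iff: "fcoset N x = fcoset N y \<longleftrightarrow> (\<lambda>t. x t - y t) \<in> N"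
proof
  assume "fcoset N x = fcoset N y"
  then show "(\<lambda>t. x t - y t) \<in> N"
    using mem_fcoset_self[of x] mem_fcoset_iff by blast
next
  assume *: "(\<lambda>t. x t - y t) \<in> N"
  have "(\<lambda>t. z t - x t) \<in> N \<longleftrightarrow> (\<lambda>t. z t - y t) \<in> N" for z
    using fspace_add[OF N _ *, of "\<lambda>t. z t - x t"] fspace_diff[OF N _ *, of "\<lambda>t. z t - y t"] by auto
  then show "fcoset N x = fcoset N y"
    by (auto simp: mem_fcoset_iff)
qed

lemma carrier_quot: "carrier (quot_module (fun_module V) N) = fcoset N ` V"
  by (auto simp: quot_module_def mk_module_def A_RCOSETS_def' a_r_coset_fun_module fun_module_simps)

lemma add_quot: "fcoset N x \<oplus>\<^bsub>quot_module (fun_module V) N\<^esub> fcoset N y = fcoset N (\<lambda>t. x t + y t)"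
proof -
  have "z \<in> (\<Union>h\<in>fcoset N x. \<Union>k\<in>fcoset N y. {\<lambda>t. h t + k t}) \<longleftrightarrow> z \<in> fcoset N (\<lambda>t. x t + y t)" for z
  proof
    assume "z \<in> (\<Union>h\<in>fcoset N x. \<Union>k\<in>fcoset N y. {\<lambda>t. h t + k t})"
    then obtain h k where "h \<in> fcoset N x" "k \<in> fcoset N y" and z: "z = (\<lambda>t. h t + k t)" by auto
    then have "(\<lambda>t. (h t - x t) + (k t - y t)) \<in> N"
      by (intro fspace_add[OF N]) (auto simp: mem_fcoset_iff)
    then show "z \<in> fcoset N (\<lambda>t. x t + y t)" by (simp add: mem_fcoset_iff z algebra_simps)
  next
    assume "z \<in> fcoset N (\<lambda>t. x t + y t)"
    then have "(\<lambda>t. z t - y t) \<in> fcoset N x" by (simp add: mem_fcoset_iff algebra_simps)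
    moreover have "z = (\<lambda>t. (z t - y t) + y t)" by simp
    ultimately show "z \<in> (\<Union>h\<in>fcoset N x. \<Union>k\<in>fcoset N y. {\<lambda>t. h t + k t})"
      using mem_fcoset_self[of y] by blast
  qed
  then show ?thesis
    by (simp add: quot_module_def mk_module_def set_add_def' fun_module_simps set_eq_iff)
qed

lemma UN_constant_eq: "x \<in> A \<Longrightarrow> (\<And>y. y \<in> A \<Longrightarrow> F y = C) \<Longrightarrow> (\<Union>y\<in>A. F y) = C"
  by (simp add: UN_constant split: if_splits) blast

text \<open>The scalar multiple in \<open>quot_module\<close> is a union over all representatives.
  They all give the same coset, and a coset is nonempty, so the union collapses. The same argument
  serves \<open>quot_map\<close> below.\<close>

lemma smult_quot: "a \<odot>\<^bsub>quot_module (fun_module V) N\<^esub> fcoset N x = fcoset N (\<lambda>t. a * x t)"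
proof -
  have "fcoset N (\<lambda>t. a * y t) = fcoset N (\<lambda>t. a * x t)" if "y \<in> fcoset N x" for y
    using fspace_smult[OF N, of "\<lambda>t. y t - x t" a] that
    by (simp add: fcoset_eq_iff mem_fcoset_iff right_diff_distrib)
  with mem_fcoset_self[of x] have "(\<Union>y\<in>fcoset N x. fcoset N (\<lambda>t. a * y t)) = fcoset N (\<lambda>t. a * x t)"
    by (rule UN_constant_eq)
  then show ?thesis
    by (simp add: quot_module_def mk_module_def fun_module_simps a_r_coset_fun_module)
qed

lemma quot_map_fcoset:
  assumes N': "fspace N'" and f: "\<And>y. y \<in> fcoset N x \<Longrightarrow> (\<lambda>t. f y t - f x t) \<in> N'"
  shows "quot_map (fun_module V') N' f (fcoset N x) = fcoset N' (f x)"
proof -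
  have "fcoset N' (f y) = fcoset N' (f x)" if "y \<in> fcoset N x" for y
  proof -
    have "z \<in> fcoset N' (f y) \<longleftrightarrow> z \<in> fcoset N' (f x)" for z
    proof -
      have m: "w \<in> fcoset N' u \<longleftrightarrow> (\<lambda>t. w t - u t) \<in> N'" for w u
        by (auto simp: fcoset_def intro!: image_eqI[of _ _ "\<lambda>t. w t - u t"])
      show ?thesis
        using fspace_add[OF N' _ f[OF that], of "\<lambda>t. z t - f y t"]
          fspace_diff[OF N' _ f[OF that], of "\<lambda>t. z t - f x t"]
        by (auto simp: m)
    qed
    then show ?thesis by blast
  qed
  with mem_fcoset_self[of x] have "(\<Union>y\<in>fcoset N x. fcoset N' (f y)) = fcoset N' (f x)"
    by (rule UN_constant_eq)
  then show ?thesis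
    by (simp add: quot_map_def a_r_coset_fun_module)
qed

end

text \<open>Closure under negation, which \<open>subgroup\<close> demands, is scaling by -1.\<close>

lemma submodule_fun_module_iff:
  assumes V: "fspace V"
  shows "submodule H ring_of_type_algebra (fun_module V) \<longleftrightarrow> H \<subseteq> V \<and> fspace H"
proof -
  let ?G = "add_monoid (fun_module V)"
  have grp: "group ?G"
  proof (rule groupI)
    show "\<exists>y\<in>carrier ?G. y \<otimes>\<^bsub>?G\<^esub> x = \<one>\<^bsub>?G\<^esub>" if "x \<in> carrier ?G" for x
      using that fspace_neg[OF V, of x]
      by (intro bexI[of _ "\<lambda>t. - x t"]) (auto simp: fun_module_simps)
  qed (use V in \<open>auto simp: fun_module_simps fspace_zero fspace_add add.assoc\<close>)
  have inv: "inv\<^bsub>?G\<^esub> x = (\<lambda>t. - x t)" if "x \<in> V" for x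
    using that fspace_neg[OF V, of x]
    by (intro group.inv_equality[OF grp]) (auto simp: fun_module_simps)
  have "carrier (ring_of_type_algebra :: 'b ring) = UNIV"
    by (simp add: ring_of_type_algebra_def)
  then have "submodule H ring_of_type_algebra (fun_module V) \<longleftrightarrow>
      subgroup H ?G \<and> (\<forall>a. \<forall>x\<in>H. (\<lambda>t. a * x t) \<in> H)"
    by (auto simp: submodule_def submodule_axioms_def fun_module_simps)
  also have "\<dots> \<longleftrightarrow> H \<subseteq> V \<and> fspace H"
  proof
    assume *: "subgroup H ?G \<and> (\<forall>a. \<forall>x\<in>H. (\<lambda>t. a * x t) \<in> H)"
    then show "H \<subseteq> V \<and> fspace H"
      using subgroup.subset[of H ?G] subgroup.m_closed[of H ?G] subgroup.one_closed[of H ?G]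
      by (auto simp: fun_module_simps fspace_def)
  next
    assume *: "H \<subseteq> V \<and> fspace H"
    then show "subgroup H ?G \<and> (\<forall>a. \<forall>x\<in>H. (\<lambda>t. a * x t) \<in> H)"
      by (intro conjI subgroup.intro allI ballI)
        (auto simp: inv fspace_neg fspace_smult, auto simp: fun_module_simps fspace_add fspace_zero)
  qed
  finally show ?thesis .
qed

lemma fspace_lookup_iff: "fspace (lookup ` W) \<longleftrightarrow> fv.subspace W"
proof -
  have l: "(\<lambda>_. 0) = lookup 0" "(\<lambda>t. lookup p t + lookup q t) = lookup (p + q)"
    "(\<lambda>t. a * lookup p t) = lookup (smul a p)" for p q :: "'a \<Rightarrow>\<^sub>0 'b" and a
    by (auto simp: lookup_add)
  have inj: "inj (lookup :: ('a \<Rightarrow>\<^sub>0 'b) \<Rightarrow> _)"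
    by (auto intro!: injI poly_mapping_eqI)
  show ?thesis
    by (simp add: fspace_def fv.subspace_def l inj_image_mem_iff[OF inj])
qed

lemma inj_lookup: "lookup p = lookup q \<Longrightarrow> p = q"
  by (auto intro!: poly_mapping_eqI)

lemma free_module_eq: "free_module S = fun_module (lookup ` fsub S)"
proof -
  have "c \<in> lookup ` fsub S" if "finite {x. c x \<noteq> 0}" "{x. c x \<noteq> 0} \<subseteq> S" for c :: "'a \<Rightarrow> 'b"
    using that by (intro image_eqI[of _ _ "Abs_poly_mapping c"]) (auto intro!: fsubI)
  then have "{c. finite {x. c x \<noteq> 0} \<and> {x. c x \<noteq> 0} \<subseteq> S} = lookup ` (fsub S :: ('a \<Rightarrow>\<^sub>0 'b) set)"
    by (auto dest: fsubD)
  then show ?thesis by (simp add: free_module_def)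
qed

lemma gen_eq: "gen b = lookup (delta b)"
  by (auto simp: gen_def lookup_single when_def)

lemma free_map_lookup: "free_map h (lookup p) = lookup (lext (\<lambda>b. delta (h b)) p)"
proof
  fix y
  have "lookup (lext (\<lambda>b. delta (h b)) p) y = (\<Sum>b\<in>keys p. if h b = y then lookup p b else 0)"
    by (auto simp: lookup_lext lookup_single when_def intro!: sum.cong)
  also have "\<dots> = (\<Sum>b\<in>{b \<in> keys p. h b = y}. lookup p b)"
    by (rule sum.inter_filter[symmetric]) simp
  also have "{b \<in> keys p. h b = y} = {x. lookup p x \<noteq> 0 \<and> h x = y}"
    by (auto simp: in_keys_iff)
  finally show "free_map h (lookup p) y = lookup (lext (\<lambda>b. delta (h b)) p) y"
    by (simp add: free_map_def)
qed


section \<open>Tensor products\<close>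

definition tnull :: "('f::field, 'v) module \<Rightarrow> ('f, 'w) module \<Rightarrow> ('v \<times> 'w \<Rightarrow>\<^sub>0 'f) set" where
  "tnull M N = {p. lookup p \<in> tensor_null M N}"

definition trel :: "('f::field, 'v) module \<Rightarrow> ('f, 'w) module \<Rightarrow> ('v \<times> 'w \<Rightarrow>\<^sub>0 'f) set" where
  "trel M N =
     {delta (x \<oplus>\<^bsub>M\<^esub> x', y) - delta (x, y) - delta (x', y) | x x' y.
        x \<in> carrier M \<and> x' \<in> carrier M \<and> y \<in> carrier N} \<union>
     {delta (x, y \<oplus>\<^bsub>N\<^esub> y') - delta (x, y) - delta (x, y') | x y y'.
        x \<in> carrier M \<and> y \<in> carrier N \<and> y' \<in> carrier N} \<union>
     {delta (a \<odot>\<^bsub>M\<^esub> x, y) - smul a (delta (x, y)) | a x y.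
        x \<in> carrier M \<and> y \<in> carrier N} \<union>
     {delta (x, a \<odot>\<^bsub>N\<^esub> y) - smul a (delta (x, y)) | a x y.
        x \<in> carrier M \<and> y \<in> carrier N}"

lemma tensor_relators_eq:
  fixes M :: "('a::field, 'b) module" and N :: "('a, 'c) module"
  shows "tensor_relators M N = lookup ` trel M N"
proof -
  have 1: "(\<lambda>z. gen a z - gen b z - gen c z) = lookup (delta a - delta b - delta c)"
    for a b c :: "'b \<times> 'c"
    by (simp add: gen_eq lookup_minus fun_eq_iff)
  have 2: "(\<lambda>z. gen b z - a * gen c z) = lookup (delta b - smul a (delta c))"
    for a and b c :: "'b \<times> 'c"
    by (simp add: gen_eq lookup_minus fun_eq_iff)
  show ?thesis
    unfolding tensor_relators_def trel_def image_Un 1 2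
    by (intro arg_cong2[where f = "(\<union>)"]) (auto simp: image_iff)
qed

text \<open>Closure of the operations is what puts every relator into the free space on
  pairs.\<close>

locale tensor_setting =
  fixes M :: "('f::field, 'v) module" and N :: "('f, 'w) module"
  assumes add_closed: "x \<in> carrier M \<Longrightarrow> x' \<in> carrier M \<Longrightarrow> x \<oplus>\<^bsub>M\<^esub> x' \<in> carrier M"
      "y \<in> carrier N \<Longrightarrow> y' \<in> carrier N \<Longrightarrow> y \<oplus>\<^bsub>N\<^esub> y' \<in> carrier N"
    and smult_closed: "x \<in> carrier M \<Longrightarrow> a \<odot>\<^bsub>M\<^esub> x \<in> carrier M"
      "y \<in> carrier N \<Longrightarrow> a \<odot>\<^bsub>N\<^esub> y \<in> carrier N"
begin

lemma trel_fsub: "trel M N \<subseteq> fsub (carrier M \<times> carrier N)"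
  unfolding trel_def
  by (auto intro!: fsub_diff fsub_smul simp: add_closed smult_closed)

lemma tensor_null_eq: "tensor_null M N = lookup ` tnull M N"
  and subspace_tnull: "fv.subspace (tnull M N)"
  and trel_tnull: "trel M N \<subseteq> tnull M N"
  and tnull_fsub: "tnull M N \<subseteq> fsub (carrier M \<times> carrier N)"
  and tnull_least: "fv.subspace W \<Longrightarrow> trel M N \<subseteq> W \<Longrightarrow> tnull M N \<subseteq> W"
proof -
  let ?S = "carrier M \<times> carrier N"
  have V: "fspace (lookup ` (fsub ?S :: (_ \<Rightarrow>\<^sub>0 'f) set))"
    by (simp add: fspace_lookup_iff subspace_fsub)
  let ?HH = "{H. H \<subseteq> lookup ` (fsub ?S :: (_ \<Rightarrow>\<^sub>0 'f) set) \<and> fspace H \<and> lookup ` trel M N \<subseteq> H}"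
  have T: "tensor_null M N = \<Inter>?HH"
    unfolding tensor_null_def submodule_generated_def free_module_eq submodule_fun_module_iff[OF V]
      tensor_relators_eq by (rule arg_cong[of _ _ Inter]) auto
  \<comment> \<open>The whole free space is one of the competing submodules, so the intersection is
    not taken over an empty family.\<close>
  have mem: "lookup ` fsub ?S \<in> ?HH"
    using trel_fsub V by auto
  have sub: "tensor_null M N \<subseteq> lookup ` fsub ?S"
    unfolding T using mem by (rule Inter_lower)
  then show eq: "tensor_null M N = lookup ` tnull M N"
    by (auto simp: tnull_def)
  have "fspace (tensor_null M N)"
    unfolding T by (auto simp: fspace_def)
  then show "fv.subspace (tnull M N)"
    by (simp add: eq fspace_lookup_iff)
  show "trel M N \<subseteq> tnull M N"
    by (auto simp: tnull_def T)
  show "tnull M N \<subseteq> fsub ?S"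
    using sub by (auto simp: tnull_def dest!: subsetD inj_lookup)
  show "tnull M N \<subseteq> W" if W: "fv.subspace W" "trel M N \<subseteq> W" for W
  proof -
    \<comment> \<open>Cutting \<open>W\<close> down to the free space makes it one of the submodules
      in the intersection.\<close>
    have "fv.subspace (W \<inter> fsub ?S)"
      using W(1) subspace_fsub by (rule fv.subspace_inter)
    then have "lookup ` (W \<inter> fsub ?S) \<in> ?HH"
      using W(2) trel_fsub by (auto simp: fspace_lookup_iff)
    then have "tensor_null M N \<subseteq> lookup ` (W \<inter> fsub ?S)"
      unfolding T by (rule Inter_lower)
    then show ?thesis
      by (auto simp: tnull_def dest!: subsetD inj_lookup)
  qed
qed

definition tcos :: "('v \<times> 'w \<Rightarrow>\<^sub>0 'f) \<Rightarrow> ('v \<times> 'w \<Rightarrow> 'f) set" where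
  "tcos p = fcoset (tensor_null M N) (lookup p)"

lemma fspace_free: "fspace (lookup ` (fsub S :: ('x \<Rightarrow>\<^sub>0 'f) set))"
  by (simp add: fspace_lookup_iff subspace_fsub)

lemma fspace_null: "fspace (tensor_null M N)"
  by (simp add: tensor_null_eq fspace_lookup_iff subspace_tnull)

lemma null_sub: "tensor_null M N \<subseteq> lookup ` fsub (carrier M \<times> carrier N)"
  using tnull_fsub by (auto simp: tensor_null_eq)

lemma tensor_module_eq:
  "tensor_module M N = quot_module (fun_module (lookup ` fsub (carrier M \<times> carrier N))) (tensor_null M N)"
  by (simp add: tensor_module_def free_module_eq)

lemmas null_hyps = fspace_free[of "carrier M \<times> carrier N"] fspace_null null_sub

lemma carrier_tensor: "carrier (tensor_module M N) = tcos ` fsub (carrier M \<times> carrier N)"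
  by (auto simp: tensor_module_eq carrier_quot[OF null_hyps] tcos_def)

lemma add_tensor: "tcos p \<oplus>\<^bsub>tensor_module M N\<^esub> tcos q = tcos (p + q)"
  by (simp add: tensor_module_eq tcos_def add_quot[OF null_hyps] lookup_add)
    (simp add: lookup_add[abs_def] plus_poly_mapping.rep_eq)

lemma smult_tensor: "a \<odot>\<^bsub>tensor_module M N\<^esub> tcos p = tcos (smul a p)"
proof -
  have "(\<lambda>t. a * lookup p t) = lookup (smul a p)" by auto
  then show ?thesis
    by (simp add: tensor_module_eq tcos_def smult_quot[OF null_hyps])
qed

lemma tcos_eq_iff: "tcos p = tcos q \<longleftrightarrow> p - q \<in> tnull M N"
proof -
  have "(\<lambda>t. lookup p t - lookup q t) = lookup (p - q)" by (auto simp: lookup_minus)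
  then show ?thesis
    by (simp add: tcos_def fcoset_eq_iff[OF null_hyps] tnull_def)
qed

end

text \<open>Linearity of \<open>f\<close> and \<open>g\<close> sends relators to relators, hence the
  null space into the null space because it is the least subspace containing the relators. The map
  on cosets is therefore computed on any representative.\<close>

lemma tensor_map_tcos:
  fixes M :: "('f::field, 'v) module" and N :: "('f, 'w) module"
    and M' :: "('f, 'v') module" and N' :: "('f, 'w') module"
  assumes "tensor_setting M N" "tensor_setting M' N'"
    and f: "\<And>x. x \<in> carrier M \<Longrightarrow> f x \<in> carrier M'"
      "\<And>x y. x \<in> carrier M \<Longrightarrow> y \<in> carrier M \<Longrightarrow> f (x \<oplus>\<^bsub>M\<^esub> y) = f x \<oplus>\<^bsub>M'\<^esub> f y"
      "\<And>a x. x \<in> carrier M \<Longrightarrow> f (a \<odot>\<^bsub>M\<^esub> x) = a \<odot>\<^bsub>M'\<^esub> f x"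
    and g: "\<And>x. x \<in> carrier N \<Longrightarrow> g x \<in> carrier N'"
      "\<And>x y. x \<in> carrier N \<Longrightarrow> y \<in> carrier N \<Longrightarrow> g (x \<oplus>\<^bsub>N\<^esub> y) = g x \<oplus>\<^bsub>N'\<^esub> g y"
      "\<And>a x. x \<in> carrier N \<Longrightarrow> g (a \<odot>\<^bsub>N\<^esub> x) = a \<odot>\<^bsub>N'\<^esub> g x"
  shows "tensor_map M' N' f g (tensor_setting.tcos M N p) =
    tensor_setting.tcos M' N' (lext (\<lambda>(m, n). delta (f m, g n)) p)"
proof -
  interpret A: tensor_setting M N by fact
  interpret B: tensor_setting M' N' by fact
  let ?h = "lext (\<lambda>(m, n). delta (f m, g n) :: _ \<Rightarrow>\<^sub>0 'f)"
  have fm: "free_map (map_prod f g) (lookup q) = lookup (?h q)" for q :: "_ \<Rightarrow>\<^sub>0 'f"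
    by (simp add: free_map_lookup case_prod_unfold map_prod_def)
  have "tnull M N \<subseteq> {q. ?h q \<in> tnull M' N'}"
  proof (rule A.tnull_least)
    show "fv.subspace {q. ?h q \<in> tnull M' N'}"
      using B.subspace_tnull
      by (auto simp: fv.subspace_def lin_0[OF lin_lext] lin_add[OF lin_lext] lin_scale[OF lin_lext])
    have "?h q \<in> trel M' N'" if "q \<in> trel M N" for q
      using that unfolding trel_def
      apply (elim UnE CollectE exE conjE)
         apply (simp_all add: lin_diff[OF lin_lext] lin_scale[OF lin_lext] f g)
         apply (use f(1) g(1) in blast)+
      done
    then show "trel M N \<subseteq> {q. ?h q \<in> tnull M' N'}"
      using B.trel_tnull by auto
  qed
  note null = this
  have "tensor_map M' N' f g (fcoset (tensor_null M N) (lookup p)) =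
      fcoset (tensor_null M' N') (free_map (map_prod f g) (lookup p))"
    unfolding tensor_map_def free_module_eq
  proof (rule quot_map_fcoset[OF A.null_hyps B.fspace_null])
    fix y assume "y \<in> fcoset (tensor_null M N) (lookup p)"
    then obtain n where n: "n \<in> tnull M N" "y = (\<lambda>t. lookup n t + lookup p t)"
      by (auto simp: fcoset_def A.tensor_null_eq)
    then have y: "y = lookup (n + p)" by (auto simp: lookup_add)
    have "(\<lambda>t. free_map (map_prod f g) y t - free_map (map_prod f g) (lookup p) t) = lookup (?h n)"
      unfolding y fm by (simp add: lin_add[OF lin_lext] lookup_add fun_eq_iff)
    then show "(\<lambda>t. free_map (map_prod f g) y t - free_map (map_prod f g) (lookup p) t)
        \<in> tensor_null M' N'"
      using null n(1) by (auto simp: tnull_def)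
  qed
  then show ?thesis
    by (simp add: A.tcos_def B.tcos_def fm)
qed


section \<open>Presentations by subspaces of free vector spaces\<close>

text \<open>A module as the image of a space of representatives under a map with kernel
  \<open>K\<close>. Representatives in one free space can be compared across parameters, whereas the
  cosets that form \<open>M\<close> change with the parameter.\<close>

locale presentation =
  fixes V K :: "('b \<Rightarrow>\<^sub>0 'f::field) set" and \<pi> :: "('b \<Rightarrow>\<^sub>0 'f) \<Rightarrow> 'v" and M :: "('f, 'v) module"
  assumes subspace_V: "fv.subspace V" and subspace_K: "fv.subspace K" and K_sub: "K \<subseteq> V"
    and \<pi>_surj: "\<pi> ` V = carrier M"
    and \<pi>_add: "\<And>x y. x \<in> V \<Longrightarrow> y \<in> V \<Longrightarrow> \<pi> (x + y) = \<pi> x \<oplus>\<^bsub>M\<^esub> \<pi> y"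
    and \<pi>_smul: "\<And>a x. x \<in> V \<Longrightarrow> \<pi> (smul a x) = a \<odot>\<^bsub>M\<^esub> \<pi> x"
    and \<pi>_eq: "\<And>x y. x \<in> V \<Longrightarrow> y \<in> V \<Longrightarrow> \<pi> x = \<pi> y \<longleftrightarrow> x - y \<in> K"
begin

definition rep :: "'v \<Rightarrow> ('b \<Rightarrow>\<^sub>0 'f)" where
  "rep m = (SOME x. x \<in> V \<and> \<pi> x = m)"

lemma rep: "m \<in> carrier M \<Longrightarrow> rep m \<in> V" "m \<in> carrier M \<Longrightarrow> \<pi> (rep m) = m"
proof -
  have "rep m \<in> V \<and> \<pi> (rep m) = m" if "m \<in> carrier M"
    unfolding rep_def by (rule someI_ex) (use that in \<open>force simp flip: \<pi>_surj\<close>)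
  then show "m \<in> carrier M \<Longrightarrow> rep m \<in> V" "m \<in> carrier M \<Longrightarrow> \<pi> (rep m) = m" by auto
qed

lemma \<pi>_carrier: "x \<in> V \<Longrightarrow> \<pi> x \<in> carrier M"
  using \<pi>_surj by auto

lemma add_closed: "x \<in> carrier M \<Longrightarrow> y \<in> carrier M \<Longrightarrow> x \<oplus>\<^bsub>M\<^esub> y \<in> carrier M"
  using \<pi>_add[of "rep x" "rep y"] \<pi>_carrier[of "rep x + rep y"]
  by (simp add: rep fv.subspace_add[OF subspace_V])

lemma smult_closed: "x \<in> carrier M \<Longrightarrow> a \<odot>\<^bsub>M\<^esub> x \<in> carrier M"
  using \<pi>_smul[of "rep x" a] \<pi>_carrier[of "smul a (rep x)"]
  by (simp add: rep fv.subspace_scale[OF subspace_V])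

end

section \<open>Bilinear maps and tensor products of presented modules\<close>

definition bilin :: "('b \<Rightarrow>\<^sub>0 'f::field) set \<Rightarrow> ('c \<Rightarrow>\<^sub>0 'f) set \<Rightarrow>
    (('b \<Rightarrow>\<^sub>0 'f) \<Rightarrow> ('c \<Rightarrow>\<^sub>0 'f) \<Rightarrow> ('d \<Rightarrow>\<^sub>0 'f)) \<Rightarrow> bool" where
  "bilin V W g \<longleftrightarrow>
    (\<forall>x\<in>V. \<forall>x'\<in>V. \<forall>y\<in>W. g (x + x') y = g x y + g x' y) \<and>
    (\<forall>x\<in>V. \<forall>y\<in>W. \<forall>y'\<in>W. g x (y + y') = g x y + g x y') \<and>
    (\<forall>x\<in>V. \<forall>y\<in>W. \<forall>a. g (smul a x) y = smul a (g x y) \<and> g x (smul a y) = smul a (g x y))"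

locale presentation2 = M: presentation V K \<pi> M + M': presentation V' K' \<pi>' M'
  for V K :: "('b \<Rightarrow>\<^sub>0 'f::field) set" and \<pi> and M :: "('f, 'v) module"
    and V' K' :: "('c \<Rightarrow>\<^sub>0 'f) set" and \<pi>' and M' :: "('f, 'w) module"
begin

sublocale T: tensor_setting M M'
  by unfold_locales (simp_all add: M.add_closed M'.add_closed M.smult_closed M'.smult_closed)

text \<open>Both free spaces have pairs of vectors, not pairs of simplices, as their basis; no
  bilinearity has been imposed yet.\<close>

definition push :: "(('b \<Rightarrow>\<^sub>0 'f) \<times> ('c \<Rightarrow>\<^sub>0 'f) \<Rightarrow>\<^sub>0 'f) \<Rightarrow> ('v \<times> 'w \<Rightarrow>\<^sub>0 'f)" where
  "push = lext (\<lambda>(x, y). delta (\<pi> x, \<pi>' y))"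

lemma lin_push: "lin push"
  unfolding push_def by (rule lin_lext)

lemma push_fsub: "t \<in> fsub (V \<times> V') \<Longrightarrow> push t \<in> fsub (carrier M \<times> carrier M')"
  by (rule lin_fsub[OF lin_push]) (auto simp: push_def M.\<pi>_carrier M'.\<pi>_carrier)

lemma push_surj:
  assumes "p \<in> fsub (carrier M \<times> carrier M')"
  obtains t where "t \<in> fsub (V \<times> V')" "push t = p"
proof
  let ?t = "lext (\<lambda>(m, n). delta (M.rep m, M'.rep n)) p"
  show "?t \<in> fsub (V \<times> V')"
    by (rule lin_fsub[OF lin_lext _ assms]) (auto simp: M.rep M'.rep)
  show "push ?t = p"
    by (rule lin_eq_on[OF lin_comp[OF lin_push lin_lext] lin_ident _ assms])
      (auto simp: push_def M.rep M'.rep)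
qed

text \<open>The universal property of the tensor product, taken modulo \<open>W\<close>: a bilinear
  map that sends the kernels into \<open>W\<close> descends to classes modulo \<open>W\<close>. With
  \<open>W\<close> the space of boundaries this applies to the cross product before passing to
  homology.\<close>

lemma push_null_imp:
  assumes W: "fv.subspace W" and g: "bilin V V' g"
    and g0: "\<And>x y. x \<in> K \<Longrightarrow> y \<in> V' \<Longrightarrow> g x y \<in> W" "\<And>x y. x \<in> V \<Longrightarrow> y \<in> K' \<Longrightarrow> g x y \<in> W"
    and t: "t \<in> fsub (V \<times> V')" "push t \<in> tnull M M'"
  shows "lext (\<lambda>(x, y). g x y) t \<in> W"
proof -
  let ?G = "lext (\<lambda>(m, n). g (M.rep m) (M'.rep n))"
  note ss = M.subspace_V M'.subspace_V
  \<comment> \<open>Modulo \<open>W\<close> the value of \<open>g\<close> depends only on the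
    classes. The chosen representatives \<open>rep\<close> are not linear, but after
    \<open>g\<close> they behave bilinearly modulo \<open>W\<close>.\<close>
  have diff: "g x y - g x' y' \<in> W"
    if "x \<in> V" "x' \<in> V" "y \<in> V'" "y' \<in> V'" "\<pi> x = \<pi> x'" "\<pi>' y = \<pi>' y'" for x x' y y'
  proof -
    have d: "x - x' \<in> V" "y - y' \<in> V'"
      using that by (auto intro: fv.subspace_diff ss)
    have "g (x - x' + x') y = g (x - x') y + g x' y"
      "g x' (y - y' + y') = g x' (y - y') + g x' y'"
      using g that(1-4) d unfolding bilin_def by blast+
    then have "g x y - g x' y' = g (x - x') y + g x' (y - y')" by simp
    also have "\<dots> \<in> W"
      using that by (intro fv.subspace_add[OF W] g0) (auto simp: M.\<pi>_eq M'.\<pi>_eq)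
    finally show ?thesis .
  qed
  have "tnull M M' \<subseteq> {q. ?G q \<in> W}"
  proof (rule T.tnull_least)
    show "fv.subspace {q. ?G q \<in> W}"
      using W by (auto simp: fv.subspace_def lin_0[OF lin_lext] lin_add[OF lin_lext] lin_scale[OF lin_lext])
    show "trel M M' \<subseteq> {q. ?G q \<in> W}"
    proof
      fix q assume "q \<in> trel M M'"
      then show "q \<in> {q. ?G q \<in> W}"
        unfolding trel_def
      proof (elim UnE CollectE exE conjE)
        fix x x' y assume q: "q = delta (x \<oplus>\<^bsub>M\<^esub> x', y) - delta (x, y) - delta (x', y)"
          and x: "x \<in> carrier M" "x' \<in> carrier M" "y \<in> carrier M'"
        have "g (M.rep (x \<oplus>\<^bsub>M\<^esub> x')) (M'.rep y) - g (M.rep x + M.rep x') (M'.rep y) \<in> W"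
          using x by (intro diff) (simp_all add: M.rep M'.rep M.add_closed M.\<pi>_add fv.subspace_add[OF M.subspace_V])
        then show ?thesis
          using g x by (simp add: q lin_diff[OF lin_lext] bilin_def M.rep M'.rep lin_add[OF lin_lext] diff_diff_eq)
      next
        fix x y y' assume q: "q = delta (x, y \<oplus>\<^bsub>M'\<^esub> y') - delta (x, y) - delta (x, y')"
          and x: "x \<in> carrier M" "y \<in> carrier M'" "y' \<in> carrier M'"
        have "g (M.rep x) (M'.rep (y \<oplus>\<^bsub>M'\<^esub> y')) - g (M.rep x) (M'.rep y + M'.rep y') \<in> W"
          using x by (intro diff) (simp_all add: M.rep M'.rep M'.add_closed M'.\<pi>_add fv.subspace_add[OF M'.subspace_V])
        then show ?thesis
          using g x by (simp add: q lin_diff[OF lin_lext] bilin_def M.rep M'.rep lin_add[OF lin_lext] diff_diff_eq)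
      next
        fix a x y assume q: "q = delta (a \<odot>\<^bsub>M\<^esub> x, y) - smul a (delta (x, y))"
          and x: "x \<in> carrier M" "y \<in> carrier M'"
        have "g (M.rep (a \<odot>\<^bsub>M\<^esub> x)) (M'.rep y) - g (smul a (M.rep x)) (M'.rep y) \<in> W"
          using x by (intro diff) (simp_all add: M.rep M'.rep M.smult_closed M.\<pi>_smul fv.subspace_scale[OF M.subspace_V])
        then show ?thesis
          using g x by (simp add: q lin_diff[OF lin_lext] lin_scale[OF lin_lext] bilin_def M.rep M'.rep)
      next
        fix a x y assume q: "q = delta (x, a \<odot>\<^bsub>M'\<^esub> y) - smul a (delta (x, y))"
          and x: "x \<in> carrier M" "y \<in> carrier M'"
        have "g (M.rep x) (M'.rep (a \<odot>\<^bsub>M'\<^esub> y)) - g (M.rep x) (smul a (M'.rep y)) \<in> W"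
          using x by (intro diff) (simp_all add: M.rep M'.rep M'.smult_closed M'.\<pi>_smul fv.subspace_scale[OF M'.subspace_V])
        then show ?thesis
          using g x by (simp add: q lin_diff[OF lin_lext] lin_scale[OF lin_lext] bilin_def M.rep M'.rep)
      qed
    qed
  qed
  then have "?G (push t) \<in> W" using t(2) by auto
  \<comment> \<open>\<open>?G (push t)\<close> replaces each pair by the chosen representatives of
    its classes, an error that \<open>diff\<close> places in \<open>W\<close>.\<close>
  moreover have "lext (\<lambda>(x, y). g x y) t - ?G (push t) \<in> W"
  proof (rule lin_mem[OF _ W _ t(1)])
    show "lin (\<lambda>t. lext (\<lambda>(x, y). g x y) t - ?G (push t))"
      by (intro lin_minus lin_lext lin_comp[OF lin_lext lin_push])
    show "lext (\<lambda>(x, y). g x y) (delta b) - ?G (push (delta b)) \<in> W" if "b \<in> V \<times> V'" for b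
      using that by (auto simp: push_def M.rep M'.rep M.\<pi>_carrier M'.\<pi>_carrier intro!: diff)
  qed
  ultimately show ?thesis
    using fv.subspace_add[OF W] by fastforce
qed

text \<open>Conversely to \<open>push_null_imp\<close>, one bilinear map suffices as a test: the
  canonical one into the tensor product. Composition with a linear map whose kernel is the null
  space lets it take values in a free space.\<close>

lemma push_null_test:
  obtains \<beta> :: "('b \<Rightarrow>\<^sub>0 'f) \<Rightarrow> ('c \<Rightarrow>\<^sub>0 'f) \<Rightarrow> ('v \<times> 'w \<Rightarrow>\<^sub>0 'f)"
  where "bilin V V' \<beta>"
    "\<And>x y. x \<in> K \<Longrightarrow> y \<in> V' \<Longrightarrow> \<beta> x y = 0" "\<And>x y. x \<in> V \<Longrightarrow> y \<in> K' \<Longrightarrow> \<beta> x y = 0"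
    "\<And>t. lext (\<lambda>(x, y). \<beta> x y) t = 0 \<Longrightarrow> push t \<in> tnull M M'"
proof -
  obtain \<rho> :: "('v \<times> 'w \<Rightarrow>\<^sub>0 'f) \<Rightarrow> ('v \<times> 'w \<Rightarrow>\<^sub>0 'f)"
    where \<rho>: "lin \<rho>" "\<And>x. \<rho> x = 0 \<longleftrightarrow> x \<in> tnull M M'"
    using subspace_kernel[OF T.subspace_tnull] by blast
  define \<beta> where "\<beta> x y = \<rho> (delta (\<pi> x, \<pi>' y))" for x y
  have rel: "\<rho> q = 0" if "q \<in> trel M M'" for q
    using that T.trel_tnull \<rho>(2) by auto
  have add1: "\<beta> (x + x') y = \<beta> x y + \<beta> x' y" if "x \<in> V" "x' \<in> V" "y \<in> V'" for x x' y
  proof -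
    have "delta (\<pi> x \<oplus>\<^bsub>M\<^esub> \<pi> x', \<pi>' y) - delta (\<pi> x, \<pi>' y) - delta (\<pi> x', \<pi>' y) \<in> trel M M'"
      unfolding trel_def using that M.\<pi>_carrier M'.\<pi>_carrier by blast
    from rel[OF this] show ?thesis
      using that by (simp add: \<beta>_def M.\<pi>_add lin_diff[OF \<rho>(1)] diff_eq_eq)
  qed
  have add2: "\<beta> x (y + y') = \<beta> x y + \<beta> x y'" if "x \<in> V" "y \<in> V'" "y' \<in> V'" for x y y'
  proof -
    have "delta (\<pi> x, \<pi>' y \<oplus>\<^bsub>M'\<^esub> \<pi>' y') - delta (\<pi> x, \<pi>' y) - delta (\<pi> x, \<pi>' y') \<in> trel M M'"
      unfolding trel_def using that M.\<pi>_carrier M'.\<pi>_carrier by blast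
    from rel[OF this] show ?thesis
      using that by (simp add: \<beta>_def M'.\<pi>_add lin_diff[OF \<rho>(1)] diff_eq_eq)
  qed
  have sm1: "\<beta> (smul a x) y = smul a (\<beta> x y)" if "x \<in> V" "y \<in> V'" for a x y
  proof -
    have "delta (a \<odot>\<^bsub>M\<^esub> \<pi> x, \<pi>' y) - smul a (delta (\<pi> x, \<pi>' y)) \<in> trel M M'"
      unfolding trel_def using that M.\<pi>_carrier M'.\<pi>_carrier by blast
    from rel[OF this] show ?thesis
      using that by (simp add: \<beta>_def M.\<pi>_smul lin_diff[OF \<rho>(1)] lin_scale[OF \<rho>(1)])
  qed
  have sm2: "\<beta> x (smul a y) = smul a (\<beta> x y)" if "x \<in> V" "y \<in> V'" for a x y
  proof -
    have "delta (\<pi> x, a \<odot>\<^bsub>M'\<^esub> \<pi>' y) - smul a (delta (\<pi> x, \<pi>' y)) \<in> trel M M'"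
      unfolding trel_def using that M.\<pi>_carrier M'.\<pi>_carrier by blast
    from rel[OF this] show ?thesis
      using that by (simp add: \<beta>_def M'.\<pi>_smul lin_diff[OF \<rho>(1)] lin_scale[OF \<rho>(1)])
  qed
  show thesis
  proof
    show "bilin V V' \<beta>" using add1 add2 sm1 sm2 by (auto simp: bilin_def)
    show "\<beta> x y = 0" if "x \<in> K" "y \<in> V'" for x y
    proof -
      have "\<pi> x = \<pi> 0"
        using that M.K_sub by (subst M.\<pi>_eq) (auto intro: fv.subspace_0 M.subspace_V)
      \<comment> \<open>\<open>smul 0 x\<close> has the same class as \<open>x\<close>, and
        homogeneity evaluates the right-hand side to 0.\<close>
      then have "\<beta> x y = \<beta> (smul 0 x) y" by (simp add: \<beta>_def)
      also have "\<dots> = 0" using that M.K_sub by (subst sm1) auto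
      finally show ?thesis .
    qed
    show "\<beta> x y = 0" if "x \<in> V" "y \<in> K'" for x y
    proof -
      have "\<pi>' y = \<pi>' 0"
        using that M'.K_sub by (subst M'.\<pi>_eq) (auto intro: fv.subspace_0 M'.subspace_V)
      then have "\<beta> x y = \<beta> x (smul 0 y)" by (simp add: \<beta>_def)
      also have "\<dots> = 0" using that M'.K_sub by (subst sm2) auto
      finally show ?thesis .
    qed
    show "push t \<in> tnull M M'" if "lext (\<lambda>(x, y). \<beta> x y) t = 0" for t
    proof -
      have "\<rho> (push t) = lext (\<lambda>(x, y). \<beta> x y) t"
        by (simp add: push_def lext_lin[OF \<rho>(1)] \<beta>_def case_prod_unfold)
      then show ?thesis using that \<rho>(2) by simp
    qed
  qed
qed

end

section \<open>Isomorphisms of persistence modules through a common cover\<close>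

text \<open>Equal fibres make the assignment from \<open>\<pi> x\<close> to \<open>g x\<close> both
  well defined and injective. Sums and multiples are required only to have a common lift, so
  \<open>V\<close> may be a set of families or of pairs of vectors.\<close>

lemma linear_iso_cover:
  fixes M :: "('f::field, 'v) module" and N :: "('f, 'w) module"
  assumes "\<pi> ` V = carrier M" "g ` V = carrier N"
    and eq: "\<And>x y. x \<in> V \<Longrightarrow> y \<in> V \<Longrightarrow> \<pi> x = \<pi> y \<longleftrightarrow> g x = g y"
    and add: "\<And>x y. x \<in> V \<Longrightarrow> y \<in> V \<Longrightarrow> \<exists>z\<in>V. \<pi> z = \<pi> x \<oplus>\<^bsub>M\<^esub> \<pi> y \<and> g z = g x \<oplus>\<^bsub>N\<^esub> g y"
    and smult: "\<And>a x. x \<in> V \<Longrightarrow> \<exists>z\<in>V. \<pi> z = a \<odot>\<^bsub>M\<^esub> \<pi> x \<and> g z = a \<odot>\<^bsub>N\<^esub> g x"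
  shows "\<exists>\<phi>. linear_iso M N \<phi> \<and> (\<forall>x\<in>V. \<phi> (\<pi> x) = g x)"
proof -
  define \<phi> where "\<phi> m = g (SOME x. x \<in> V \<and> \<pi> x = m)" for m
  have \<phi>: "\<phi> (\<pi> x) = g x" if "x \<in> V" for x
  proof -
    have "(SOME y. y \<in> V \<and> \<pi> y = \<pi> x) \<in> V \<and> \<pi> (SOME y. y \<in> V \<and> \<pi> y = \<pi> x) = \<pi> x"
      by (rule someI_ex) (use that in auto)
    then show ?thesis using eq that by (auto simp: \<phi>_def)
  qed
  have "\<phi> \<in> iso (add_monoid M) (add_monoid N)"
  proof (rule isoI)
    show "\<phi> \<in> hom (add_monoid M) (add_monoid N)"
    proof (rule homI)
      show "\<phi> m \<in> carrier (add_monoid N)" if "m \<in> carrier (add_monoid M)" for m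
      proof -
        have "m \<in> \<pi> ` V" using that by (simp add: assms(1))
        then obtain x where "x \<in> V" "m = \<pi> x" by blast
        then show ?thesis by (simp add: \<phi> assms(2)[symmetric])
      qed
      show "\<phi> (m \<otimes>\<^bsub>add_monoid M\<^esub> m') = \<phi> m \<otimes>\<^bsub>add_monoid N\<^esub> \<phi> m'"
        if mm: "m \<in> carrier (add_monoid M)" "m' \<in> carrier (add_monoid M)" for m m'
      proof -
        have "m \<in> \<pi> ` V" "m' \<in> \<pi> ` V" using mm by (simp_all add: assms(1))
        then obtain x y where xy: "x \<in> V" "y \<in> V" "m = \<pi> x" "m' = \<pi> y"
          by blast
        obtain z where "z \<in> V" "\<pi> z = \<pi> x \<oplus>\<^bsub>M\<^esub> \<pi> y" "g z = g x \<oplus>\<^bsub>N\<^esub> g y"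
          using add[OF xy(1,2)] by blast
        then show ?thesis using xy \<phi>[of z] by (simp add: \<phi>)
      qed
    qed
    show "bij_betw \<phi> (carrier (add_monoid M)) (carrier (add_monoid N))"
    proof -
      have "inj_on \<phi> (\<pi> ` V)"
        using \<phi> eq by (intro inj_onI) auto
      moreover have "\<phi> ` \<pi> ` V = g ` V"
        unfolding image_image using \<phi> by (rule image_cong[OF refl])
      ultimately show ?thesis
        by (simp add: bij_betw_def assms(1,2))
    qed
  qed
  moreover have "\<phi> (a \<odot>\<^bsub>M\<^esub> m) = a \<odot>\<^bsub>N\<^esub> \<phi> m" if "m \<in> carrier M" for a m
  proof -
    have "m \<in> \<pi> ` V" using that by (simp add: assms(1))
    then obtain x where x: "x \<in> V" "m = \<pi> x" by blast
    then show ?thesis using smult[OF x(1), of a] \<phi> by metis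
  qed
  ultimately show ?thesis
    using \<phi> by (auto simp: linear_iso_def)
qed

text \<open>Naturality holds because one representative is used at both parameters: each structure
  map sends its class at \<open>r\<close> to its class at \<open>s\<close>.\<close>

lemma pm_isomorphic_cover:
  fixes P :: "('f::field, 'v) pers_module" and Q :: "('f, 'w) pers_module"
  assumes surj: "\<And>k r. 0 < r \<Longrightarrow> \<pi> k r ` V k r = carrier (pm_obj P k r)"
      "\<And>k r. 0 < r \<Longrightarrow> g k r ` V k r = carrier (pm_obj Q k r)"
    and eq: "\<And>k r x y. 0 < r \<Longrightarrow> x \<in> V k r \<Longrightarrow> y \<in> V k r \<Longrightarrow> \<pi> k r x = \<pi> k r y \<longleftrightarrow> g k r x = g k r y"
    and add: "\<And>k r x y. 0 < r \<Longrightarrow> x \<in> V k r \<Longrightarrow> y \<in> V k r \<Longrightarrow> \<exists>z\<in>V k r.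
      \<pi> k r z = \<pi> k r x \<oplus>\<^bsub>pm_obj P k r\<^esub> \<pi> k r y \<and> g k r z = g k r x \<oplus>\<^bsub>pm_obj Q k r\<^esub> g k r y"
    and smult: "\<And>k r a x. 0 < r \<Longrightarrow> x \<in> V k r \<Longrightarrow> \<exists>z\<in>V k r.
      \<pi> k r z = a \<odot>\<^bsub>pm_obj P k r\<^esub> \<pi> k r x \<and> g k r z = a \<odot>\<^bsub>pm_obj Q k r\<^esub> g k r x"
    and mono: "\<And>k r s. 0 < r \<Longrightarrow> r \<le> s \<Longrightarrow> V k r \<subseteq> V k s"
    and nat: "\<And>k r s x. 0 < r \<Longrightarrow> r \<le> s \<Longrightarrow> x \<in> V k r \<Longrightarrow> pm_map P k r s (\<pi> k r x) = \<pi> k s x"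
      "\<And>k r s x. 0 < r \<Longrightarrow> r \<le> s \<Longrightarrow> x \<in> V k r \<Longrightarrow> pm_map Q k r s (g k r x) = g k s x"
  shows "P \<cong>\<^sub>P\<^sub>M Q"
proof -
  have "\<forall>k r. \<exists>\<phi>. 0 < r \<longrightarrow> linear_iso (pm_obj P k r) (pm_obj Q k r) \<phi> \<and> (\<forall>x\<in>V k r. \<phi> (\<pi> k r x) = g k r x)"
    using linear_iso_cover[OF surj eq add smult] by blast
  then obtain \<Phi> where \<Phi>: "\<And>k r. 0 < r \<Longrightarrow> linear_iso (pm_obj P k r) (pm_obj Q k r) (\<Phi> k r)"
    "\<And>k r x. 0 < r \<Longrightarrow> x \<in> V k r \<Longrightarrow> \<Phi> k r (\<pi> k r x) = g k r x"
    by metis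
  have "\<Phi> k s (pm_map P k r s m) = pm_map Q k r s (\<Phi> k r m)"
    if r: "0 < r" "r \<le> s" and m: "m \<in> carrier (pm_obj P k r)" for k r s m
  proof -
    obtain x where x: "x \<in> V k r" "m = \<pi> k r x" using m surj(1)[OF r(1)] by blast
    moreover have "x \<in> V k s" using mono[OF r] x(1) by blast
    ultimately show ?thesis using \<Phi>(2) nat r by simp
  qed
  then show ?thesis
    unfolding pm_isomorphic_def using \<Phi>(1) by blast
qed


section \<open>Alternating functions on lists\<close>

text \<open>Adjacent swaps suit induction on lists. Distinctness is a separate condition because
  antisymmetry does not force vanishing on repeated entries in characteristic 2. Lists of all
  lengths, including the empty one, are allowed, so that the augmented complex is treated in all
  degrees at once.\<close>

definition altc :: "('a list \<Rightarrow> 'f::field) set" where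
  "altc = {c. finite {vs. c vs \<noteq> 0} \<and> (\<forall>vs. c vs \<noteq> 0 \<longrightarrow> distinct vs) \<and>
     (\<forall>xs a b ys. c (xs @ a # b # ys) = - c (xs @ b # a # ys))}"

lemma altcI:
  assumes "finite {vs. c vs \<noteq> 0}" "\<And>vs. c vs \<noteq> 0 \<Longrightarrow> distinct vs"
    "\<And>xs a b ys. c (xs @ a # b # ys) = - c (xs @ b # a # ys)"
  shows "c \<in> altc"
  unfolding altc_def using assms by blast

lemma
  assumes "c \<in> altc"
  shows altc_finite: "finite {vs. c vs \<noteq> 0}"
    and altc_distinct: "c vs \<noteq> 0 \<Longrightarrow> distinct vs"
    and altc_swap: "c (xs @ a # b # ys) = - c (xs @ b # a # ys)"
  using assms unfolding altc_def by blast+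

lemma altc_move:
  assumes "c \<in> altc"
  shows "c (xs @ u # ms @ ys) = (- 1) ^ length ms * c (xs @ ms @ u # ys)"
proof (induction ms arbitrary: xs)
  case (Cons m ms)
  have "c (xs @ u # m # ms @ ys) = - c ((xs @ [m]) @ u # ms @ ys)"
    using altc_swap[OF assms, of xs u m "ms @ ys"] by simp
  then show ?case using Cons.IH[of "xs @ [m]"] by simp
qed simp

lemma permute_list_transpose:
  assumes "vs = xs @ u # ms @ w # ys" "i = length xs" "j = length xs + Suc (length ms)"
  shows "permute_list (Transposition.transpose i j) vs = xs @ w # ms @ u # ys"
proof (rule nth_equalityI)
  have \<pi>: "Transposition.transpose i j permutes {..<length vs}"
    by (rule permutes_swap_id) (simp_all add: assms)
  fix k assume "k < length (permute_list (Transposition.transpose i j) vs)"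
  then have k: "k < length vs" by simp
  consider "k < i" | "k = i" | "i < k" "k < j" | "k = j" | "j < k" by linarith
  then show "permute_list (Transposition.transpose i j) vs ! k = (xs @ w # ms @ u # ys) ! k"
    unfolding permute_list_nth[OF \<pi> k]
    by cases (auto simp: assms nth_append nth_Cons' Transposition.transpose_def)
qed (simp add: assms)

text \<open>The block between the two entries is crossed twice, so its signs cancel and the one swap
  of the two entries remains.\<close>

lemma altc_transpose:
  assumes c: "c \<in> altc" and ij: "i < length vs" "j < length vs" "i \<noteq> j"
  shows "c (permute_list (Transposition.transpose i j) vs) = - c vs"
proof -
  have *: "c (permute_list (Transposition.transpose i j) vs) = - c vs" if "i < j" "j < length vs" for i j
  proof -
    note ij' = that
    obtain xs u ms w ys where vs: "vs = xs @ u # ms @ w # ys" "i = length xs" "j = length xs + Suc (length ms)"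
    proof
      let ?zs = "drop (Suc i) vs"
      have "vs = take i vs @ vs ! i # ?zs" using ij' by (intro id_take_nth_drop) simp
      also have "?zs = take (j - Suc i) ?zs @ ?zs ! (j - Suc i) # drop (Suc (j - Suc i)) ?zs"
        using ij' by (intro id_take_nth_drop) simp
      finally show "vs = take i vs @ vs ! i # take (j - Suc i) ?zs @ ?zs ! (j - Suc i) # drop (Suc (j - Suc i)) ?zs" .
    qed (use ij' in auto)
    have "c (xs @ w # ms @ u # ys) = (- 1) ^ length ms * c (xs @ ms @ w # u # ys)"
      by (rule altc_move[OF c])
    also have "c (xs @ ms @ w # u # ys) = - c ((xs @ ms) @ u # w # ys)"
      using altc_swap[OF c, of "xs @ ms" w u ys] by simp
    finally show ?thesis
      using altc_move[OF c, of xs u ms "w # ys"] by (subst permute_list_transpose[OF vs]) (simp add: vs(1))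
  qed
  show ?thesis
    using *[of i j] *[of j i] ij by (cases "i < j") (auto simp: Transposition.transpose_commute)
qed

lemma altc_permute:
  assumes c: "c \<in> altc" and "\<pi> permutes {..<length vs}"
  shows "c (permute_list \<pi> vs) = of_int (sign \<pi>) * c vs"
proof -
  have "finite {..<length vs}" by simp
  \<comment> \<open>All lists of this length are included because peeling off a transposition
    changes the list.\<close>
  with assms(2) have "\<forall>us. length us = length vs \<longrightarrow> c (permute_list \<pi> us) = of_int (sign \<pi>) * c us"
  proof (induction \<pi> rule: permutes_induct)
    case id then show ?case by simp
  next
    case (swap a b p)
    show ?case
    proof (intro allI impI)
      fix us :: "'a list" assume us: "length us = length vs"
      have "c (permute_list (Transposition.transpose a b \<circ> p) us) = c (permute_list p (permute_list (Transposition.transpose a b) us))"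
        using swap us by (simp add: permute_list_compose)
      also have "\<dots> = of_int (sign p) * c (permute_list (Transposition.transpose a b) us)"
        using swap us by simp
      also have "\<dots> = of_int (sign p) * - c us"
        using swap us by (subst altc_transpose[OF c]) auto
      also have "\<dots> = of_int (sign (Transposition.transpose a b \<circ> p)) * c us"
      proof -
        have "permutation p" using swap by (metis finite_lessThan permutation_permutes)
        then have "sign (Transposition.transpose a b \<circ> p) = - sign p"
          using swap by (simp add: sign_compose permutation_swap_id sign_swap_id)
        then show ?thesis by simp
      qed
      finally show "c (permute_list (Transposition.transpose a b \<circ> p) us) = of_int (sign (Transposition.transpose a b \<circ> p)) * c us" .
    qed
  qed
  then show ?thesis by simp
qed

text \<open>Adjacent transpositions have sign -1, which gives one inclusion; the other holds because
  every permutation is a product of transpositions.\<close>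

lemma chains_eq: "chains K k = {c \<in> altc. \<forall>vs. c vs \<noteq> 0 \<longrightarrow> length vs = Suc k \<and> set vs \<in> K}"
proof (rule subset_antisym; rule subsetI)
  fix c :: "'a list \<Rightarrow> 'b" assume c: "c \<in> chains K k"
  have "c (xs @ a # b # ys) = - c (xs @ b # a # ys)" for xs a b ys
  proof -
    let ?i = "length xs" and ?j = "length xs + Suc (length ([] :: 'a list))" and ?vs = "xs @ b # [] @ a # ys"
    have "Transposition.transpose ?i ?j permutes {..<length ?vs}"
      by (rule permutes_swap_id) simp_all
    then have "c (permute_list (Transposition.transpose ?i ?j) ?vs) = of_int (sign (Transposition.transpose ?i ?j)) * c ?vs"
      using c unfolding chains_def by blast
    then show ?thesis
      by (subst (asm) permute_list_transpose[of ?vs xs b "[]" a ys]) (simp_all add: sign_swap_id)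
  qed
  then show "c \<in> {c \<in> altc. \<forall>vs. c vs \<noteq> 0 \<longrightarrow> length vs = Suc k \<and> set vs \<in> K}"
    using c unfolding altc_def chains_def by blast
next
  fix c :: "'a list \<Rightarrow> 'b"
  assume "c \<in> {c \<in> altc. \<forall>vs. c vs \<noteq> 0 \<longrightarrow> length vs = Suc k \<and> set vs \<in> K}"
  then show "c \<in> chains K k"
    by (auto simp: chains_def altc_finite altc_distinct altc_permute)
qed

lemma altc_zero: "(\<lambda>_. 0) \<in> altc"
  by (simp add: altc_def)

lemma altc_add: "c \<in> altc \<Longrightarrow> d \<in> altc \<Longrightarrow> (\<lambda>vs. c vs + d vs) \<in> altc"
proof (rule altcI)
  assume c: "c \<in> altc" and d: "d \<in> altc"
  show "finite {vs. c vs + d vs \<noteq> 0}"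
    by (rule finite_subset[of _ "{vs. c vs \<noteq> 0} \<union> {vs. d vs \<noteq> 0}"])
      (use altc_finite[OF c] altc_finite[OF d] in auto)
  show "distinct vs" if "c vs + d vs \<noteq> 0" for vs
    using that altc_distinct[OF c, of vs] altc_distinct[OF d, of vs] by fastforce
  show "c (xs @ a # b # ys) + d (xs @ a # b # ys) = - (c (xs @ b # a # ys) + d (xs @ b # a # ys))" for xs a b ys
    using altc_swap[OF c, of xs a b ys] altc_swap[OF d, of xs a b ys] by simp
qed

lemma altc_smult: "c \<in> altc \<Longrightarrow> (\<lambda>vs. a * c vs) \<in> altc"
proof (rule altcI)
  assume c: "c \<in> altc"
  show "finite {vs. a * c vs \<noteq> 0}"
    by (rule finite_subset[OF _ altc_finite[OF c]]) auto
  show "distinct vs" if "a * c vs \<noteq> 0" for vs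
    using that altc_distinct[OF c, of vs] by auto
  show "a * c (xs @ u # v # ys) = - (a * c (xs @ v # u # ys))" for xs u v ys
    using altc_swap[OF c, of xs u v ys] by simp
qed

lemma finite_cofaces: "c \<in> altc \<Longrightarrow> finite {v. c (v # vs) \<noteq> 0}"
  by (rule finite_imageD[of "\<lambda>v. v # vs"])
    (auto intro!: finite_subset[OF _ altc_finite] inj_onI)

text \<open>The index set in \<open>boundary\<close> depends on the chain. A common finite index set
  is what allows boundaries of different chains to be added.\<close>

lemma boundary_superset:
  assumes "finite A" "{v. c (v # vs) \<noteq> 0} \<subseteq> A"
  shows "boundary c vs = (\<Sum>v\<in>A. c (v # vs))"
  unfolding boundary_def using assms by (intro sum.mono_neutral_left) auto

lemma boundary_add:
  assumes "c \<in> altc" "d \<in> altc"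
  shows "boundary (\<lambda>vs. c vs + d vs) = (\<lambda>vs. boundary c vs + boundary d vs)"
proof
  fix vs
  let ?A = "{v. c (v # vs) \<noteq> 0} \<union> {v. d (v # vs) \<noteq> 0}"
  have "finite ?A" using assms by (simp add: finite_cofaces)
  then show "boundary (\<lambda>vs. c vs + d vs) vs = boundary c vs + boundary d vs"
    by (subst (1 2 3) boundary_superset[of ?A]) (auto simp: sum.distrib)
qed

lemma boundary_smult:
  assumes "c \<in> altc"
  shows "boundary (\<lambda>vs. a * c vs) = (\<lambda>vs. a * boundary c vs)"
proof
  fix vs
  let ?A = "{v. c (v # vs) \<noteq> 0}"
  have "finite ?A" using assms by (simp add: finite_cofaces)
  then show "boundary (\<lambda>vs. a * c vs) vs = a * boundary c vs"
    by (subst (1 2) boundary_superset[of ?A]) (auto simp: sum_distrib_left)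
qed

lemma boundary_nonzero: "boundary c vs \<noteq> 0 \<Longrightarrow> \<exists>v. c (v # vs) \<noteq> 0"
  unfolding boundary_def by (metis (mono_tags, lifting) mem_Collect_eq sum.neutral)

lemma boundary_altc:
  assumes c: "c \<in> altc"
  shows "boundary c \<in> altc"
proof (rule altcI)
  have "{vs. boundary c vs \<noteq> 0} \<subseteq> tl ` {vs. c vs \<noteq> 0}"
    using boundary_nonzero by (force simp: image_iff)
  then show "finite {vs. boundary c vs \<noteq> 0}"
    using altc_finite[OF c] finite_surj by blast
  show "distinct vs" if "boundary c vs \<noteq> 0" for vs
    using boundary_nonzero[OF that] altc_distinct[OF c] by fastforce
  show "boundary c (xs @ a # b # ys) = - boundary c (xs @ b # a # ys)" for xs a b ys
  proof -
    have "c (v # xs @ a # b # ys) = - c (v # xs @ b # a # ys)" for v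
      using altc_swap[OF c, of "v # xs" a b ys] by simp
    then show ?thesis by (simp add: boundary_def sum_negf)
  qed
qed

text \<open>In characteristic 2 the assumption on the diagonal does not follow from antisymmetry.\<close>

lemma sum_antisymmetric:
  fixes g :: "'b \<Rightarrow> 'b \<Rightarrow> 'f::ab_group_add"
  assumes "finite A" "\<And>v w. g v w = - g w v" "\<And>v. g v v = 0"
  shows "(\<Sum>v\<in>A. \<Sum>w\<in>A. g v w) = 0"
  using assms(1)
proof induction
  case (insert a A)
  have "(\<Sum>v\<in>A. g v a) = - (\<Sum>w\<in>A. g a w)"
    by (simp add: sum_negf[symmetric] assms(2)[symmetric])
  then show ?case
    using insert by (simp add: sum.distrib assms(3))
qed simp

lemma boundary_boundary:
  assumes c: "c \<in> altc"
  shows "boundary (boundary c) = (\<lambda>_. 0)"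
proof
  fix vs
  \<comment> \<open>All vertices that occur in \<open>c\<close>: one finite set over which both
    boundary sums can be taken, leaving a double sum antisymmetric in its two indices.\<close>
  let ?A = "\<Union>us\<in>{us. c us \<noteq> 0}. set us"
  have A: "finite ?A" using altc_finite[OF c] by auto
  have "boundary c (v # vs) = (\<Sum>w\<in>?A. c (w # v # vs))" for v
    by (rule boundary_superset[OF A]) force
  moreover have "boundary (boundary c) vs = (\<Sum>v\<in>?A. boundary c (v # vs))"
    by (rule boundary_superset[OF A]) (use boundary_nonzero in fastforce)
  ultimately have "boundary (boundary c) vs = (\<Sum>v\<in>?A. \<Sum>w\<in>?A. c (w # v # vs))"
    by simp
  also have "\<dots> = 0"
  proof (rule sum_antisymmetric[OF A])
    show "c (w # v # vs) = - c (v # w # vs)" for v w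
      using altc_swap[OF c, of "[]" w v vs] by simp
    show "c (v # v # vs) = 0" for v
      using altc_distinct[OF c, of "v # v # vs"] by auto
  qed
  finally show "boundary (boundary c) vs = 0" .
qed

subsection \<open>Cones\<close>

text \<open>Each occurrence of \<open>v\<close> contributes the value of \<open>c\<close> on the
  list with that entry deleted, with sign -1 to the power of its position. The recursion passes an
  entry by fixing it as the first argument of \<open>c\<close>.\<close>

fun rcone :: "'a \<Rightarrow> ('a list \<Rightarrow> 'f::field) \<Rightarrow> 'a list \<Rightarrow> 'f" where
  "rcone v c [] = 0"
| "rcone v c (w # ws) = (if w = v then c ws else 0) - rcone v (\<lambda>us. c (w # us)) ws"

text \<open>The cone of \<open>[v\<^sub>0, \<dots>, v\<^sub>k]\<close> is \<open>[v, v\<^sub>0, \<dots>, v\<^sub>k]\<close>, which is 0 if \<open>v\<close> is one of the \<open>v\<^sub>i\<close>.\<close>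

definition lcone :: "'a \<Rightarrow> ('a list \<Rightarrow> 'f::field) \<Rightarrow> 'a list \<Rightarrow> 'f" where
  "lcone v c vs = (if distinct vs then rcone v c vs else 0)"

lemma rcone_notin: "v \<notin> set vs \<Longrightarrow> rcone v c vs = 0"
  by (induction vs arbitrary: c) auto

lemma rcone_at:
  "v \<notin> set xs \<Longrightarrow> v \<notin> set ys \<Longrightarrow> rcone v c (xs @ v # ys) = (- 1) ^ length xs * c (xs @ ys)"
  by (induction xs arbitrary: c) (auto simp: rcone_notin)

lemma rcone_add: "rcone v (\<lambda>us. c us + d us) vs = rcone v c vs + rcone v d vs"
  by (induction vs arbitrary: c d) auto

lemma rcone_smult: "rcone v (\<lambda>us. a * c us) vs = a * rcone v c vs"
  by (induction vs arbitrary: c) (auto simp: algebra_simps)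

lemma rcone_swap:
  "(\<And>xs a b ys. c (xs @ a # b # ys) = - c (xs @ b # a # ys)) \<Longrightarrow>
    rcone v c (xs @ a # b # ys) = - rcone v c (xs @ b # a # ys)"
proof (induction xs arbitrary: c)
  case Nil
  have "(\<lambda>us. c (a # b # us)) = (\<lambda>us. (- 1) * c (b # a # us))"
    using Nil[of "[]" a b] by auto
  then have "rcone v (\<lambda>us. c (a # b # us)) ys = - rcone v (\<lambda>us. c (b # a # us)) ys"
    by (simp only: rcone_smult) simp
  then show ?case by simp
next
  case (Cons x xs)
  have "rcone v (\<lambda>us. c (x # us)) (xs @ a # b # ys) = - rcone v (\<lambda>us. c (x # us)) (xs @ b # a # ys)"
  proof (rule Cons.IH)
    show "c (x # us @ a # b # ws) = - c (x # us @ b # a # ws)" for us a b ws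
      using Cons.prems[of "x # us" a b ws] by simp
  qed
  then show ?case using Cons.prems[of xs a b ys] by auto
qed

lemma lcone_nonzero:
  assumes "lcone v c vs \<noteq> 0"
  obtains xs ys where "vs = xs @ v # ys" "distinct vs" "c (xs @ ys) \<noteq> 0"
proof -
  from assms have d: "distinct vs" and r: "rcone v c vs \<noteq> 0"
    by (auto simp: lcone_def split: if_splits)
  from r have "v \<in> set vs" using rcone_notin[of v vs c] by blast
  then obtain xs ys where "vs = xs @ v # ys" by (auto simp: in_set_conv_decomp)
  with d r show thesis by (intro that[of xs ys]) (auto simp: rcone_at)
qed

lemma lcone_altc:
  assumes c: "c \<in> altc"
  shows "lcone v c \<in> altc"
proof (rule altcI)
  have "{vs. lcone v c vs \<noteq> 0} \<subseteq> (\<Union>us\<in>{us. c us \<noteq> 0}. (\<lambda>i. take i us @ v # drop i us) ` {..length us})"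
  proof
    fix vs assume "vs \<in> {vs. lcone v c vs \<noteq> 0}"
    then have "lcone v c vs \<noteq> 0" by simp
    then obtain xs ys where "vs = xs @ v # ys" "c (xs @ ys) \<noteq> 0"
      by (rule lcone_nonzero)
    then show "vs \<in> (\<Union>us\<in>{us. c us \<noteq> 0}. (\<lambda>i. take i us @ v # drop i us) ` {..length us})"
      by (auto intro!: bexI[of _ "xs @ ys"] image_eqI[of _ _ "length xs"])
  qed
  then show "finite {vs. lcone v c vs \<noteq> 0}"
    by (rule finite_subset) (use altc_finite[OF c] in auto)
  show "distinct vs" if "lcone v c vs \<noteq> 0" for vs
    using lcone_nonzero[OF that] by blast
  show "lcone v c (xs @ a # b # ys) = - lcone v c (xs @ b # a # ys)" for xs a b ys
  proof -
    have "rcone v c (xs @ a # b # ys) = - rcone v c (xs @ b # a # ys)"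
      by (rule rcone_swap) (rule altc_swap[OF c])
    moreover have "distinct (xs @ a # b # ys) = distinct (xs @ b # a # ys)" by auto
    ultimately show ?thesis by (simp only: lcone_def) simp
  qed
qed

lemma lcone_add: "lcone v (\<lambda>vs. c vs + d vs) = (\<lambda>vs. lcone v c vs + lcone v d vs)"
  by (auto simp: lcone_def rcone_add)

lemma lcone_smult: "lcone v (\<lambda>vs. a * c vs) = (\<lambda>vs. a * lcone v c vs)"
  by (auto simp: lcone_def rcone_smult)

text \<open>The contracting homotopy of a cone. It has no correction term because the empty list
  counts as a simplex of dimension -1.\<close>

lemma boundary_lcone:
  assumes c: "c \<in> altc"
  shows "boundary (lcone v c) vs + lcone v (boundary c) vs = c vs"
proof (cases "distinct vs")
  case False
  then have "c vs = 0" "\<And>w. lcone v c (w # vs) = 0"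
    using altc_distinct[OF c] by (auto simp: lcone_def)
  then show ?thesis using False by (simp add: boundary_def lcone_def)
next
  case d: True
  show ?thesis
  proof (cases "v \<in> set vs")
    case False
    \<comment> \<open>Every list in the support of the cone contains \<open>v\<close>, so only the
      coface that adds \<open>v\<close> contributes.\<close>
    have "boundary (lcone v c) vs = (\<Sum>w\<in>{v}. lcone v c (w # vs))"
      by (rule boundary_superset) (use False in \<open>auto simp: lcone_def rcone_notin split: if_splits\<close>)
    then show ?thesis
      using False d by (simp add: lcone_def rcone_notin)
  next
    case True
    then obtain xs ys where vs: "vs = xs @ v # ys" by (auto simp: in_set_conv_decomp)
    let ?A = "insert v ({w. c (w # xs @ ys) \<noteq> 0} \<union> {w. lcone v c (w # vs) \<noteq> 0})"
    have A: "finite ?A" by (simp add: finite_cofaces lcone_altc c)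
    have 1: "boundary (lcone v c) vs = (\<Sum>w\<in>?A. lcone v c (w # vs))"
      by (rule boundary_superset[OF A]) auto
    have 2: "boundary c (xs @ ys) = (\<Sum>w\<in>?A. c (w # xs @ ys))"
      by (rule boundary_superset[OF A]) auto
    \<comment> \<open>For \<open>w\<close> different from \<open>v\<close> the terms cancel, since a
      new first entry shifts the position of \<open>v\<close> by one. For \<open>w = v\<close> the
      cone vanishes on a repeated entry and the boundary term survives.\<close>
    have 3: "lcone v c (w # vs) + (- 1) ^ length xs * c (w # xs @ ys)
        = (if w = v then (- 1) ^ length xs * c (v # xs @ ys) else 0)" for w
    proof (cases "w \<in> set vs")
      case True
      then have "w \<noteq> v \<Longrightarrow> c (w # xs @ ys) = 0"
        using vs altc_distinct[OF c, of "w # xs @ ys"] by auto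
      then show ?thesis using True by (simp add: lcone_def)
    next
      case False
      then have "w \<noteq> v" "v \<notin> set (w # xs)" "v \<notin> set ys" using vs d by auto
      with rcone_at[of v "w # xs" ys c] show ?thesis
        using False d by (simp add: lcone_def vs)
    qed
    have "lcone v (boundary c) vs = (- 1) ^ length xs * boundary c (xs @ ys)"
      using d by (auto simp: lcone_def vs rcone_at)
    then have "boundary (lcone v c) vs + lcone v (boundary c) vs
        = (\<Sum>w\<in>?A. lcone v c (w # vs) + (- 1) ^ length xs * c (w # xs @ ys))"
      by (simp add: 1 2 sum.distrib sum_distrib_left)
    also have "\<dots> = (- 1) ^ length xs * c (v # xs @ ys)"
      unfolding 3 using A by simp
    also have "\<dots> = c vs"
      using altc_move[OF c, of "[]" v xs ys] by (simp add: vs flip: mult.assoc power_add)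
    finally show ?thesis .
  qed
qed

text \<open>The elementary chain of a list as an iterated cone, so that antisymmetry is inherited
  from \<open>lcone_altc\<close>.\<close>

fun elch :: "'a list \<Rightarrow> 'a list \<Rightarrow> 'f::field" where
  "elch [] = (\<lambda>vs. if vs = [] then 1 else 0)"
| "elch (v # vs) = lcone v (elch vs)"

lemma elch_altc: "(elch us :: 'a list \<Rightarrow> 'f::field) \<in> altc"
proof (induction us)
  case Nil
  have "{vs. (elch [] vs :: 'f) \<noteq> 0} \<subseteq> {[]}" by auto
  then show ?case by (intro altcI) (auto split: if_splits intro: finite_subset)
next
  case (Cons u us) then show ?case by (simp add: lcone_altc)
qed

lemma elch_self: "distinct us \<Longrightarrow> elch us us = (1 :: 'a::field)"
  by (induction us) (auto simp: lcone_def rcone_notin)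

section \<open>Chains as finitely supported functions on simplices\<close>

text \<open>Every finite set is oriented by an arbitrarily chosen ordering; the elementary chains of
  these orderings form a basis of the alternating functions.\<close>

definition ori :: "'a set \<Rightarrow> 'a list" where
  "ori \<sigma> = (SOME vs. distinct vs \<and> set vs = \<sigma>)"

lemma ori: "finite \<sigma> \<Longrightarrow> distinct (ori \<sigma>)" "finite \<sigma> \<Longrightarrow> set (ori \<sigma>) = \<sigma>"
  unfolding ori_def using someI_ex[of "\<lambda>vs. distinct vs \<and> set vs = \<sigma>"] finite_distinct_list[of \<sigma>]
  by auto

text \<open>The combination of elementary chains with coefficients \<open>p\<close>. At a given list
  only the basis element \<open>set vs\<close> can contribute, so no sum appears.\<close>

definition alt_of :: "('a set \<Rightarrow>\<^sub>0 'f::field) \<Rightarrow> 'a list \<Rightarrow> 'f" where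
  "alt_of p vs = (if distinct vs then lookup p (set vs) * elch (ori (set vs)) vs else 0)"

text \<open>Coefficients are read off at the chosen orderings. Infinite sets have no ordering and
  get the value 0.\<close>

definition set_of :: "('a list \<Rightarrow> 'f::field) \<Rightarrow> ('a set \<Rightarrow>\<^sub>0 'f)" where
  "set_of c = Abs_poly_mapping (\<lambda>\<sigma>. if finite \<sigma> then c (ori \<sigma>) else 0)"

lemma lookup_set_of:
  assumes "c \<in> altc"
  shows "lookup (set_of c) \<sigma> = (if finite \<sigma> then c (ori \<sigma>) else 0)"
proof -
  have "{\<sigma>. (if finite \<sigma> then c (ori \<sigma>) else 0) \<noteq> 0} \<subseteq> set ` {vs. c vs \<noteq> 0}"
  proof
    fix \<sigma> assume "\<sigma> \<in> {\<sigma>. (if finite \<sigma> then c (ori \<sigma>) else 0) \<noteq> 0}"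
    then have "finite \<sigma>" "c (ori \<sigma>) \<noteq> 0" by (auto split: if_splits)
    then show "\<sigma> \<in> set ` {vs. c vs \<noteq> 0}"
      by (intro image_eqI[of _ _ "ori \<sigma>"]) (simp_all add: ori)
  qed
  then have "finite {\<sigma>. (if finite \<sigma> then c (ori \<sigma>) else 0) \<noteq> 0}"
    using altc_finite[OF assms] finite_surj by blast
  then show ?thesis by (simp add: set_of_def)
qed

lemma alt_of_nonzero: "alt_of p vs \<noteq> 0 \<Longrightarrow> distinct vs \<and> set vs \<in> keys p"
  by (auto simp: alt_of_def in_keys_iff split: if_splits)

lemma alt_of_altc: "alt_of (p :: 'a set \<Rightarrow>\<^sub>0 'f::field) \<in> altc"
proof (rule altcI)
  have "{vs. alt_of p vs \<noteq> 0} \<subseteq> (\<Union>\<sigma>\<in>{\<sigma> \<in> keys p. finite \<sigma>}. {vs. set vs \<subseteq> \<sigma> \<and> distinct vs})"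
    using alt_of_nonzero[of p] by fastforce
  then show "finite {vs. alt_of p vs \<noteq> 0}"
    by (rule finite_subset) (auto intro: finite_subset_distinct)
  show "distinct vs" if "alt_of p vs \<noteq> 0" for vs
    using alt_of_nonzero[OF that] by blast
  show "alt_of p (xs @ a # b # ys) = - alt_of p (xs @ b # a # ys)" for xs a b ys
  proof -
    have 1: "set (xs @ b # a # ys) = set (xs @ a # b # ys)"
      "distinct (xs @ b # a # ys) = distinct (xs @ a # b # ys)"
      by auto
    have e: "elch (ori (set (xs @ a # b # ys))) (xs @ a # b # ys)
        = - (elch (ori (set (xs @ a # b # ys))) (xs @ b # a # ys) :: 'f)"
      by (rule altc_swap[OF elch_altc])
    show ?thesis
      unfolding alt_of_def 1 e by simp
  qed
qed

text \<open>Both sides are alternating and agree at the chosen ordering, of which every distinct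
  list with the same entries is a permutation.\<close>

lemma alt_of_set_of:
  fixes c :: "'a list \<Rightarrow> 'f::field"
  assumes c: "c \<in> altc"
  shows "alt_of (set_of c) = c"
proof
  fix vs
  show "alt_of (set_of c) vs = c vs"
  proof (cases "distinct vs")
    case d: True
    let ?o = "ori (set vs)"
    have "mset vs = mset ?o"
      using d ori[of "set vs"] set_eq_iff_mset_eq_distinct by (metis List.finite_set)
    then obtain \<pi> where \<pi>: "\<pi> permutes {..<length ?o}" "permute_list \<pi> ?o = vs"
      by (rule mset_eq_permutation)
    have "c vs = of_int (sign \<pi>) * c ?o" "(elch ?o vs :: 'f) = of_int (sign \<pi>) * elch ?o ?o"
      using altc_permute[OF c \<pi>(1)] altc_permute[OF elch_altc[where 'f = 'f] \<pi>(1)] \<pi>(2) by simp_all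
    then show ?thesis
      using d elch_self[where 'a = 'f, OF ori(1)[of "set vs"]]
      by (simp only: alt_of_def lookup_set_of[OF c]) simp
  next
    case False
    then show ?thesis using altc_distinct[OF c, of vs] by (auto simp: alt_of_def)
  qed
qed

lemma set_of_alt_of: "p \<in> fsub {\<sigma>. finite \<sigma>} \<Longrightarrow> set_of (alt_of p) = p"
  by (rule poly_mapping_eqI)
    (auto simp: lookup_set_of[OF alt_of_altc] alt_of_def ori elch_self dest: fsubD)

lemma alt_of_add: "alt_of (p + q) = (\<lambda>vs. alt_of p vs + alt_of q vs)"
  by (auto simp: alt_of_def lookup_add algebra_simps)

lemma alt_of_smul: "alt_of (smul a p) = (\<lambda>vs. a * alt_of p vs)"
  by (auto simp: alt_of_def)

lemma alt_of_zero: "alt_of 0 = (\<lambda>vs. 0)"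
  by (auto simp: alt_of_def)

lemma set_of_add: "c \<in> altc \<Longrightarrow> d \<in> altc \<Longrightarrow> set_of (\<lambda>vs. c vs + d vs) = set_of c + set_of d"
  by (rule poly_mapping_eqI) (simp add: lookup_set_of altc_add lookup_add)

lemma set_of_smult: "c \<in> altc \<Longrightarrow> set_of (\<lambda>vs. a * c vs) = smul a (set_of c)"
  by (rule poly_mapping_eqI) (simp add: lookup_set_of altc_smult)

lemma set_of_zero: "set_of (\<lambda>_. 0) = 0"
  by (rule poly_mapping_eqI) (simp add: lookup_set_of altc_zero)

text \<open>The augmented boundary operator, with the empty simplex as a basis element.\<close>

definition abd :: "('a set \<Rightarrow>\<^sub>0 'f::field) \<Rightarrow> ('a set \<Rightarrow>\<^sub>0 'f)" where
  "abd p = set_of (boundary (alt_of p))"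

definition scone :: "'a \<Rightarrow> ('a set \<Rightarrow>\<^sub>0 'f::field) \<Rightarrow> ('a set \<Rightarrow>\<^sub>0 'f)" where
  "scone v p = set_of (lcone v (alt_of p))"

lemma lin_abd: "lin abd"
  by (rule linI)
    (simp_all add: abd_def alt_of_add alt_of_smul boundary_add boundary_smult alt_of_altc
      set_of_add set_of_smult boundary_altc)

lemma lin_scone: "lin (scone v)"
  by (rule linI)
    (simp_all add: scone_def alt_of_add alt_of_smul lcone_add lcone_smult alt_of_altc
      set_of_add set_of_smult lcone_altc)

lemma alt_of_abd: "alt_of (abd p) = boundary (alt_of p)"
  by (simp add: abd_def alt_of_set_of boundary_altc alt_of_altc)

lemma alt_of_scone: "alt_of (scone v p) = lcone v (alt_of p)"
  by (simp add: scone_def alt_of_set_of lcone_altc alt_of_altc)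

lemma abd_abd: "abd (abd p) = 0"
  by (simp add: abd_def[of "abd p"] alt_of_abd boundary_boundary alt_of_altc set_of_zero)

text \<open>Infinite sets are basis elements of the type but represent no chain, hence the support
  condition.\<close>

lemma abd_scone:
  assumes "p \<in> fsub {\<sigma>. finite \<sigma>}"
  shows "abd (scone v p) + scone v (abd p) = p"
proof -
  have "abd (scone v p) + scone v (abd p) = set_of (\<lambda>vs. boundary (lcone v (alt_of p)) vs + lcone v (boundary (alt_of p)) vs)"
    by (simp add: abd_def[of "scone v p"] scone_def[of v "abd p"] alt_of_abd alt_of_scone
        set_of_add boundary_altc lcone_altc alt_of_altc)
  also have "\<dots> = p"
    using assms by (simp add: boundary_lcone alt_of_altc set_of_alt_of)
  finally show ?thesis .
qed

text \<open>Only the support of the boundary of a simplex is recorded. The later arguments rest on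
  supports, on \<open>abd_abd\<close> and on the cone identity, never on explicit incidence
  signs.\<close>

lemma lookup_abd_delta:
  assumes "lookup (abd (delta \<sigma>)) \<tau> \<noteq> (0 :: 'f::field)"
  shows "finite \<sigma> \<and> (\<exists>v\<in>\<sigma>. \<tau> = \<sigma> - {v})"
proof -
  have \<tau>: "finite \<tau>" "boundary (alt_of (delta \<sigma> :: _ \<Rightarrow>\<^sub>0 'f)) (ori \<tau>) \<noteq> 0"
    using assms by (auto simp: abd_def lookup_set_of boundary_altc alt_of_altc split: if_splits)
  then obtain v where "alt_of (delta \<sigma> :: _ \<Rightarrow>\<^sub>0 'f) (v # ori \<tau>) \<noteq> 0"
    using boundary_nonzero by blast
  then have "v \<notin> \<tau>" "\<sigma> = insert v \<tau>"
    using alt_of_nonzero \<tau>(1) by (fastforce simp: ori)+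
  then show ?thesis using \<tau>(1) by auto
qed

lemma lookup_scone_delta:
  assumes "lookup (scone v (delta \<sigma>)) \<tau> \<noteq> (0 :: 'f::field)"
  shows "finite \<sigma> \<and> v \<notin> \<sigma> \<and> \<tau> = insert v \<sigma>"
proof -
  have \<tau>: "finite \<tau>" "lcone v (alt_of (delta \<sigma> :: _ \<Rightarrow>\<^sub>0 'f)) (ori \<tau>) \<noteq> 0"
    using assms by (auto simp: scone_def lookup_set_of lcone_altc alt_of_altc split: if_splits)
  obtain xs ys where xy: "ori \<tau> = xs @ v # ys" "distinct (ori \<tau>)"
      "alt_of (delta \<sigma> :: _ \<Rightarrow>\<^sub>0 'f) (xs @ ys) \<noteq> 0"
    by (rule lcone_nonzero[OF \<tau>(2)])
  then have "set (xs @ ys) = \<sigma>" using alt_of_nonzero by fastforce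
  moreover have "\<tau> = set (xs @ v # ys)" using ori(2)[OF \<tau>(1)] xy(1) by simp
  ultimately show ?thesis using xy(1,2) by auto
qed

lemma abd_fsub:
  assumes "p \<in> fsub S" "\<And>\<sigma> v. \<sigma> \<in> S \<Longrightarrow> finite \<sigma> \<Longrightarrow> v \<in> \<sigma> \<Longrightarrow> \<sigma> - {v} \<in> T"
  shows "abd p \<in> fsub T"
proof (rule lin_fsub[OF lin_abd _ assms(1)])
  show "abd (delta \<sigma>) \<in> fsub T" if "\<sigma> \<in> S" for \<sigma>
    using lookup_abd_delta assms(2)[OF that] by (intro fsubI) blast
qed

lemma scone_fsub:
  fixes p :: "'a set \<Rightarrow>\<^sub>0 'f::field"
  assumes p: "p \<in> fsub S" and ST: "\<And>\<sigma>. \<sigma> \<in> S \<Longrightarrow> finite \<sigma> \<Longrightarrow> v \<notin> \<sigma> \<Longrightarrow> insert v \<sigma> \<in> T"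
  shows "scone v p \<in> fsub T"
proof (rule lin_fsub[OF lin_scone _ p])
  fix \<sigma> assume \<sigma>: "\<sigma> \<in> S"
  show "scone v (delta \<sigma>) \<in> (fsub T :: (_ \<Rightarrow>\<^sub>0 'f) set)"
  proof (rule fsubI)
    fix \<tau> assume "lookup (scone v (delta \<sigma>)) \<tau> \<noteq> (0 :: 'f)"
    from lookup_scone_delta[OF this] ST[OF \<sigma>] show "\<tau> \<in> T" by auto
  qed
qed

subsection \<open>Pulling back along an injection of vertices\<close>

text \<open>Chains are functions on lists, so a vertex map acts by precomposition. The orderings
  chosen by \<open>ori\<close> on the two vertex types are not related by \<open>\<iota>\<close>,
  and in this form they need not be compared.\<close>

definition pullback :: "('a \<Rightarrow> 'c) \<Rightarrow> ('c set \<Rightarrow>\<^sub>0 'f::field) \<Rightarrow> 'a list \<Rightarrow> 'f" where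
  "pullback \<iota> p vs = alt_of p (map \<iota> vs)"

text \<open>The index is the cardinality, one more than the dimension, so that the empty simplex has
  index 0.\<close>

definition csub :: "'c set set \<Rightarrow> nat \<Rightarrow> ('c set \<Rightarrow>\<^sub>0 'f::field) set" where
  "csub K k = fsub {\<sigma> \<in> K. card \<sigma> = k}"

lemma subspace_csub: "fv.subspace (csub K k)"
  unfolding csub_def by (rule subspace_fsub)

lemma pullback_add: "pullback \<iota> (p + q) = (\<lambda>vs. pullback \<iota> p vs + pullback \<iota> q vs)"
  by (simp add: pullback_def alt_of_add fun_eq_iff)

lemma pullback_smul: "pullback \<iota> (smul a p) = (\<lambda>vs. a * pullback \<iota> p vs)"
  by (simp add: pullback_def alt_of_smul fun_eq_iff)

lemma pullback_zero: "pullback \<iota> 0 = (\<lambda>vs. 0)"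
  by (simp add: pullback_def alt_of_zero fun_eq_iff)

context
  fixes \<iota> :: "'a \<Rightarrow> 'c"
  assumes inj: "inj \<iota>"
begin

lemma pullback_altc:
  fixes p :: "'c set \<Rightarrow>\<^sub>0 'f::field"
  shows "pullback \<iota> p \<in> altc"
proof (rule altcI)
  have "map \<iota> ` {vs. pullback \<iota> p vs \<noteq> 0} \<subseteq> {vs. alt_of p vs \<noteq> 0}"
    by (auto simp: pullback_def)
  then have "finite (map \<iota> ` {vs. pullback \<iota> p vs \<noteq> 0})"
    by (rule finite_subset[OF _ altc_finite[OF alt_of_altc]])
  then show "finite {vs. pullback \<iota> p vs \<noteq> 0}"
    by (rule finite_imageD) (use inj in \<open>simp add: inj_on_def inj_map_eq_map\<close>)
  show "distinct vs" if "pullback \<iota> p vs \<noteq> 0" for vs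
    using that altc_distinct[OF alt_of_altc[of p], of "map \<iota> vs"] by (auto simp: pullback_def distinct_map)
  show "pullback \<iota> p (xs @ a # b # ys) = - pullback \<iota> p (xs @ b # a # ys)" for xs a b ys
    using altc_swap[OF alt_of_altc, of p "map \<iota> xs" "\<iota> a" "\<iota> b"] by (simp add: pullback_def)
qed

lemma pullback_chains:
  fixes p :: "'c set \<Rightarrow>\<^sub>0 'f::field"
  assumes "p \<in> csub ((`) \<iota> ` K) (Suc k)"
  shows "pullback \<iota> p \<in> chains K k"
proof -
  have "length vs = Suc k \<and> set vs \<in> K" if "pullback \<iota> p vs \<noteq> 0" for vs
  proof -
    have "distinct (map \<iota> vs)" "set (map \<iota> vs) \<in> keys p"
      using that alt_of_nonzero[of p "map \<iota> vs"] by (simp_all add: pullback_def)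
    moreover have "keys p \<subseteq> {\<sigma> \<in> (`) \<iota> ` K. card \<sigma> = Suc k}"
      using assms by (simp add: csub_def fsub_def)
    ultimately show ?thesis
      using inj distinct_card[of "map \<iota> vs"] by (auto simp: inj_image_eq_iff)
  qed
  then show ?thesis by (simp add: chains_eq pullback_altc)
qed

lemma pullback_chains_surj:
  assumes c: "c \<in> chains K k"
  obtains p where "p \<in> csub ((`) \<iota> ` K) (Suc k)" "pullback \<iota> p = c"
proof -
  have ca: "c \<in> altc" and cK: "\<And>vs. c vs \<noteq> 0 \<Longrightarrow> length vs = Suc k \<and> set vs \<in> K"
    using c by (auto simp: chains_eq)
  \<comment> \<open>The push-forward of \<open>c\<close>, extended by zero to lists with an entry
    outside the range of \<open>\<iota>\<close>.\<close>
  define c' where "c' ws = (if set ws \<subseteq> range \<iota> then c (map (inv_into UNIV \<iota>) ws) else 0)" for ws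
  have map_inv: "map \<iota> (map (inv_into UNIV \<iota>) ws) = ws" if "set ws \<subseteq> range \<iota>" for ws
    using that by (induction ws) (auto simp: f_inv_into_f)
  have inv_map: "map (inv_into UNIV \<iota>) (map \<iota> vs) = vs" for vs
    using inj by (induction vs) auto
  have c'_nz: "\<exists>vs. ws = map \<iota> vs \<and> c vs \<noteq> 0" if "c' ws \<noteq> 0" for ws
    using that map_inv[of ws] by (auto simp: c'_def split: if_splits intro: exI[of _ "map (inv_into UNIV \<iota>) ws"])
  have c'a: "c' \<in> altc"
  proof (rule altcI)
    show "finite {ws. c' ws \<noteq> 0}"
      by (rule finite_subset[of _ "map \<iota> ` {vs. c vs \<noteq> 0}"]) (use c'_nz altc_finite[OF ca] in auto)
    show "distinct ws" if "c' ws \<noteq> 0" for ws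
      using c'_nz[OF that] altc_distinct[OF ca] inj by (auto simp: distinct_map intro: inj_on_subset[OF _ subset_UNIV])
    show "c' (xs @ a # b # ys) = - c' (xs @ b # a # ys)" for xs a b ys
      using altc_swap[OF ca, of "map (inv_into UNIV \<iota>) xs" "inv_into UNIV \<iota> a" "inv_into UNIV \<iota> b"] by (auto simp: c'_def)
  qed
  show thesis
  proof
    show "pullback \<iota> (set_of c') = c"
    proof
      show "pullback \<iota> (set_of c') vs = c vs" for vs
        using inv_map[of vs] by (simp add: pullback_def alt_of_set_of[OF c'a] c'_def image_subset_iff del: map_map)
    qed
    show "set_of c' \<in> csub ((`) \<iota> ` K) (Suc k)"
      unfolding csub_def
    proof (rule fsubI)
      fix \<sigma> assume "lookup (set_of c') \<sigma> \<noteq> 0"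
      then have \<sigma>: "finite \<sigma>" "c' (ori \<sigma>) \<noteq> 0"
        by (auto simp: lookup_set_of[OF c'a] split: if_splits)
      then obtain vs where vs: "ori \<sigma> = map \<iota> vs" "c vs \<noteq> 0" using c'_nz by blast
      then have "\<sigma> = \<iota> ` set vs" "card \<sigma> = length vs"
        using ori[OF \<sigma>(1)] by (metis list.set_map, metis distinct_card length_map)
      then show "\<sigma> \<in> {\<sigma> \<in> (`) \<iota> ` K. card \<sigma> = Suc k}"
        using cK[OF vs(2)] by auto
    qed
  qed
qed

lemma pullback_eq_zero:
  assumes p: "p \<in> fsub {\<sigma>. finite \<sigma> \<and> \<sigma> \<subseteq> range \<iota>}" and "pullback \<iota> p = (\<lambda>_. 0)"
  shows "p = 0"
proof -
  have "alt_of p ws = 0" for ws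
  proof (rule ccontr)
    assume nz: "alt_of p ws \<noteq> 0"
    then have "set ws \<subseteq> range \<iota>"
      using alt_of_nonzero p by (fastforce simp: fsub_def)
    then obtain vs where "ws = map \<iota> vs"
      by (metis (full_types) ex_map_conv image_iff subset_iff)
    then show False using nz assms(2) by (auto simp: pullback_def dest: fun_cong)
  qed
  then have "alt_of p = (\<lambda>_. 0)" by auto
  moreover have "p \<in> fsub {\<sigma>. finite \<sigma>}"
    using p by (rule fsub_mono) auto
  ultimately show ?thesis using set_of_alt_of[of p] by (simp add: set_of_zero)
qed

text \<open>A vertex that completes a list to a simplex of \<open>p\<close> lies in the range of
  \<open>\<iota>\<close>, so the boundary sum loses no term when it is indexed by the smaller vertex
  type.\<close>

lemma pullback_abd:
  fixes p :: "'c set \<Rightarrow>\<^sub>0 'f::field"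
  assumes p: "p \<in> fsub {\<sigma>. \<sigma> \<subseteq> range \<iota>}"
  shows "pullback \<iota> (abd p) = boundary (pullback \<iota> p)"
proof
  fix vs
  let ?c = "alt_of p"
  have "{w. ?c (w # map \<iota> vs) \<noteq> 0} = \<iota> ` {v. ?c (map \<iota> (v # vs)) \<noteq> 0}"
  proof -
    have "w \<in> range \<iota>" if "?c (w # map \<iota> vs) \<noteq> 0" for w
      using alt_of_nonzero[OF that] p by (auto simp: fsub_def)
    then show ?thesis by auto
  qed
  then show "pullback \<iota> (abd p) vs = boundary (pullback \<iota> p) vs"
    using inj unfolding pullback_def alt_of_abd boundary_def
    by (simp add: sum.reindex inj_on_def)
qed

end


section \<open>Acyclic carriers\<close>

context
  fixes B :: "'b set" and deg :: "'b \<Rightarrow> nat" and S :: "'b \<Rightarrow> nat \<Rightarrow> 'c set"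
    and d :: "('b \<Rightarrow>\<^sub>0 'f::field) \<Rightarrow> ('b \<Rightarrow>\<^sub>0 'f)" and d' :: "('c \<Rightarrow>\<^sub>0 'f) \<Rightarrow> ('c \<Rightarrow>\<^sub>0 'f)"
    and \<epsilon>' :: "('c \<Rightarrow>\<^sub>0 'f) \<Rightarrow> ('u \<Rightarrow>\<^sub>0 'f)"
  assumes lin_d: "lin d" and lin_d': "lin d'" and lin_\<epsilon>': "lin \<epsilon>'"
    and d: "\<And>b. b \<in> B \<Longrightarrow> d (delta b) \<in> fsub {c \<in> B. Suc (deg c) = deg b \<and> (\<forall>n. S c n \<subseteq> S b n)}"
    and dd: "\<And>b. b \<in> B \<Longrightarrow> d (d (delta b)) = 0"
    and d'_0: "\<And>b z. b \<in> B \<Longrightarrow> z \<in> fsub (S b 0) \<Longrightarrow> d' z = 0"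
    and acyclic: "\<And>b n z. b \<in> B \<Longrightarrow> z \<in> fsub (S b n) \<Longrightarrow> d' z = 0 \<Longrightarrow> (n = 0 \<Longrightarrow> \<epsilon>' z = 0) \<Longrightarrow>
      \<exists>y\<in>fsub (S b (Suc n)). d' y = z"
begin

lemma d_delta_0: "b \<in> B \<Longrightarrow> deg b = 0 \<Longrightarrow> d (delta b) = 0"
  using d[of b] by (simp add: fsub_empty_iff)

text \<open>Recursion on the degree: the value already fixed on the boundary of \<open>b\<close> is
  a cycle in the carrier of \<open>b\<close>, because carriers of faces are contained in it, and
  there it bounds. In degree 0 a point with the prescribed augmentation starts the recursion;
  preservation of augmentations makes the cycle in degree 0 bound.\<close>

lemma carried_map_exists:
  fixes \<epsilon> :: "('b \<Rightarrow>\<^sub>0 'f) \<Rightarrow> ('u \<Rightarrow>\<^sub>0 'f)"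
  assumes lin_\<epsilon>: "lin \<epsilon>" and \<epsilon>_d: "\<And>b. b \<in> B \<Longrightarrow> \<epsilon> (d (delta b)) = 0"
    and point: "\<And>b. b \<in> B \<Longrightarrow> deg b = 0 \<Longrightarrow> \<exists>y\<in>fsub (S b 0). \<epsilon>' y = \<epsilon> (delta b)"
  obtains f where "lin f" "\<And>b. b \<in> B \<Longrightarrow> f (delta b) \<in> fsub (S b (deg b))"
    "\<And>b. b \<in> B \<Longrightarrow> d' (f (delta b)) = f (d (delta b))"
    "\<And>b. b \<in> B \<Longrightarrow> deg b = 0 \<Longrightarrow> \<epsilon>' (f (delta b)) = \<epsilon> (delta b)"
proof -
  \<comment> \<open>The condition at \<open>b\<close> consults \<open>u\<close> only on the boundary
    of \<open>b\<close>, that is, in smaller degree, which permits choice by well-founded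
    recursion.\<close>
  define P where "P u b r \<longleftrightarrow> (b \<in> B \<longrightarrow> r \<in> fsub (S b (deg b)) \<and> d' r = lext u (d (delta b)) \<and>
    (deg b = 0 \<longrightarrow> \<epsilon>' r = \<epsilon> (delta b)))" for u b r
  have "\<exists>u. \<forall>b. P u b (u b)"
  proof (rule dependent_wf_choice[of "Wellfounded.measure deg"])
    fix u v :: "'b \<Rightarrow> ('c \<Rightarrow>\<^sub>0 'f)" and b r
    assume "\<And>c. (c, b) \<in> Wellfounded.measure deg \<Longrightarrow> u c = v c"
    then have "lext u (d (delta b)) = lext v (d (delta b))" if "b \<in> B"
      using d[OF that] by (intro lext_cong) auto
    then show "P u b r = P v b r" by (auto simp: P_def)
  next
    fix b and u :: "'b \<Rightarrow> ('c \<Rightarrow>\<^sub>0 'f)"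
    assume IH: "\<And>c. (c, b) \<in> Wellfounded.measure deg \<Longrightarrow> P u c (u c)"
    have "\<exists>r. r \<in> fsub (S b (deg b)) \<and> d' r = lext u (d (delta b)) \<and> (deg b = 0 \<longrightarrow> \<epsilon>' r = \<epsilon> (delta b))"
      if b: "b \<in> B"
    proof (cases "deg b")
      case 0
      then show ?thesis
        using point[OF b] d'_0[OF b] d_delta_0[OF b] by (auto simp: lin_0[OF lin_lext])
    next
      case (Suc m)
      let ?C = "{c \<in> B. Suc (deg c) = deg b \<and> (\<forall>n. S c n \<subseteq> S b n)}"
      have u: "u c \<in> fsub (S c (deg c))" "d' (u c) = lext u (d (delta c))"
        "deg c = 0 \<Longrightarrow> \<epsilon>' (u c) = \<epsilon> (delta c)" if "c \<in> ?C" for c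
        using IH[of c] that by (auto simp: P_def)
      let ?z = "lext u (d (delta b))"
      have "?z \<in> fsub (S b m)"
      proof (rule lin_fsub[OF lin_lext _ d[OF b]])
        show "lext u (delta c) \<in> fsub (S b m)" if "c \<in> ?C" for c
          using u(1)[OF that] that Suc by (auto intro: fsub_mono)
      qed
      moreover have "d' ?z = lext u (d (d (delta b)))"
        by (rule lin_eq_on[OF lin_comp[OF lin_d' lin_lext] lin_comp[OF lin_lext lin_d] _ d[OF b]])
          (simp add: u(2))
      moreover have "\<epsilon>' ?z = \<epsilon> (d (delta b))" if "m = 0"
        by (rule lin_eq_on[OF lin_comp[OF lin_\<epsilon>' lin_lext] lin_\<epsilon> _ d[OF b]])
          (use u(3) that Suc in simp)
      ultimately show ?thesis
        using acyclic[OF b, of ?z m] Suc by (auto simp: dd[OF b] \<epsilon>_d[OF b] lin_0[OF lin_lext])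
    qed
    then show "\<exists>r. P u b r" by (auto simp: P_def)
  qed simp
  then obtain u where u: "\<And>b. P u b (u b)" by blast
  show thesis
    by (rule that[of "lext u"]) (use u in \<open>auto simp: P_def lin_lext\<close>)
qed

text \<open>The same recursion applied to the cycle formed by \<open>f\<close> at \<open>b\<close>
  minus the homotopy on the boundary of \<open>b\<close>. Here \<open>f\<close> stands for the
  difference of two carried chain maps that agree after augmentation.\<close>

lemma carried_homotopy_exists:
  assumes lin_f: "lin f" and f: "\<And>b. b \<in> B \<Longrightarrow> f (delta b) \<in> fsub (S b (deg b))"
    and f_d: "\<And>b. b \<in> B \<Longrightarrow> d' (f (delta b)) = f (d (delta b))"
    and \<epsilon>_f: "\<And>b. b \<in> B \<Longrightarrow> deg b = 0 \<Longrightarrow> \<epsilon>' (f (delta b)) = 0"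
  obtains D where "lin D" "\<And>b. b \<in> B \<Longrightarrow> D (delta b) \<in> fsub (S b (Suc (deg b)))"
    "\<And>b. b \<in> B \<Longrightarrow> d' (D (delta b)) + D (d (delta b)) = f (delta b)"
proof -
  define P where "P u b r \<longleftrightarrow> (b \<in> B \<longrightarrow> r \<in> fsub (S b (Suc (deg b))) \<and>
    d' r = f (delta b) - lext u (d (delta b)))" for u b r
  have "\<exists>u. \<forall>b. P u b (u b)"
  proof (rule dependent_wf_choice[of "Wellfounded.measure deg"])
    fix u v :: "'b \<Rightarrow> ('c \<Rightarrow>\<^sub>0 'f)" and b r
    assume "\<And>c. (c, b) \<in> Wellfounded.measure deg \<Longrightarrow> u c = v c"
    then have "lext u (d (delta b)) = lext v (d (delta b))" if "b \<in> B"
      using d[OF that] by (intro lext_cong) auto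
    then show "P u b r = P v b r" by (auto simp: P_def)
  next
    fix b and u :: "'b \<Rightarrow> ('c \<Rightarrow>\<^sub>0 'f)"
    assume IH: "\<And>c. (c, b) \<in> Wellfounded.measure deg \<Longrightarrow> P u c (u c)"
    have "\<exists>r. r \<in> fsub (S b (Suc (deg b))) \<and> d' r = f (delta b) - lext u (d (delta b))"
      if b: "b \<in> B"
    proof -
      let ?C = "{c \<in> B. Suc (deg c) = deg b \<and> (\<forall>n. S c n \<subseteq> S b n)}"
      have u: "u c \<in> fsub (S c (Suc (deg c)))" "d' (u c) = f (delta c) - lext u (d (delta c))"
        if "c \<in> ?C" for c
        using IH[of c] that by (auto simp: P_def)
      let ?z = "lext u (d (delta b))"
      have "?z \<in> fsub (S b (deg b))"
      proof (rule lin_fsub[OF lin_lext _ d[OF b]])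
        show "lext u (delta c) \<in> fsub (S b (deg b))" if "c \<in> ?C" for c
          using u(1)[OF that] that by (auto intro: fsub_mono)
      qed
      then have "f (delta b) - ?z \<in> fsub (S b (deg b))"
        using f[OF b] by (rule fsub_diff[rotated])
      moreover have "d' ?z = f (d (delta b)) - lext u (d (d (delta b)))"
        by (rule lin_eq_on[OF lin_comp[OF lin_d' lin_lext]
              lin_minus[OF lin_f lin_comp[OF lin_lext lin_d]] _ d[OF b]]) (simp add: u(2))
      then have "d' (f (delta b) - ?z) = 0"
        by (simp add: lin_diff[OF lin_d'] f_d[OF b] dd[OF b] lin_0[OF lin_lext])
      moreover have "\<epsilon>' (f (delta b) - ?z) = 0" if "deg b = 0"
        using that by (simp add: d_delta_0[OF b] lin_0[OF lin_lext] \<epsilon>_f[OF b])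
      ultimately have "\<exists>y\<in>fsub (S b (Suc (deg b))). d' y = f (delta b) - ?z"
        by (intro acyclic[OF b])
      then show ?thesis by blast
    qed
    then show "\<exists>r. P u b r" by (auto simp: P_def)
  qed simp
  then obtain u where u: "\<And>b. P u b (u b)" by blast
  show thesis
    by (rule that[of "lext u"]) (use u in \<open>auto simp: P_def lin_lext\<close>)
qed

end


section \<open>The chain complex of a simplicial complex\<close>

definition bd :: "('a set \<Rightarrow>\<^sub>0 'f::field) \<Rightarrow> ('a set \<Rightarrow>\<^sub>0 'f)" where
  "bd p = restr (- {{}}) (abd p)"

text \<open>The coefficient of the empty simplex in the augmented boundary. It is placed in a
  one-dimensional free space so that it is a linear map of the form used for carriers.\<close>

definition aug :: "('a set \<Rightarrow>\<^sub>0 'f::field) \<Rightarrow> (unit \<Rightarrow>\<^sub>0 'f)" where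
  "aug p = smul (lookup (abd p) {}) (delta ())"

text \<open>A vertex as the cone over the empty simplex, so that its augmented boundary follows from
  \<open>abd_scone\<close>.\<close>

definition point :: "'a \<Rightarrow> ('a set \<Rightarrow>\<^sub>0 'f::field)" where
  "point v = scone v (delta {})"

lemma lin_bd: "lin bd"
  unfolding bd_def[abs_def] by (rule lin_comp[OF lin_restr lin_abd])

lemma lin_coeff: "lin (\<lambda>p. smul (lookup p b) q)"
  by (rule linI) (simp_all add: lookup_add fv.scale_left_distrib)

lemma lin_aug: "lin aug"
  unfolding aug_def[abs_def] by (rule lin_comp[OF lin_coeff lin_abd])

lemma delta_nonzero: "delta b \<noteq> (0 :: 'b \<Rightarrow>\<^sub>0 'f::field)"
  by (metis lookup_single_eq lookup_zero zero_neq_one)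

lemma aug_eq_0_iff: "aug p = 0 \<longleftrightarrow> lookup (abd p) {} = 0"
  by (simp add: aug_def delta_nonzero)

lemma abd_empty: "abd (delta {}) = 0"
  using lookup_abd_delta[of "{}"] by (intro poly_mapping_eqI) auto

lemma abd_eq: "abd p = bd p + smul (lookup (abd p) {}) (delta {})"
  by (rule poly_mapping_eqI) (auto simp: bd_def lookup_add lookup_restr lookup_single when_def)

lemma abd_bd: "abd (bd p) = 0"
proof -
  have "abd (abd p) = abd (bd p) + smul (lookup (abd p) {}) (abd (delta {}))"
    by (subst abd_eq) (simp add: lin_add[OF lin_abd] lin_scale[OF lin_abd])
  then show ?thesis by (simp add: abd_abd abd_empty)
qed

lemma bd_bd: "bd (bd p) = 0"
  by (simp add: bd_def[of "bd p"] abd_bd lin_0[OF lin_restr])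

lemma aug_bd: "aug (bd p) = 0"
  by (simp add: aug_eq_0_iff abd_bd)

lemma bd_fsub:
  assumes "p \<in> fsub S" "\<And>\<sigma> v. \<sigma> \<in> S \<Longrightarrow> finite \<sigma> \<Longrightarrow> v \<in> \<sigma> \<Longrightarrow> \<sigma> - {v} \<noteq> {} \<Longrightarrow> \<sigma> - {v} \<in> T"
  shows "bd p \<in> fsub T"
proof -
  have "abd p \<in> fsub (T \<union> {{}})" by (rule abd_fsub[OF assms(1)]) (use assms(2) in blast)
  then show ?thesis unfolding bd_def by (rule restr_fsub'[THEN fsub_mono]) auto
qed

lemma bd_eq_abd:
  assumes "p \<in> fsub {\<sigma>. 2 \<le> card \<sigma>}"
  shows "bd p = abd p"
proof -
  have "abd p \<in> fsub (- {{}})"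
    by (rule abd_fsub[OF assms]) (auto simp: card_le_Suc_iff numeral_2_eq_2 insert_eq_iff)
  then show ?thesis by (simp add: bd_def restr_id)
qed

text \<open>The unaugmented form of \<open>abd_scone\<close>: the part of the cone that comes from
  the empty simplex becomes a multiple of the apex. The cone is thus a homotopy from the identity to
  the projection onto one vertex.\<close>

lemma scone_contraction:
  assumes p: "p \<in> fsub {\<sigma>. finite \<sigma> \<and> \<sigma> \<noteq> {}}"
  shows "bd (scone v p) + scone v (bd p) = p - smul (lookup (abd p) {}) (point v)"
proof -
  have "abd (scone v p) = p - scone v (abd p)"
    using abd_scone[of p v] p by (metis (no_types, lifting) add_diff_cancel_right' fsub_mono mem_Collect_eq subsetI)
  moreover have "p - scone v (abd p) \<in> fsub (- {{}})"
  proof (rule fsub_diff)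
    show "p \<in> fsub (- {{}})" using p by (rule fsub_mono) auto
    show "scone v (abd p) \<in> fsub (- {{}})"
      by (rule scone_fsub[where S = UNIV]) auto
  qed
  ultimately have "bd (scone v p) = p - scone v (abd p)"
    by (simp add: bd_def restr_id)
  moreover have "scone v (abd p) = scone v (bd p) + smul (lookup (abd p) {}) (point v)"
    by (subst abd_eq) (simp add: lin_add[OF lin_scone] lin_scale[OF lin_scone] point_def)
  ultimately show ?thesis by (simp add: algebra_simps)
qed

lemma point_fsub: "point v \<in> fsub {{v}}"
  unfolding point_def by (rule scone_fsub[where S = "{{}}"]) auto

lemma abd_point: "abd (point v) = delta {}"
  using abd_scone[of "delta {}" v] by (simp add: point_def abd_empty lin_0[OF lin_scone])

lemma bd_point: "bd (point v) = 0"
  by (simp add: bd_def abd_point restr_delta)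

definition nes :: "'a set set" where
  "nes = {\<sigma>. finite \<sigma> \<and> \<sigma> \<noteq> {}}"

definition sc_complex :: "'a set set \<Rightarrow> bool" where
  "sc_complex K \<longleftrightarrow> K \<subseteq> nes \<and> (\<forall>\<sigma>\<in>K. \<forall>\<tau>\<subseteq>\<sigma>. \<tau> \<noteq> {} \<longrightarrow> \<tau> \<in> K)"

definition full_simplex :: "'a set \<Rightarrow> 'a set set" where
  "full_simplex A = {\<sigma>. \<sigma> \<subseteq> A \<and> \<sigma> \<noteq> {}}"

lemma complexD: "sc_complex K \<Longrightarrow> \<sigma> \<in> K \<Longrightarrow> \<tau> \<subseteq> \<sigma> \<Longrightarrow> \<tau> \<noteq> {} \<Longrightarrow> \<tau> \<in> K"
  by (auto simp: sc_complex_def)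

lemma complex_nes: "sc_complex K \<Longrightarrow> \<sigma> \<in> K \<Longrightarrow> \<sigma> \<in> nes"
  by (auto simp: sc_complex_def)

lemma complex_finite: "sc_complex K \<Longrightarrow> \<sigma> \<in> K \<Longrightarrow> finite \<sigma> \<and> \<sigma> \<noteq> {} \<and> 0 < card \<sigma>"
  by (auto simp: sc_complex_def nes_def card_gt_0_iff)

lemma complex_simplex: "finite A \<Longrightarrow> sc_complex (full_simplex A)"
  by (auto simp: sc_complex_def full_simplex_def nes_def intro: finite_subset)

lemma complex_simplex_le: "sc_complex K \<Longrightarrow> \<sigma> \<in> K \<Longrightarrow> full_simplex \<sigma> \<subseteq> K"
  by (auto simp: sc_complex_def full_simplex_def)

lemma csub_mono: "p \<in> csub K n \<Longrightarrow> K \<subseteq> L \<Longrightarrow> p \<in> csub L n"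
  unfolding csub_def by (erule fsub_mono) auto

lemma bd_csub:
  assumes "sc_complex K" "p \<in> csub K (Suc n)"
  shows "bd p \<in> csub K n"
  unfolding csub_def
proof (rule bd_fsub[OF assms(2)[unfolded csub_def]])
  fix \<sigma> v assume "\<sigma> \<in> {\<sigma> \<in> K. card \<sigma> = Suc n}" "finite \<sigma>" "v \<in> \<sigma>" "\<sigma> - {v} \<noteq> {}"
  then show "\<sigma> - {v} \<in> {\<sigma> \<in> K. card \<sigma> = n}"
    using complexD[OF assms(1), of \<sigma> "\<sigma> - {v}"] by auto
qed

lemma csub_0: "sc_complex K \<Longrightarrow> p \<in> csub K 0 \<Longrightarrow> p = 0"
proof -
  assume K: "sc_complex K" and p: "p \<in> csub K 0"
  have "{\<sigma> \<in> K. card \<sigma> = 0} = {}" using complex_finite[OF K] by fastforce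
  with p have "p \<in> fsub {}" by (simp only: csub_def)
  then show ?thesis by (simp add: fsub_empty_iff)
qed

lemma csub_nes: "sc_complex K \<Longrightarrow> p \<in> csub K n \<Longrightarrow> p \<in> fsub {\<sigma>. finite \<sigma> \<and> \<sigma> \<noteq> {}}"
  unfolding csub_def by (erule fsub_mono) (auto dest: complex_finite)

lemma scone_csub: "v \<in> A \<Longrightarrow> p \<in> csub (full_simplex A) n \<Longrightarrow> scone v p \<in> csub (full_simplex A) (Suc n)"
  unfolding csub_def by (erule scone_fsub) (auto simp: full_simplex_def)

lemma aug_csub:
  assumes "p \<in> csub K (Suc (Suc n))"
  shows "aug p = 0"
proof -
  have "abd p \<in> fsub (- {{}})"
    by (rule abd_fsub[OF assms[unfolded csub_def]]) (auto simp: card_Suc_eq_finite insert_eq_iff)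
  then show ?thesis using fsubD by (fastforce simp: aug_eq_0_iff)
qed

text \<open>Coning from any vertex of \<open>A\<close> fills the cycle. The multiple of the apex
  drops out by the augmentation hypothesis in degree 0, and in higher degrees because those
  simplices have no empty face.\<close>

lemma simplex_acyclic:
  assumes "finite A" "A \<noteq> {}" "z \<in> csub (full_simplex A) (Suc n)" "bd z = 0" "n = 0 \<Longrightarrow> aug z = 0"
  shows "\<exists>y\<in>csub (full_simplex A) (Suc (Suc n)). bd y = z"
proof -
  obtain v where v: "v \<in> A" using assms by blast
  have "lookup (abd z) {} = 0"
    using assms(5) aug_csub[of z _ "n - 1"] assms(3) by (cases n) (auto simp: aug_eq_0_iff)
  then have "bd (scone v z) = z"
    using scone_contraction[OF csub_nes[OF complex_simplex[OF assms(1)] assms(3)], of v] assms(4)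
    by (simp add: lin_0[OF lin_scone])
  then show ?thesis using scone_csub[OF v assms(3)] by blast
qed

section \<open>The tensor product of chain complexes\<close>

text \<open>Simplices are graded by their cardinality, so that the sign differs from the usual one by a
  global factor.\<close>

definition sgno :: "('a set \<Rightarrow>\<^sub>0 'f::field) \<Rightarrow> ('a set \<Rightarrow>\<^sub>0 'f)" where
  "sgno = lext (\<lambda>\<sigma>. smul ((- 1) ^ card \<sigma>) (delta \<sigma>))"

lemma lin_sgno: "lin sgno"
  unfolding sgno_def by (rule lin_lext)

lemma sgno_csub: "p \<in> csub K n \<Longrightarrow> sgno p = smul ((- 1) ^ n) p"
  unfolding csub_def
  by (rule lin_eq_on[OF lin_sgno lin_smul]) (auto simp: sgno_def)

text \<open>The Leibniz rule with sign \<open>(-1)^n\<close> for a left factor of cardinality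
  \<open>n\<close>. Carrying the sign in the linear operator \<open>sgno\<close> makes the formula
  valid for mixed degrees.\<close>

definition tbd :: "('a set \<times> 'b set \<Rightarrow>\<^sub>0 'f::field) \<Rightarrow> ('a set \<times> 'b set \<Rightarrow>\<^sub>0 'f)" where
  "tbd z = tmap bd (\<lambda>y. y) z + tmap sgno bd z"

lemma lin_tbd: "lin tbd"
  unfolding tbd_def[abs_def] by (intro lin_plus lin_tmap)

lemma tbd_tens: "tbd (tens x y) = tens (bd x) y + tens (sgno x) (bd y)"
  by (simp add: tbd_def tmap_tens lin_bd lin_ident lin_sgno)

text \<open>The index is the sum of the two cardinalities, so the total dimension is
  \<open>n - 2\<close>.\<close>

definition tsub :: "'a set set \<Rightarrow> 'b set set \<Rightarrow> nat \<Rightarrow> ('a set \<times> 'b set \<Rightarrow>\<^sub>0 'f::field) set" where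
  "tsub K L n = fsub {(\<sigma>, \<tau>). \<sigma> \<in> K \<and> \<tau> \<in> L \<and> card \<sigma> + card \<tau> = n}"

lemma tsub_mono: "p \<in> tsub K L n \<Longrightarrow> K \<subseteq> K' \<Longrightarrow> L \<subseteq> L' \<Longrightarrow> p \<in> tsub K' L' n"
  unfolding tsub_def by (erule fsub_mono) auto

lemma tens_tsub: "x \<in> csub K m \<Longrightarrow> y \<in> csub L n \<Longrightarrow> tens x y \<in> tsub K L (m + n)"
  unfolding tsub_def csub_def by (drule (1) tens_fsub, erule fsub_mono) auto

lemma delta_csub: "delta \<sigma> \<in> csub K n \<longleftrightarrow> \<sigma> \<in> K \<and> card \<sigma> = n"
  by (auto simp: csub_def)

lemma delta_tsub: "delta (\<sigma>, \<tau>) \<in> tsub K L n \<longleftrightarrow> \<sigma> \<in> K \<and> \<tau> \<in> L \<and> card \<sigma> + card \<tau> = n"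
  by (auto simp: tsub_def)

lemma subspace_tsub: "fv.subspace (tsub K L k)"
  unfolding tsub_def by (rule subspace_fsub)

lemma lin_csub_mem:
  assumes "lin f" "fv.subspace W" "\<And>\<sigma>. \<sigma> \<in> K \<Longrightarrow> card \<sigma> = n \<Longrightarrow> f (delta \<sigma>) \<in> W" "z \<in> csub K n"
  shows "f z \<in> W"
  by (rule lin_mem[OF assms(1,2) _ assms(4)[unfolded csub_def]]) (use assms(3) in auto)

lemma lin_csub_eq:
  assumes "lin f" "lin g" "\<And>\<sigma>. \<sigma> \<in> K \<Longrightarrow> card \<sigma> = n \<Longrightarrow> f (delta \<sigma>) = g (delta \<sigma>)" "z \<in> csub K n"
  shows "f z = g z"
  by (rule lin_eq_on[OF assms(1,2) _ assms(4)[unfolded csub_def]]) (use assms(3) in auto)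

lemma lin_tsub_mem:
  assumes "lin f" "fv.subspace W" "z \<in> tsub K L n"
    "\<And>\<sigma> \<tau>. \<sigma> \<in> K \<Longrightarrow> \<tau> \<in> L \<Longrightarrow> card \<sigma> + card \<tau> = n \<Longrightarrow> f (tens (delta \<sigma>) (delta \<tau>)) \<in> W"
  shows "f z \<in> W"
  by (rule lin_mem[OF assms(1,2) _ assms(3)[unfolded tsub_def]]) (use assms(4) in auto)

lemma lin_tsub_eq:
  assumes "lin f" "lin g" "z \<in> tsub K L n"
    "\<And>\<sigma> \<tau>. \<sigma> \<in> K \<Longrightarrow> \<tau> \<in> L \<Longrightarrow> card \<sigma> + card \<tau> = n \<Longrightarrow>
      f (tens (delta \<sigma>) (delta \<tau>)) = g (tens (delta \<sigma>) (delta \<tau>))"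
  shows "f z = g z"
  by (rule lin_eq_on[OF assms(1,2) _ assms(3)[unfolded tsub_def]]) (use assms(4) in auto)

lemma tens_bd_tsub:
  assumes K: "sc_complex K" "sc_complex L" and x: "x \<in> csub K i" "y \<in> csub L j" and n: "i + j = Suc n"
  shows "tens (bd x) y \<in> tsub K L n" "tens x (bd y) \<in> tsub K L n"
proof -
  show "tens (bd x) y \<in> tsub K L n"
  proof (cases i)
    case 0
    then show ?thesis
      using csub_0[OF K(1), of x] x(1) by (simp add: lin_0[OF lin_bd] fv.subspace_0[OF subspace_tsub])
  next
    case (Suc i')
    then show ?thesis using tens_tsub[OF bd_csub[OF K(1)] x(2), of x i'] x n by simp
  qed
  show "tens x (bd y) \<in> tsub K L n"
  proof (cases j)
    case 0
    then show ?thesis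
      using csub_0[OF K(2), of y] x(2) by (simp add: lin_0[OF lin_bd] fv.subspace_0[OF subspace_tsub])
  next
    case (Suc j')
    then show ?thesis using tens_tsub[OF x(1) bd_csub[OF K(2)], of y j'] x n by simp
  qed
qed

lemma tbd_tsub:
  assumes K: "sc_complex K" "sc_complex L" and z: "z \<in> tsub K L (Suc n)"
  shows "tbd z \<in> tsub K L n"
proof (rule lin_tsub_mem[OF lin_tbd subspace_tsub z])
  fix \<sigma> \<tau> assume "\<sigma> \<in> K" "\<tau> \<in> L" and c: "card \<sigma> + card \<tau> = Suc n"
  then have \<sigma>: "delta \<sigma> \<in> csub K (card \<sigma>)" and \<tau>: "delta \<tau> \<in> csub L (card \<tau>)"
    by (simp_all add: delta_csub)
  show "tbd (tens (delta \<sigma>) (delta \<tau>)) \<in> tsub K L n"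
    unfolding tbd_tens sgno_csub[OF \<sigma>] tens_smul_left
    by (intro fv.subspace_add[OF subspace_tsub] fv.subspace_scale[OF subspace_tsub]
        tens_bd_tsub[OF K \<sigma> \<tau> c])
qed

lemma sgno_bd_csub:
  assumes "sc_complex K" "x \<in> csub K n"
  shows "sgno (bd x) = - smul ((- 1) ^ n) (bd x)"
proof (cases n)
  case 0
  then show ?thesis using csub_0[OF assms(1), of x] assms(2) by (auto simp: lin_0[OF lin_bd] lin_0[OF lin_sgno])
next
  case (Suc m)
  then show ?thesis using sgno_csub[OF bd_csub[OF assms(1)], of x m] assms by simp
qed

lemma tbd_tens_csub:
  assumes "x \<in> csub K n"
  shows "tbd (tens x y) = tens (bd x) y + smul ((- 1) ^ n) (tens x (bd y))"
  by (simp add: tbd_tens sgno_csub[OF assms] tens_smul_left)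

lemma sq_sign: "((- 1) ^ n * (- 1) ^ n :: 'f::field) = 1"
  by (simp flip: power_mult_distrib)

text \<open>The mixed terms cancel because \<open>bd\<close> lowers the cardinality by one and
  thereby flips the sign given by \<open>sgno\<close>.\<close>

lemma tbd_tbd:
  assumes K: "sc_complex K" "sc_complex L" and z: "z \<in> tsub K L n"
  shows "tbd (tbd z) = 0"
proof (rule lin_tsub_eq[OF lin_comp[OF lin_tbd lin_tbd] lin_zero z])
  fix \<sigma> \<tau> assume "\<sigma> \<in> K" "\<tau> \<in> L"
  then have \<sigma>: "delta \<sigma> \<in> csub K (card \<sigma>)" by (simp add: delta_csub)
  show "tbd (tbd (tens (delta \<sigma>) (delta \<tau>))) = 0"
    unfolding tbd_tens_csub[OF \<sigma>] lin_add[OF lin_tbd] lin_scale[OF lin_tbd]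
    unfolding tbd_tens sgno_bd_csub[OF K(1) \<sigma>] sgno_csub[OF \<sigma>]
    by (simp add: bd_bd tens_neg_left tens_smul_left)
qed

text \<open>\<open>s\<close> leads from the identity to \<open>P\<close> in the left factor, and
  then \<open>s'\<close> leads from the identity to \<open>P'\<close> in the right one; the sum of
  the two stages is a homotopy to the tensor product of \<open>P\<close> and \<open>P'\<close>. That
  \<open>P\<close> vanishes on the boundary of \<open>x\<close> and has a cycle as its value at
  \<open>x\<close> removes the remaining terms. Both the acyclicity of products of simplices and the
  Kuenneth theorem use this formula.\<close>

lemma tensor_homotopy:
  fixes x :: "'a set \<Rightarrow>\<^sub>0 'f::field" and y :: "'b set \<Rightarrow>\<^sub>0 'f"
  assumes lin: "lin s" "lin P" "lin s'"
    and K: "sc_complex K" and x: "x \<in> csub K n" "s x \<in> csub K (Suc n)" "P x \<in> csub K n"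
    and sx: "bd (s x) + s (bd x) = x - P x" "bd (P x) = 0" "P (bd x) = 0"
    and sy: "bd (s' y) + s' (bd y) = y - P' y"
  shows "tbd (tmap s (\<lambda>y. y) (tens x y) + tmap (\<lambda>x. sgno (P x)) s' (tens x y)) +
      (tmap s (\<lambda>y. y) (tbd (tens x y)) + tmap (\<lambda>x. sgno (P x)) s' (tbd (tens x y)))
    = tens x y - tens (P x) (P' y)"
proof -
  let ?e = "(- 1) ^ n :: 'f"
  define D where "D = (\<lambda>z. tmap s (\<lambda>y :: 'b set \<Rightarrow>\<^sub>0 'f. y) z + tmap (\<lambda>x. sgno (P x)) s' z)"
  have linD: "lin D" unfolding D_def by (intro lin_plus lin_tmap)
  note lsP = lin_comp[OF lin_sgno lin(2)]
  have "D (tens x y) = tens (s x) y + smul ?e (tens (P x) (s' y))"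
    by (simp add: D_def tmap_tens lin lin_ident lsP sgno_csub[OF x(3)] tens_smul_left)
  then have 1: "tbd (D (tens x y)) = tens (bd (s x)) y - smul ?e (tens (s x) (bd y)) + tens (P x) (bd (s' y))"
    by (simp add: lin_add[OF lin_tbd] lin_scale[OF lin_tbd] tbd_tens_csub[OF x(2)]
        tbd_tens_csub[OF x(3)] sx sq_sign fv.scale_right_distrib)
  have "D (tens (bd x) y) = tens (s (bd x)) y"
    by (simp add: D_def tmap_tens lin lin_ident lsP sx lin_0[OF lin_sgno])
  moreover have "D (tens x (bd y)) = tens (s x) (bd y) + smul ?e (tens (P x) (s' (bd y)))"
    by (simp add: D_def tmap_tens lin lin_ident lsP sgno_csub[OF x(3)] tens_smul_left)
  ultimately have 2: "D (tbd (tens x y)) =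
      tens (s (bd x)) y + smul ?e (tens (s x) (bd y)) + tens (P x) (s' (bd y))"
    by (simp add: tbd_tens_csub[OF x(1)] lin_add[OF linD] lin_scale[OF linD]
        fv.scale_right_distrib sq_sign add.assoc)
  have 3: "tens (bd (s x)) y + tens (s (bd x)) y = tens (x - P x) y"
    by (simp add: sx(1)[symmetric] tens_add_left)
  have 4: "tens (P x) (bd (s' y)) + tens (P x) (s' (bd y)) = tens (P x) (y - P' y)"
    by (simp add: sy[symmetric] tens_add_right)
  have "tbd (D (tens x y)) + D (tbd (tens x y)) =
      (tens (bd (s x)) y + tens (s (bd x)) y) + (tens (P x) (bd (s' y)) + tens (P x) (s' (bd y)))"
    unfolding 1 2 by simp
  also have "\<dots> = tens x y - tens (P x) (P' y)"
    unfolding 3 4 by (simp add: tens_diff_left tens_diff_right)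
  finally show ?thesis by (simp only: D_def)
qed

text \<open>The product of the two augmentations, read off at the pair of empty simplices.\<close>

definition taug :: "('a set \<times> 'b set \<Rightarrow>\<^sub>0 'f::field) \<Rightarrow> (unit \<Rightarrow>\<^sub>0 'f)" where
  "taug z = smul (lookup (tmap abd abd z) ({}, {})) (delta ())"

lemma lin_taug: "lin taug"
  unfolding taug_def[abs_def] by (rule lin_comp[OF lin_coeff lin_tmap])

lemma taug_tens: "taug (tens x y) = smul (lookup (abd x) {} * lookup (abd y) {}) (delta ())"
  by (simp add: taug_def tmap_tens lin_abd lookup_tens)

lemma taug_eq_0_iff: "taug z = 0 \<longleftrightarrow> lookup (tmap abd abd z) ({}, {}) = 0"
  by (simp add: taug_def delta_nonzero)

lemma taug_tbd: "taug (tbd (z :: 'a set \<times> 'b set \<Rightarrow>\<^sub>0 'f::field)) = 0"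
proof -
  have "taug (tbd z) = (\<lambda>_. 0) z"
  proof (rule lin_eq[OF lin_comp[OF lin_taug lin_tbd] lin_zero])
    fix b :: "'a set \<times> 'b set"
    obtain \<sigma> \<tau> where b: "b = (\<sigma>, \<tau>)" by (cases b)
    show "taug (tbd (delta b)) = 0"
      unfolding b tens_delta[symmetric] tbd_tens lin_add[OF lin_taug] taug_tens
      by (simp add: abd_bd)
  qed
  then show ?thesis .
qed

text \<open>With total cardinality at least 3, one factor has at least two vertices, and there the
  augmentation vanishes.\<close>

lemma taug_tsub:
  fixes z :: "'a set \<times> 'b set \<Rightarrow>\<^sub>0 'f::field"
  assumes z: "z \<in> tsub K L (Suc (Suc (Suc n)))"
  shows "taug z = 0"
proof (rule lin_tsub_eq[OF lin_taug lin_zero z])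
  fix \<sigma> \<tau> assume "\<sigma> \<in> K" "\<tau> \<in> L" "card \<sigma> + card \<tau> = Suc (Suc (Suc n))"
  then have "aug (delta \<sigma> :: _ \<Rightarrow>\<^sub>0 'f) = 0 \<or> aug (delta \<tau> :: _ \<Rightarrow>\<^sub>0 'f) = 0"
    using aug_csub[of "delta \<sigma> :: _ \<Rightarrow>\<^sub>0 'f" K "card \<sigma> - 2"] aug_csub[of "delta \<tau> :: _ \<Rightarrow>\<^sub>0 'f" L "card \<tau> - 2"]
    unfolding delta_csub by (cases "2 \<le> card \<sigma>") auto
  then show "taug (tens (delta \<sigma>) (delta \<tau>)) = (0 :: _ \<Rightarrow>\<^sub>0 'f)"
    unfolding taug_tens aug_eq_0_iff by auto
qed

text \<open>\<open>tensor_homotopy\<close> is applied to cones in both factors, with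
  \<open>P\<close> and \<open>P'\<close> the projections onto the two apices. What is left is a
  multiple of the pair of apices, with the augmentation as coefficient.\<close>

lemma tensor_acyclic:
  fixes z :: "'a set \<times> 'b set \<Rightarrow>\<^sub>0 'f::field"
  assumes A: "finite A" "A \<noteq> {}" and B: "finite B" "B \<noteq> {}"
    and z: "z \<in> tsub (full_simplex A) (full_simplex B) (Suc (Suc n))" and bz: "tbd z = 0"
    and az: "n = 0 \<Longrightarrow> taug z = 0"
  shows "\<exists>y\<in>tsub (full_simplex A) (full_simplex B) (Suc (Suc (Suc n))). tbd y = z"
proof -
  obtain v w where vw: "v \<in> A" "w \<in> B" using A B by blast
  let ?P = "\<lambda>p. smul (lookup (abd p) {}) (point v) :: 'a set \<Rightarrow>\<^sub>0 'f"
  let ?P' = "\<lambda>p. smul (lookup (abd p) {}) (point w) :: 'b set \<Rightarrow>\<^sub>0 'f"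
  let ?D = "\<lambda>z. tmap (scone v) (\<lambda>y. y) z + tmap (\<lambda>x. sgno (?P x)) (scone w) z"
  note cA = complex_simplex[OF A(1)] and cB = complex_simplex[OF B(1)]
  have linP: "lin ?P" by (rule lin_comp[OF lin_coeff lin_abd])
  have linD: "lin ?D" by (intro lin_plus lin_tmap)
  \<comment> \<open>The vertex lives in cardinality 1 only. In every other cardinality
    \<open>?P\<close> respects the grading because the augmentation is zero there.\<close>
  have P: "?P p \<in> csub (full_simplex A) k" if "p \<in> csub (full_simplex A) k" for p k
  proof (cases "k = 1")
    case True
    have "point v \<in> csub (full_simplex A) 1"
      unfolding csub_def using point_fsub by (rule fsub_mono) (use vw in \<open>auto simp: full_simplex_def\<close>)
    then show ?thesis unfolding True by (rule fv.subspace_scale[OF subspace_csub])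
  next
    case False
    then have "aug p = 0"
      using that csub_0[OF cA, of p] aug_csub[of p _ "k - 2"]
      by (cases k; cases "k - 1") (auto simp: lin_0[OF lin_aug])
    then show ?thesis by (simp add: aug_eq_0_iff fv.subspace_0[OF subspace_csub])
  qed
  have "tbd (?D z) + ?D (tbd z) = z - smul (lookup (tmap abd abd z) ({}, {})) (tens (point v) (point w))"
  proof (rule lin_tsub_eq[OF _ _ z])
    show "lin (\<lambda>z. tbd (?D z) + ?D (tbd z))"
      by (intro lin_plus lin_comp[OF lin_tbd linD] lin_comp[OF lin_tmap lin_tbd])
    show "lin (\<lambda>z. z - smul (lookup (tmap abd abd z) ({}, {})) (tens (point v) (point w)))"
      by (intro lin_minus lin_ident lin_comp[OF lin_coeff lin_tmap])
    fix \<sigma> \<tau> assume s: "\<sigma> \<in> full_simplex A" "\<tau> \<in> full_simplex B"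
    then have \<sigma>: "delta \<sigma> \<in> csub (full_simplex A) (card \<sigma>)" and \<tau>: "delta \<tau> \<in> csub (full_simplex B) (card \<tau>)"
      by (simp_all add: delta_csub)
    have "tbd (?D (tens (delta \<sigma>) (delta \<tau>))) + ?D (tbd (tens (delta \<sigma>) (delta \<tau>))) =
        tens (delta \<sigma>) (delta \<tau>) - tens (?P (delta \<sigma>)) (?P' (delta \<tau>))"
    proof (rule tensor_homotopy[OF lin_scone linP lin_scone cA \<sigma> scone_csub[OF vw(1) \<sigma>] P[OF \<sigma>]])
      show "bd (scone v (delta \<sigma>)) + scone v (bd (delta \<sigma>)) = delta \<sigma> - ?P (delta \<sigma>)"
        by (rule scone_contraction[OF csub_nes[OF cA \<sigma>]])
      show "bd (scone w (delta \<tau>)) + scone w (bd (delta \<tau>)) = delta \<tau> - ?P' (delta \<tau>)"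
        by (rule scone_contraction[OF csub_nes[OF cB \<tau>]])
    qed (simp_all add: lin_scale[OF lin_bd] bd_point abd_bd)
    then show "tbd (?D (tens (delta \<sigma>) (delta \<tau>))) + ?D (tbd (tens (delta \<sigma>) (delta \<tau>))) =
        tens (delta \<sigma>) (delta \<tau>) - smul (lookup (tmap abd abd (tens (delta \<sigma>) (delta \<tau>))) ({}, {})) (tens (point v) (point w))"
      by (simp only: tmap_tens[OF lin_abd lin_abd] lookup_tens tens_smul_left tens_smul_right fv.scale_scale mult.commute)
  qed
  moreover have "taug z = 0"
    using az taug_tsub[of z _ _ "n - 1"] z by (cases n) auto
  ultimately have "tbd (?D z) = z"
    by (simp add: bz lin_0[OF linD] taug_eq_0_iff lin_0[OF lin_tmap])
  moreover have "?D z \<in> tsub (full_simplex A) (full_simplex B) (Suc (Suc (Suc n)))"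
  proof (rule lin_tsub_mem[OF linD subspace_tsub z])
    fix \<sigma> \<tau> assume s: "\<sigma> \<in> full_simplex A" "\<tau> \<in> full_simplex B" and c: "card \<sigma> + card \<tau> = Suc (Suc n)"
    then have \<sigma>: "delta \<sigma> \<in> csub (full_simplex A) (card \<sigma>)" and \<tau>: "delta \<tau> \<in> csub (full_simplex B) (card \<tau>)"
      by (simp_all add: delta_csub)
    have "tens (scone v (delta \<sigma>)) (delta \<tau>) \<in> tsub (full_simplex A) (full_simplex B) (Suc (card \<sigma>) + card \<tau>)"
      by (rule tens_tsub[OF scone_csub[OF vw(1) \<sigma>] \<tau>])
    moreover have "tens (sgno (?P (delta \<sigma>))) (scone w (delta \<tau>)) \<in> tsub (full_simplex A) (full_simplex B) (card \<sigma> + Suc (card \<tau>))"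
      unfolding sgno_csub[OF P[OF \<sigma>]]
      by (rule tens_tsub[OF fv.subspace_scale[OF subspace_csub P[OF \<sigma>]] scone_csub[OF vw(2) \<tau>]])
    ultimately show "?D (tens (delta \<sigma>) (delta \<tau>)) \<in> tsub (full_simplex A) (full_simplex B) (Suc (Suc (Suc n)))"
      unfolding tmap_tens[OF lin_scone lin_ident] tmap_tens[OF lin_comp[OF lin_sgno linP] lin_scone]
      using c by (intro fv.subspace_add[OF subspace_tsub]) simp_all
  qed
  ultimately show ?thesis by blast
qed


section \<open>The Eilenberg--Zilber maps\<close>

text \<open>The categorical product of simplicial complexes. It contains the full simplex on
  \<open>\<sigma> \<times> \<tau>\<close> for simplices of the factors, and this provides acyclic
  carriers.\<close>

definition prodc :: "'a set set \<Rightarrow> 'b set set \<Rightarrow> ('a \<times> 'b) set set" where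
  "prodc K L = {\<rho>. finite \<rho> \<and> \<rho> \<noteq> {} \<and> fst ` \<rho> \<in> K \<and> snd ` \<rho> \<in> L}"

lemma complex_prodc:
  assumes "sc_complex K" "sc_complex L"
  shows "sc_complex (prodc K L)"
  unfolding sc_complex_def
proof (intro conjI ballI allI impI)
  show "prodc K L \<subseteq> nes" by (auto simp: prodc_def nes_def)
  fix \<rho> \<rho>' assume "\<rho> \<in> prodc K L" "\<rho>' \<subseteq> \<rho>" "\<rho>' \<noteq> {}"
  then show "\<rho>' \<in> prodc K L"
    using complexD[OF assms(1), of "fst ` \<rho>" "fst ` \<rho>'"] complexD[OF assms(2), of "snd ` \<rho>" "snd ` \<rho>'"]
    by (auto simp: prodc_def finite_subset image_mono)
qed

lemma full_simplex_Times_prodc: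
  assumes "sc_complex K" "sc_complex L" "\<sigma> \<in> K" "\<tau> \<in> L"
  shows "full_simplex (\<sigma> \<times> \<tau>) \<subseteq> prodc K L"
proof
  fix \<rho> assume "\<rho> \<in> full_simplex (\<sigma> \<times> \<tau>)"
  then have \<rho>: "\<rho> \<subseteq> \<sigma> \<times> \<tau>" "\<rho> \<noteq> {}" by (auto simp: full_simplex_def)
  then have "fst ` \<rho> \<subseteq> \<sigma>" "snd ` \<rho> \<subseteq> \<tau>" "finite \<rho>"
    using complex_finite[OF assms(1,3)] complex_finite[OF assms(2,4)] by (auto intro: finite_subset)
  then show "\<rho> \<in> prodc K L"
    using \<rho> assms(3,4) complexD[OF assms(1,3)] complexD[OF assms(2,4)] by (simp add: prodc_def)
qed

lemma tsub_le_1: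
  assumes "sc_complex K" "sc_complex L" "z \<in> tsub K L n" "n \<le> 1"
  shows "z = 0"
proof -
  have "{(\<sigma>, \<tau>). \<sigma> \<in> K \<and> \<tau> \<in> L \<and> card \<sigma> + card \<tau> = n} = {}"
    using complex_finite[OF assms(1)] complex_finite[OF assms(2)] assms(4) by fastforce
  with assms(3) show ?thesis by (simp only: tsub_def fsub_empty_iff)
qed

lemma nes_full_simplex:
  assumes "\<sigma> \<in> nes"
  shows "\<sigma> \<in> full_simplex \<sigma>" "sc_complex (full_simplex \<sigma>)"
  using assms complex_simplex[of \<sigma>] by (simp_all add: nes_def full_simplex_def)

lemma nes_card: "\<sigma> \<in> nes \<Longrightarrow> 0 < card \<sigma>"
  by (auto simp: nes_def card_gt_0_iff)

lemma full_simplex_nes: "\<sigma> \<in> nes \<Longrightarrow> \<sigma>' \<in> full_simplex \<sigma> \<Longrightarrow> \<sigma>' \<in> nes \<and> \<sigma>' \<subseteq> \<sigma>"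
  by (auto simp: nes_def full_simplex_def intro: finite_subset)

text \<open>The degree \<open>card \<rho> - 1\<close> is a truncated difference; nonempty faces keep
  it exact.\<close>

lemma bd_delta_faces:
  assumes "\<rho> \<in> nes"
  shows "bd (delta \<rho>) \<in> fsub {\<rho>' \<in> nes. Suc (card \<rho>' - 1) = card \<rho> - 1 \<and> \<rho>' \<subseteq> \<rho>}"
proof -
  have "delta \<rho> \<in> csub (full_simplex \<rho>) (Suc (card \<rho> - 1))"
    using nes_full_simplex(1)[OF assms] nes_card[OF assms] by (simp add: delta_csub)
  then have "bd (delta \<rho>) \<in> csub (full_simplex \<rho>) (card \<rho> - 1)"
    by (rule bd_csub[OF nes_full_simplex(2)[OF assms]])
  then show ?thesis
    unfolding csub_def
  proof (rule fsub_mono, intro subsetI)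
    fix x assume "x \<in> {\<sigma> \<in> full_simplex \<rho>. card \<sigma> = card \<rho> - 1}"
    then have "x \<in> nes" "x \<subseteq> \<rho>" "card x = card \<rho> - 1"
      using full_simplex_nes[OF assms] by auto
    then show "x \<in> {\<rho>' \<in> nes. Suc (card \<rho>' - 1) = card \<rho> - 1 \<and> \<rho>' \<subseteq> \<rho>}"
      using nes_card[of x] by simp
  qed
qed

lemma tbd_delta_faces:
  assumes "\<sigma> \<in> nes" "\<tau> \<in> nes"
  shows "tbd (delta (\<sigma>, \<tau>)) \<in> fsub {(\<sigma>', \<tau>'). \<sigma>' \<in> nes \<and> \<tau>' \<in> nes \<and>
    Suc (card \<sigma>' + card \<tau>' - 2) = card \<sigma> + card \<tau> - 2 \<and> \<sigma>' \<subseteq> \<sigma> \<and> \<tau>' \<subseteq> \<tau>}"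
proof -
  have "delta (\<sigma>, \<tau>) \<in> tsub (full_simplex \<sigma>) (full_simplex \<tau>) (Suc (card \<sigma> + card \<tau> - 1))"
    using nes_full_simplex(1)[OF assms(1)] nes_full_simplex(1)[OF assms(2)] nes_card[OF assms(1)]
    by (simp add: delta_tsub)
  then have "tbd (delta (\<sigma>, \<tau>)) \<in> tsub (full_simplex \<sigma>) (full_simplex \<tau>) (card \<sigma> + card \<tau> - 1)"
    by (rule tbd_tsub[OF nes_full_simplex(2)[OF assms(1)] nes_full_simplex(2)[OF assms(2)]])
  then show ?thesis
    unfolding tsub_def
  proof (rule fsub_mono, clarify)
    fix \<sigma>' \<tau>' assume *: "\<sigma>' \<in> full_simplex \<sigma>" "\<tau>' \<in> full_simplex \<tau>" "card \<sigma>' + card \<tau>' = card \<sigma> + card \<tau> - 1"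
    then have "\<sigma>' \<in> nes" "\<tau>' \<in> nes" "\<sigma>' \<subseteq> \<sigma>" "\<tau>' \<subseteq> \<tau>"
      using full_simplex_nes[OF assms(1)] full_simplex_nes[OF assms(2)] by auto
    moreover from this have "Suc (card \<sigma>' + card \<tau>' - 2) = card \<sigma> + card \<tau> - 2"
      using *(3) nes_card[of \<sigma>'] nes_card[of \<tau>'] by simp
    ultimately show "\<sigma>' \<in> nes \<and> \<tau>' \<in> nes \<and>
        Suc (card \<sigma>' + card \<tau>' - 2) = card \<sigma> + card \<tau> - 2 \<and> \<sigma>' \<subseteq> \<sigma> \<and> \<tau>' \<subseteq> \<tau>"
      by simp
  qed
qed

lemma full_simplex_mono: "A \<subseteq> B \<Longrightarrow> full_simplex A \<subseteq> full_simplex B"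
  by (auto simp: full_simplex_def)

text \<open>The defining properties are stated on basis elements only; the maps preserve all the carriers
  at once, and therefore restrict to all pairs of simplicial complexes.\<close>

locale eilenberg_zilber =
  fixes EZ :: "('a set \<times> 'b set \<Rightarrow>\<^sub>0 'f::field) \<Rightarrow> (('a \<times> 'b) set \<Rightarrow>\<^sub>0 'f)"
    and AW :: "(('a \<times> 'b) set \<Rightarrow>\<^sub>0 'f) \<Rightarrow> ('a set \<times> 'b set \<Rightarrow>\<^sub>0 'f)"
  assumes lin_EZ: "lin EZ" and lin_AW: "lin AW"
    and EZ_delta: "\<sigma> \<in> nes \<Longrightarrow> \<tau> \<in> nes \<Longrightarrow>
      EZ (delta (\<sigma>, \<tau>)) \<in> csub (full_simplex (\<sigma> \<times> \<tau>)) (card \<sigma> + card \<tau> - 1)"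
    and bd_EZ_delta: "\<sigma> \<in> nes \<Longrightarrow> \<tau> \<in> nes \<Longrightarrow> bd (EZ (delta (\<sigma>, \<tau>))) = EZ (tbd (delta (\<sigma>, \<tau>)))"
    and aug_EZ_delta: "\<sigma> \<in> nes \<Longrightarrow> \<tau> \<in> nes \<Longrightarrow> card \<sigma> + card \<tau> = 2 \<Longrightarrow>
      aug (EZ (delta (\<sigma>, \<tau>))) = taug (delta (\<sigma>, \<tau>))"
    and AW_delta: "\<rho> \<in> nes \<Longrightarrow>
      AW (delta \<rho>) \<in> tsub (full_simplex (fst ` \<rho>)) (full_simplex (snd ` \<rho>)) (Suc (card \<rho>))"
    and tbd_AW_delta: "\<rho> \<in> nes \<Longrightarrow> tbd (AW (delta \<rho>)) = AW (bd (delta \<rho>))"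
    and taug_AW_delta: "\<rho> \<in> nes \<Longrightarrow> card \<rho> = 1 \<Longrightarrow> taug (AW (delta \<rho>)) = aug (delta \<rho>)"
begin

context
  fixes K :: "'a set set" and L :: "'b set set"
  assumes K: "sc_complex K" and L: "sc_complex L"
begin

lemma EZ_tsub: "z \<in> tsub K L (Suc n) \<Longrightarrow> EZ z \<in> csub (prodc K L) n"
proof (rule lin_tsub_mem[OF lin_EZ subspace_csub])
  fix \<sigma> \<tau> assume *: "\<sigma> \<in> K" "\<tau> \<in> L" "card \<sigma> + card \<tau> = Suc n"
  then show "EZ (tens (delta \<sigma>) (delta \<tau>)) \<in> csub (prodc K L) n"
    using EZ_delta[OF complex_nes[OF K *(1)] complex_nes[OF L *(2)]]
      full_simplex_Times_prodc[OF K L *(1,2)] by (auto intro: csub_mono)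
qed

lemma bd_EZ: "z \<in> tsub K L n \<Longrightarrow> bd (EZ z) = EZ (tbd z)"
  by (rule lin_tsub_eq[OF lin_comp[OF lin_bd lin_EZ] lin_comp[OF lin_EZ lin_tbd]])
    (use bd_EZ_delta complex_nes[OF K] complex_nes[OF L] in auto)

lemma aug_EZ: "z \<in> tsub K L 2 \<Longrightarrow> aug (EZ z) = taug z"
  by (rule lin_tsub_eq[OF lin_comp[OF lin_aug lin_EZ] lin_taug])
    (use aug_EZ_delta complex_nes[OF K] complex_nes[OF L] in auto)

lemma AW_csub: "z \<in> csub (prodc K L) n \<Longrightarrow> AW z \<in> tsub K L (Suc n)"
proof (rule lin_csub_mem[OF lin_AW subspace_tsub])
  fix \<rho> assume *: "\<rho> \<in> prodc K L" "card \<rho> = n"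
  have "\<rho> \<in> nes" "fst ` \<rho> \<in> K" "snd ` \<rho> \<in> L"
    using *(1) by (auto simp: prodc_def nes_def)
  then show "AW (delta \<rho>) \<in> tsub K L (Suc n)"
    using AW_delta[of \<rho>] *(2) complex_simplex_le[OF K, of "fst ` \<rho>"] complex_simplex_le[OF L, of "snd ` \<rho>"]
    by (auto intro: tsub_mono)
qed

lemma tbd_AW: "z \<in> csub (prodc K L) n \<Longrightarrow> tbd (AW z) = AW (bd z)"
  by (rule lin_csub_eq[OF lin_comp[OF lin_tbd lin_AW] lin_comp[OF lin_AW lin_bd]])
    (use tbd_AW_delta complex_nes[OF complex_prodc[OF K L]] in auto)

lemma taug_AW: "z \<in> csub (prodc K L) 1 \<Longrightarrow> taug (AW z) = aug z"
  by (rule lin_csub_eq[OF lin_comp[OF lin_taug lin_AW] lin_aug])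
    (use taug_AW_delta complex_nes[OF complex_prodc[OF K L]] in auto)

end

text \<open>The composite may leave the simplex \<rho>, but it stays in the full simplex on the
  product of the two projections of \<rho>. That larger simplex is therefore the carrier.\<close>

lemma EZ_AW_homotopy:
  obtains D where "lin D"
    "\<And>\<rho>. \<rho> \<in> nes \<Longrightarrow> D (delta \<rho>) \<in> csub (full_simplex (fst ` \<rho> \<times> snd ` \<rho>)) (Suc (card \<rho>))"
    "\<And>\<rho>. \<rho> \<in> nes \<Longrightarrow> bd (D (delta \<rho>)) + D (bd (delta \<rho>)) = delta \<rho> - EZ (AW (delta \<rho>))"
proof -
  let ?S = "\<lambda>\<rho> n. {\<rho>' \<in> full_simplex (fst ` \<rho> \<times> snd ` \<rho>) :: ('a \<times> 'b) set set. card \<rho>' = Suc n}"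
  let ?f = "\<lambda>p. p - EZ (AW p)"
  have fin: "finite (fst ` \<rho> \<times> snd ` \<rho>)" "fst ` \<rho> \<times> snd ` \<rho> \<noteq> {}"
    "sc_complex (full_simplex (fst ` \<rho>))" "sc_complex (full_simplex (snd ` \<rho>))"
    if "\<rho> \<in> nes" for \<rho> :: "('a \<times> 'b) set"
    using that by (auto simp: nes_def complex_simplex)
  have AWp: "AW (delta \<rho>) \<in> tsub (full_simplex (fst ` \<rho>)) (full_simplex (snd ` \<rho>)) (Suc (card \<rho>))"
    if "\<rho> \<in> nes" for \<rho> using AW_delta[OF that] .
  have sub: "prodc (full_simplex (fst ` \<rho>)) (full_simplex (snd ` \<rho>)) \<subseteq> full_simplex (fst ` \<rho> \<times> snd ` \<rho>)"
    for \<rho> :: "('a \<times> 'b) set"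
    by (auto simp: prodc_def full_simplex_def) (metis fst_conv snd_conv image_eqI subset_iff)+
  show thesis
  proof (rule carried_homotopy_exists[of bd bd aug nes "\<lambda>\<rho>. card \<rho> - 1" ?S ?f])
    show "lin bd" "lin bd" "lin aug" by (rule lin_bd lin_aug)+
    show "lin ?f" by (intro lin_minus lin_ident lin_comp[OF lin_EZ lin_AW])
    fix \<rho> :: "('a \<times> 'b) set" assume \<rho>: "\<rho> \<in> nes"
    show "bd (delta \<rho>) \<in> fsub {c \<in> nes. Suc (card c - 1) = card \<rho> - 1 \<and> (\<forall>n. ?S c n \<subseteq> ?S \<rho> n)}"
    proof (rule fsub_mono[OF bd_delta_faces[OF \<rho>]], safe)
      fix c n x assume c: "c \<subseteq> \<rho>" and "x \<in> full_simplex (fst ` c \<times> snd ` c)"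
      then show "x \<in> full_simplex (fst ` \<rho> \<times> snd ` \<rho>)"
        using full_simplex_mono[of "fst ` c \<times> snd ` c" "fst ` \<rho> \<times> snd ` \<rho>"] by blast
    qed
    show "bd (bd (delta \<rho>)) = 0" by (rule bd_bd)
    show "bd z = 0" if "z \<in> fsub (?S \<rho> 0)" for z
      using that csub_0[OF complex_simplex[OF fin(1)[OF \<rho>]] bd_csub[OF complex_simplex[OF fin(1)[OF \<rho>]], of z 0]]
      by (simp add: csub_def)
    show "\<exists>y\<in>fsub (?S \<rho> (Suc n)). bd y = z"
      if "z \<in> fsub (?S \<rho> n)" "bd z = 0" "n = 0 \<Longrightarrow> aug z = 0" for z n
      using simplex_acyclic[OF fin(1,2)[OF \<rho>], of z n] that by (simp add: csub_def)
    have d\<rho>: "delta \<rho> \<in> csub (full_simplex (fst ` \<rho> \<times> snd ` \<rho>)) (card \<rho>)"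
      using \<rho> by (auto simp: delta_csub full_simplex_def nes_def image_iff) force+
    have EA: "EZ (AW (delta \<rho>)) \<in> csub (full_simplex (fst ` \<rho> \<times> snd ` \<rho>)) (card \<rho>)"
      by (rule csub_mono[OF EZ_tsub[OF fin(3)[OF \<rho>] fin(4)[OF \<rho>] AWp[OF \<rho>]] sub])
    have "card \<rho> = Suc (card \<rho> - 1)" using nes_card[OF \<rho>] by simp
    then show "?f (delta \<rho>) \<in> fsub (?S \<rho> (card \<rho> - 1))"
      using fv.subspace_diff[OF subspace_csub d\<rho> EA] by (simp add: csub_def)
    show "bd (?f (delta \<rho>)) = ?f (bd (delta \<rho>))"
      by (simp add: lin_diff[OF lin_bd] bd_EZ[OF fin(3)[OF \<rho>] fin(4)[OF \<rho>] AWp[OF \<rho>]] tbd_AW_delta[OF \<rho>])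
    show "aug (?f (delta \<rho>)) = 0" if "card \<rho> - 1 = 0"
    proof -
      have c: "card \<rho> = 1" using that nes_card[OF \<rho>] by simp
      show ?thesis
        using aug_EZ[OF fin(3)[OF \<rho>] fin(4)[OF \<rho>], of "AW (delta \<rho>)"] AWp[OF \<rho>] taug_AW_delta[OF \<rho> c] c
        by (simp add: lin_diff[OF lin_aug] numeral_2_eq_2)
    qed
  next
    fix D :: "(('a \<times> 'b) set \<Rightarrow>\<^sub>0 'f) \<Rightarrow> (('a \<times> 'b) set \<Rightarrow>\<^sub>0 'f)"
    assume D: "lin D" "\<And>b. b \<in> nes \<Longrightarrow> D (delta b) \<in> fsub (?S b (Suc (card b - 1)))"
      "\<And>b. b \<in> nes \<Longrightarrow> bd (D (delta b)) + D (bd (delta b)) = ?f (delta b)"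
    show thesis
    proof (rule that[OF D(1) _ D(3)])
      show "D (delta \<rho>) \<in> csub (full_simplex (fst ` \<rho> \<times> snd ` \<rho>)) (Suc (card \<rho>))" if "\<rho> \<in> nes" for \<rho>
        using D(2)[OF that] nes_card[OF that] by (simp add: csub_def)
    qed
  qed
qed

text \<open>The carrier of a pair is the tensor product of the chains of its two full simplices,
  acyclic by \<open>tensor_acyclic\<close>.\<close>

lemma AW_EZ_homotopy:
  obtains D where "lin D"
    "\<And>\<sigma> \<tau>. \<sigma> \<in> nes \<Longrightarrow> \<tau> \<in> nes \<Longrightarrow>
      D (delta (\<sigma>, \<tau>)) \<in> tsub (full_simplex \<sigma>) (full_simplex \<tau>) (Suc (card \<sigma> + card \<tau>))"
    "\<And>\<sigma> \<tau>. \<sigma> \<in> nes \<Longrightarrow> \<tau> \<in> nes \<Longrightarrow>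
      tbd (D (delta (\<sigma>, \<tau>))) + D (tbd (delta (\<sigma>, \<tau>))) = delta (\<sigma>, \<tau>) - AW (EZ (delta (\<sigma>, \<tau>)))"
proof -
  let ?S = "\<lambda>b n. {(\<sigma>, \<tau>). \<sigma> \<in> full_simplex (fst b) \<and> \<tau> \<in> full_simplex (snd b) \<and> card \<sigma> + card \<tau> = Suc (Suc n)}
     :: ('a set \<times> 'b set) set"
  let ?deg = "\<lambda>b :: 'a set \<times> 'b set. card (fst b) + card (snd b) - 2"
  let ?f = "\<lambda>p. p - AW (EZ p)"
  show thesis
  proof (rule carried_homotopy_exists[of tbd tbd taug "nes \<times> nes" ?deg ?S ?f])
    show "lin tbd" "lin tbd" "lin taug" by (rule lin_tbd lin_taug)+
    show "lin ?f" by (intro lin_minus lin_ident lin_comp[OF lin_AW lin_EZ])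
    fix b :: "'a set \<times> 'b set" assume b: "b \<in> nes \<times> nes"
    obtain \<sigma> \<tau> where b': "b = (\<sigma>, \<tau>)" by (cases b)
    have \<sigma>: "\<sigma> \<in> nes" and \<tau>: "\<tau> \<in> nes" using b by (auto simp: b')
    have fin: "finite \<sigma>" "\<sigma> \<noteq> {}" "finite \<tau>" "\<tau> \<noteq> {}" using \<sigma> \<tau> by (auto simp: nes_def)
    note cc = nes_full_simplex(2)[OF \<sigma>] nes_full_simplex(2)[OF \<tau>]
    have S: "fsub (?S b n) = tsub (full_simplex \<sigma>) (full_simplex \<tau>) (Suc (Suc n))" for n
      by (simp add: tsub_def b')
    show "tbd (delta b) \<in> fsub {c \<in> nes \<times> nes. Suc (?deg c) = ?deg b \<and> (\<forall>n. ?S c n \<subseteq> ?S b n)}"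
      unfolding b'
    proof (rule fsub_mono[OF tbd_delta_faces[OF \<sigma> \<tau>]], intro subsetI)
      fix c assume "c \<in> {(\<sigma>', \<tau>'). \<sigma>' \<in> nes \<and> \<tau>' \<in> nes \<and>
        Suc (card \<sigma>' + card \<tau>' - 2) = card \<sigma> + card \<tau> - 2 \<and> \<sigma>' \<subseteq> \<sigma> \<and> \<tau>' \<subseteq> \<tau>}"
      then have "c \<in> nes \<times> nes" "Suc (?deg c) = ?deg (\<sigma>, \<tau>)" and c: "fst c \<subseteq> \<sigma>" "snd c \<subseteq> \<tau>"
        by auto
      moreover have "?S c n \<subseteq> ?S (\<sigma>, \<tau>) n" for n
        using full_simplex_mono[of "fst c" \<sigma>] full_simplex_mono[of "snd c" \<tau>] c by auto
      ultimately show "c \<in> {c \<in> nes \<times> nes. Suc (?deg c) = ?deg (\<sigma>, \<tau>) \<and> (\<forall>n. ?S c n \<subseteq> ?S (\<sigma>, \<tau>) n)}"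
        by simp
    qed
    have dt: "delta b \<in> tsub (full_simplex \<sigma>) (full_simplex \<tau>) (card \<sigma> + card \<tau>)"
      using nes_full_simplex(1)[OF \<sigma>] nes_full_simplex(1)[OF \<tau>] by (simp add: delta_tsub b')
    show "tbd (tbd (delta b)) = 0" by (rule tbd_tbd[OF cc dt])
    \<comment> \<open>Carrier degree 0 is total cardinality 2. A boundary would have total
      cardinality 1, which two nonempty simplices cannot have.\<close>
    show "tbd z = 0" if "z \<in> fsub (?S b 0)" for z
      using tsub_le_1[OF cc tbd_tsub[OF cc, of z 1]] that unfolding S by simp
    show "\<exists>y\<in>fsub (?S b (Suc n)). tbd y = z"
      if "z \<in> fsub (?S b n)" "tbd z = 0" "n = 0 \<Longrightarrow> taug z = 0" for z n
      using that unfolding S by (rule tensor_acyclic[OF fin])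
    have c: "card \<sigma> + card \<tau> = Suc (Suc (?deg b))" "card \<sigma> + card \<tau> = Suc (card \<sigma> + card \<tau> - 1)"
      using nes_card[OF \<sigma>] nes_card[OF \<tau>] by (simp_all add: b')
    have sub: "full_simplex (\<sigma> \<times> \<tau>) \<subseteq> prodc (full_simplex \<sigma>) (full_simplex \<tau>)"
      by (rule full_simplex_Times_prodc[OF cc nes_full_simplex(1)[OF \<sigma>] nes_full_simplex(1)[OF \<tau>]])
    have E: "EZ (delta b) \<in> csub (prodc (full_simplex \<sigma>) (full_simplex \<tau>)) (card \<sigma> + card \<tau> - 1)"
      using csub_mono[OF EZ_delta[OF \<sigma> \<tau>] sub] by (simp add: b')
    have AE: "AW (EZ (delta b)) \<in> tsub (full_simplex \<sigma>) (full_simplex \<tau>) (card \<sigma> + card \<tau>)"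
      using AW_csub[OF cc E] c(2) by simp
    show "?f (delta b) \<in> fsub (?S b (?deg b))"
      using fv.subspace_diff[OF subspace_tsub dt AE] unfolding S using c(1) by simp
    show "tbd (?f (delta b)) = ?f (tbd (delta b))"
      using tbd_AW[OF cc E] bd_EZ_delta[OF \<sigma> \<tau>] by (simp add: lin_diff[OF lin_tbd] b')
    show "taug (?f (delta b)) = 0" if "?deg b = 0"
    proof -
      have 2: "card \<sigma> + card \<tau> = 2" using that c by simp
      show ?thesis
        using taug_AW[OF cc, of "EZ (delta b)"] E aug_EZ_delta[OF \<sigma> \<tau> 2] 2
        by (simp add: lin_diff[OF lin_taug] b')
    qed
  next
    fix D :: "('a set \<times> 'b set \<Rightarrow>\<^sub>0 'f) \<Rightarrow> ('a set \<times> 'b set \<Rightarrow>\<^sub>0 'f)"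
    assume D: "lin D" "\<And>b. b \<in> nes \<times> nes \<Longrightarrow> D (delta b) \<in> fsub (?S b (Suc (?deg b)))"
      "\<And>b. b \<in> nes \<times> nes \<Longrightarrow> tbd (D (delta b)) + D (tbd (delta b)) = ?f (delta b)"
    show thesis
    proof (rule that[OF D(1)])
      fix \<sigma> \<tau> assume s: "(\<sigma> :: 'a set) \<in> nes" "(\<tau> :: 'b set) \<in> nes"
      have "Suc (Suc (Suc (card \<sigma> + card \<tau> - 2))) = Suc (card \<sigma> + card \<tau>)"
        using nes_card[OF s(1)] nes_card[OF s(2)] by simp
      then show "D (delta (\<sigma>, \<tau>)) \<in> tsub (full_simplex \<sigma>) (full_simplex \<tau>) (Suc (card \<sigma> + card \<tau>))"
        using D(2)[of "(\<sigma>, \<tau>)"] s by (simp add: tsub_def)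
      show "tbd (D (delta (\<sigma>, \<tau>))) + D (tbd (delta (\<sigma>, \<tau>))) = delta (\<sigma>, \<tau>) - AW (EZ (delta (\<sigma>, \<tau>)))"
        using D(3)[of "(\<sigma>, \<tau>)"] s by simp
    qed
  qed
qed

end

lemma aug_point: "aug (point v) = delta ()"
  by (simp add: aug_def abd_point)

lemma point_csub: "v \<in> A \<Longrightarrow> point v \<in> csub (full_simplex A) (Suc 0)"
  unfolding csub_def by (rule fsub_mono[OF point_fsub]) (auto simp: full_simplex_def)

text \<open>The shuffle and front-face/back-face formulas depend on vertex orders. Acyclic carriers
  avoid them: the full simplex on \<open>\<sigma> \<times> \<tau>\<close> carries \<open>EZ\<close>,
  and the tensor product of the simplices on the two projections carries \<open>AW\<close>. The
  recursion starts with single vertices, scaled by the augmentation.\<close>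

lemma eilenberg_zilber_exists:
  obtains EZ :: "('a set \<times> 'b set \<Rightarrow>\<^sub>0 'f::field) \<Rightarrow> (('a \<times> 'b) set \<Rightarrow>\<^sub>0 'f)" and AW
  where "eilenberg_zilber EZ AW"
proof -
  let ?S = "\<lambda>b n. {\<rho> \<in> full_simplex (fst b \<times> snd b) :: ('a \<times> 'b) set set. card \<rho> = Suc n}"
  let ?deg = "\<lambda>b :: 'a set \<times> 'b set. card (fst b) + card (snd b) - 2"
  have "\<exists>EZ :: ('a set \<times> 'b set \<Rightarrow>\<^sub>0 'f) \<Rightarrow> (('a \<times> 'b) set \<Rightarrow>\<^sub>0 'f). lin EZ \<and>
    (\<forall>b\<in>nes \<times> nes. EZ (delta b) \<in> fsub (?S b (?deg b)) \<and> bd (EZ (delta b)) = EZ (tbd (delta b)) \<and>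
      (?deg b = 0 \<longrightarrow> aug (EZ (delta b)) = taug (delta b)))"
  proof (rule carried_map_exists[of tbd bd aug "nes \<times> nes" ?deg ?S taug])
    show "lin tbd" "lin bd" "lin aug" "lin taug" by (rule lin_tbd lin_bd lin_aug lin_taug)+
    fix b :: "'a set \<times> 'b set" assume b: "b \<in> nes \<times> nes"
    obtain \<sigma> \<tau> where b': "b = (\<sigma>, \<tau>)" by (cases b)
    have \<sigma>: "\<sigma> \<in> nes" and \<tau>: "\<tau> \<in> nes" using b by (auto simp: b')
    have fin: "finite (\<sigma> \<times> \<tau>)" "\<sigma> \<times> \<tau> \<noteq> {}" using \<sigma> \<tau> by (auto simp: nes_def)
    note cc = nes_full_simplex(2)[OF \<sigma>] nes_full_simplex(2)[OF \<tau>]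
    have S: "fsub (?S b n) = csub (full_simplex (\<sigma> \<times> \<tau>)) (Suc n)" for n
      by (simp add: csub_def b')
    show "tbd (delta b) \<in> fsub {c \<in> nes \<times> nes. Suc (?deg c) = ?deg b \<and> (\<forall>n. ?S c n \<subseteq> ?S b n)}"
      unfolding b'
    proof (rule fsub_mono[OF tbd_delta_faces[OF \<sigma> \<tau>]], intro subsetI)
      fix c assume "c \<in> {(\<sigma>', \<tau>'). \<sigma>' \<in> nes \<and> \<tau>' \<in> nes \<and>
        Suc (card \<sigma>' + card \<tau>' - 2) = card \<sigma> + card \<tau> - 2 \<and> \<sigma>' \<subseteq> \<sigma> \<and> \<tau>' \<subseteq> \<tau>}"
      then have "c \<in> nes \<times> nes" "Suc (?deg c) = ?deg (\<sigma>, \<tau>)" and c: "fst c \<subseteq> \<sigma>" "snd c \<subseteq> \<tau>"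
        by auto
      moreover have "?S c n \<subseteq> ?S (\<sigma>, \<tau>) n" for n
        using full_simplex_mono[of "fst c \<times> snd c" "\<sigma> \<times> \<tau>"] Sigma_mono[OF c(1), of "\<lambda>_. snd c" "\<lambda>_. \<tau>"] c by auto
      ultimately show "c \<in> {c \<in> nes \<times> nes. Suc (?deg c) = ?deg (\<sigma>, \<tau>) \<and> (\<forall>n. ?S c n \<subseteq> ?S (\<sigma>, \<tau>) n)}"
        by simp
    qed
    have dt: "delta b \<in> tsub (full_simplex \<sigma>) (full_simplex \<tau>) (card \<sigma> + card \<tau>)"
      using nes_full_simplex(1)[OF \<sigma>] nes_full_simplex(1)[OF \<tau>] by (simp add: delta_tsub b')
    show "tbd (tbd (delta b)) = 0" by (rule tbd_tbd[OF cc dt])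
    show "bd z = 0" if "z \<in> fsub (?S b 0)" for z
      using csub_0[OF complex_simplex[OF fin(1)] bd_csub[OF complex_simplex[OF fin(1)], of z 0]] that
      unfolding S by simp
    show "\<exists>y\<in>fsub (?S b (Suc n)). bd y = z"
      if "z \<in> fsub (?S b n)" "bd z = 0" "n = 0 \<Longrightarrow> aug z = 0" for z n
      using that unfolding S by (rule simplex_acyclic[OF fin])
    show "taug (tbd (delta b)) = 0" by (rule taug_tbd)
    show "\<exists>y\<in>fsub (?S b 0). aug y = taug (delta b)"
    proof -
      obtain v where "v \<in> \<sigma> \<times> \<tau>" using fin by blast
      then have "point v \<in> csub (full_simplex (\<sigma> \<times> \<tau>)) (Suc 0)"
        by (rule point_csub)
      then have "smul a (point v) \<in> fsub (?S b 0)" for a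
        unfolding S by (rule fv.subspace_scale[OF subspace_csub])
      moreover have "aug (smul (lookup (tmap abd abd (delta b)) ({}, {})) (point v)) = taug (delta b)"
        by (simp add: lin_scale[OF lin_aug] aug_point taug_def)
      ultimately show ?thesis by blast
    qed
  qed blast
  then obtain EZ :: "('a set \<times> 'b set \<Rightarrow>\<^sub>0 'f) \<Rightarrow> (('a \<times> 'b) set \<Rightarrow>\<^sub>0 'f)" where EZ: "lin EZ"
    "\<And>b. b \<in> nes \<times> nes \<Longrightarrow> EZ (delta b) \<in> fsub (?S b (?deg b)) \<and> bd (EZ (delta b)) = EZ (tbd (delta b)) \<and>
      (?deg b = 0 \<longrightarrow> aug (EZ (delta b)) = taug (delta b))" by blast
  let ?S' = "\<lambda>\<rho> n. {(\<sigma>, \<tau>). \<sigma> \<in> full_simplex (fst ` \<rho>) \<and> \<tau> \<in> full_simplex (snd ` \<rho>) \<and> card \<sigma> + card \<tau> = Suc (Suc n)}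
     :: ('a set \<times> 'b set) set"
  have "\<exists>AW :: (('a \<times> 'b) set \<Rightarrow>\<^sub>0 'f) \<Rightarrow> ('a set \<times> 'b set \<Rightarrow>\<^sub>0 'f). lin AW \<and>
    (\<forall>\<rho>\<in>nes. AW (delta \<rho>) \<in> fsub (?S' \<rho> (card \<rho> - 1)) \<and> tbd (AW (delta \<rho>)) = AW (bd (delta \<rho>)) \<and>
      (card \<rho> - 1 = 0 \<longrightarrow> taug (AW (delta \<rho>)) = aug (delta \<rho>)))"
  proof (rule carried_map_exists[of bd tbd taug nes "\<lambda>\<rho>. card \<rho> - 1" ?S' aug])
    show "lin tbd" "lin bd" "lin aug" "lin taug" by (rule lin_tbd lin_bd lin_aug lin_taug)+
    fix \<rho> :: "('a \<times> 'b) set" assume \<rho>: "\<rho> \<in> nes"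
    have fin: "finite (fst ` \<rho>)" "fst ` \<rho> \<noteq> {}" "finite (snd ` \<rho>)" "snd ` \<rho> \<noteq> {}"
      using \<rho> by (auto simp: nes_def)
    note cc = complex_simplex[OF fin(1)] complex_simplex[OF fin(3)]
    have S: "fsub (?S' \<rho> n) = tsub (full_simplex (fst ` \<rho>)) (full_simplex (snd ` \<rho>)) (Suc (Suc n))" for n
      by (simp add: tsub_def)
    show "bd (delta \<rho>) \<in> fsub {c \<in> nes. Suc (card c - 1) = card \<rho> - 1 \<and> (\<forall>n. ?S' c n \<subseteq> ?S' \<rho> n)}"
    proof (rule fsub_mono[OF bd_delta_faces[OF \<rho>]], intro subsetI)
      fix c assume "c \<in> {\<rho>' \<in> nes. Suc (card \<rho>' - 1) = card \<rho> - 1 \<and> \<rho>' \<subseteq> \<rho>}"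
      then have c: "c \<in> nes" "Suc (card c - 1) = card \<rho> - 1" "fst ` c \<subseteq> fst ` \<rho>" "snd ` c \<subseteq> snd ` \<rho>"
        by auto
      have "?S' c n \<subseteq> ?S' \<rho> n" for n
        using full_simplex_mono[OF c(3)] full_simplex_mono[OF c(4)] by auto
      then show "c \<in> {c \<in> nes. Suc (card c - 1) = card \<rho> - 1 \<and> (\<forall>n. ?S' c n \<subseteq> ?S' \<rho> n)}"
        using c by simp
    qed
    show "bd (bd (delta \<rho>)) = 0" by (rule bd_bd)
    show "tbd z = 0" if "z \<in> fsub (?S' \<rho> 0)" for z
      using tsub_le_1[OF cc tbd_tsub[OF cc, of z 1]] that unfolding S by simp
    show "\<exists>y\<in>fsub (?S' \<rho> (Suc n)). tbd y = z"
      if "z \<in> fsub (?S' \<rho> n)" "tbd z = 0" "n = 0 \<Longrightarrow> taug z = 0" for z n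
      using that unfolding S by (rule tensor_acyclic[OF fin])
    show "aug (bd (delta \<rho>)) = 0" by (rule aug_bd)
    show "\<exists>y\<in>fsub (?S' \<rho> 0). taug y = aug (delta \<rho>)"
    proof -
      obtain v w where "v \<in> fst ` \<rho>" "w \<in> snd ` \<rho>" using fin by blast
      then have "point v \<in> csub (full_simplex (fst ` \<rho>)) (Suc 0)"
          "point w \<in> csub (full_simplex (snd ` \<rho>)) (Suc 0)"
        by (simp_all only: point_csub)
      then have "tens (point v) (point w) \<in> tsub (full_simplex (fst ` \<rho>)) (full_simplex (snd ` \<rho>)) (Suc 0 + Suc 0)"
        by (rule tens_tsub)
      then have "smul a (tens (point v) (point w)) \<in> fsub (?S' \<rho> 0)" for a
        unfolding S by (intro fv.subspace_scale[OF subspace_tsub]) simp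
      moreover have "taug (smul (lookup (abd (delta \<rho>)) {}) (tens (point v) (point w))) = aug (delta \<rho>)"
        by (simp add: lin_scale[OF lin_taug] taug_tens abd_point aug_def)
      ultimately show ?thesis by blast
    qed
  qed blast
  then obtain AW :: "(('a \<times> 'b) set \<Rightarrow>\<^sub>0 'f) \<Rightarrow> ('a set \<times> 'b set \<Rightarrow>\<^sub>0 'f)" where AW: "lin AW"
    "\<And>\<rho>. \<rho> \<in> nes \<Longrightarrow> AW (delta \<rho>) \<in> fsub (?S' \<rho> (card \<rho> - 1)) \<and> tbd (AW (delta \<rho>)) = AW (bd (delta \<rho>)) \<and>
      (card \<rho> - 1 = 0 \<longrightarrow> taug (AW (delta \<rho>)) = aug (delta \<rho>))" by blast
  show thesis
  proof (rule that[of EZ AW], rule eilenberg_zilber.intro)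
    show "lin EZ" "lin AW" by fact+
    show "EZ (delta (\<sigma>, \<tau>)) \<in> csub (full_simplex (\<sigma> \<times> \<tau>)) (card \<sigma> + card \<tau> - 1)"
      if "\<sigma> \<in> nes" "\<tau> \<in> nes" for \<sigma> \<tau>
    proof -
      have "Suc (card \<sigma> + card \<tau> - 2) = card \<sigma> + card \<tau> - 1"
        using nes_card[OF that(1)] nes_card[OF that(2)] by simp
      then show ?thesis using EZ(2)[of "(\<sigma>, \<tau>)"] that by (simp add: csub_def)
    qed
    show "bd (EZ (delta (\<sigma>, \<tau>))) = EZ (tbd (delta (\<sigma>, \<tau>)))" if "\<sigma> \<in> nes" "\<tau> \<in> nes" for \<sigma> \<tau>
      using EZ(2)[of "(\<sigma>, \<tau>)"] that by simp
    show "aug (EZ (delta (\<sigma>, \<tau>))) = taug (delta (\<sigma>, \<tau>))"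
      if "\<sigma> \<in> nes" "\<tau> \<in> nes" "card \<sigma> + card \<tau> = 2" for \<sigma> \<tau>
      using EZ(2)[of "(\<sigma>, \<tau>)"] that by simp
    show "AW (delta \<rho>) \<in> tsub (full_simplex (fst ` \<rho>)) (full_simplex (snd ` \<rho>)) (Suc (card \<rho>))"
      if "\<rho> \<in> nes" for \<rho>
      using AW(2)[OF that] nes_card[OF that] by (simp add: tsub_def)
    show "tbd (AW (delta \<rho>)) = AW (bd (delta \<rho>))" if "\<rho> \<in> nes" for \<rho>
      using AW(2)[OF that] by simp
    show "taug (AW (delta \<rho>)) = aug (delta \<rho>)" if "\<rho> \<in> nes" "card \<rho> = 1" for \<rho>
      using AW(2)[OF that(1)] that(2) by simp
  qed
qed


section \<open>The Kuenneth theorem\<close>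

text \<open>For the unaugmented boundary and indexed by cardinality: \<open>cyc K (Suc k)\<close>
  consists of the cycles of dimension \<open>k\<close>.\<close>

definition cyc :: "'a set set \<Rightarrow> nat \<Rightarrow> ('a set \<Rightarrow>\<^sub>0 'f::field) set" where
  "cyc K n = {p \<in> csub K n. bd p = 0}"

definition bnd :: "'a set set \<Rightarrow> nat \<Rightarrow> ('a set \<Rightarrow>\<^sub>0 'f::field) set" where
  "bnd K n = bd ` csub K (Suc n)"

lemma subspace_cyc: "fv.subspace (cyc K n)"
  using subspace_csub[of K n]
  by (auto simp: fv.subspace_def cyc_def lin_add[OF lin_bd] lin_scale[OF lin_bd] lin_0[OF lin_bd])

lemma subspace_bnd: "fv.subspace (bnd K n)"
  unfolding bnd_def using fvp.linear_subspace_image[OF lin_bd subspace_csub] .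

lemma bnd_cyc: "sc_complex K \<Longrightarrow> bnd K n \<subseteq> cyc K n"
  by (auto simp: bnd_def cyc_def bd_csub bd_bd)

lemma bndI: "p \<in> csub K (Suc n) \<Longrightarrow> bd p \<in> bnd K n"
  by (auto simp: bnd_def)

text \<open>Over a field the boundary operator has a generalised inverse, which deforms the chain complex
  to a complement of the boundaries in the cycles.\<close>

lemma generalised_inverse:
  fixes K :: "'a set set"
  assumes K: "sc_complex K"
  obtains s :: "('a set \<Rightarrow>\<^sub>0 'f::field) \<Rightarrow> ('a set \<Rightarrow>\<^sub>0 'f)" where "lin s"
    "\<And>n x. x \<in> csub K n \<Longrightarrow> s x \<in> csub K (Suc n)"
    "\<And>n x. x \<in> csub K n \<Longrightarrow> bd (s (bd x)) = bd x"
proof -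
  have "\<forall>n. \<exists>g :: ('a set \<Rightarrow>\<^sub>0 'f) \<Rightarrow> ('a set \<Rightarrow>\<^sub>0 'f). range g \<subseteq> csub K (Suc n) \<and> lin g \<and> (\<forall>v\<in>bd ` csub K (Suc n). bd (g v) = v)"
    using fvp.linear_exists_right_inverse_on[OF lin_bd subspace_csub] by blast
  then obtain g :: "nat \<Rightarrow> ('a set \<Rightarrow>\<^sub>0 'f) \<Rightarrow> ('a set \<Rightarrow>\<^sub>0 'f)" where g:
    "\<And>n. range (g n) \<subseteq> csub K (Suc n)" "\<And>n. lin (g n)"
    "\<And>n v. v \<in> bd ` csub K (Suc n) \<Longrightarrow> bd (g n v) = v" by metis
  \<comment> \<open>The right inverses are chosen separately in each degree; the cardinality of a
    simplex selects the one that acts on it.\<close>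
  define s where "s = lext (\<lambda>\<sigma>. g (card \<sigma>) (delta \<sigma>))"
  have s: "s x = g n x" if "x \<in> csub K n" for x n
    by (rule lin_csub_eq[OF _ g(2) _ that]) (simp_all add: s_def lin_lext)
  show thesis
  proof
    show "lin s" unfolding s_def by (rule lin_lext)
    show "s x \<in> csub K (Suc n)" if "x \<in> csub K n" for x n
      using s[OF that] g(1)[of n] by auto
    show "bd (s (bd x)) = bd x" if "x \<in> csub K n" for x n
    proof (cases n)
      case 0
      then show ?thesis using csub_0[OF K, of x] that by (simp add: lin_0[OF lin_bd] s_def lin_0[OF lin_lext])
    next
      case (Suc m)
      then show ?thesis
        using s[OF bd_csub[OF K, of x m]] g(3)[of "bd x" m] that by simp
    qed
  qed
qed

text \<open>The identity \<open>bd_s_bd\<close> makes both composites of \<open>P\<close> with the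
  boundary vanish, so \<open>P\<close> deforms the chains onto a subspace on which the differential
  is zero.\<close>

locale contraction =
  fixes K :: "'a set set" and s P :: "('a set \<Rightarrow>\<^sub>0 'f::field) \<Rightarrow> ('a set \<Rightarrow>\<^sub>0 'f)"
  assumes K: "sc_complex K" and lin_s: "lin s"
    and s_csub: "x \<in> csub K n \<Longrightarrow> s x \<in> csub K (Suc n)"
    and bd_s_bd: "x \<in> csub K n \<Longrightarrow> bd (s (bd x)) = bd x"
    and P_def: "P = (\<lambda>x. x - bd (s x) - s (bd x))"
begin

lemma lin_P: "lin P"
  unfolding P_def by (intro lin_minus lin_ident lin_comp[OF lin_bd lin_s] lin_comp[OF lin_s lin_bd])

lemma homotopy: "bd (s x) + s (bd x) = x - P x"
  by (simp add: P_def)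

lemma s_bd_csub: "x \<in> csub K n \<Longrightarrow> s (bd x) \<in> csub K n"
proof (cases n)
  case 0
  assume "x \<in> csub K n"
  then show ?thesis
    using csub_0[OF K, of x] 0 by (simp add: lin_0[OF lin_bd] lin_0[OF lin_s] fv.subspace_0[OF subspace_csub])
next
  case (Suc m)
  assume "x \<in> csub K n"
  then show ?thesis using s_csub[OF bd_csub[OF K, of x m]] Suc by simp
qed

lemma P_cyc: "x \<in> csub K n \<Longrightarrow> P x \<in> cyc K n"
proof -
  assume x: "x \<in> csub K n"
  have "P x \<in> csub K n"
    unfolding P_def using x by (intro fv.subspace_diff[OF subspace_csub] bd_csub[OF K] s_csub s_bd_csub)
  then show ?thesis
    by (simp add: cyc_def P_def lin_diff[OF lin_bd] bd_bd bd_s_bd[OF x])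
qed

lemma P_bd: "x \<in> csub K n \<Longrightarrow> P (bd x) = 0"
  by (simp add: P_def bd_bd bd_s_bd lin_0[OF lin_s])

lemma P_cyc_bnd:
  assumes "x \<in> cyc K n"
  shows "x - P x \<in> bnd K n"
  using assms s_csub[of x n] by (auto simp: P_def cyc_def lin_0[OF lin_s] intro: bndI)

end

lemma contraction_exists:
  assumes "sc_complex K"
  obtains s P where "contraction K s P"
proof -
  obtain s :: "('a set \<Rightarrow>\<^sub>0 'b) \<Rightarrow> ('a set \<Rightarrow>\<^sub>0 'b)" where "lin s"
    "\<And>n x. x \<in> csub K n \<Longrightarrow> s x \<in> csub K (Suc n)"
    "\<And>n x. x \<in> csub K n \<Longrightarrow> bd (s (bd x)) = bd x"
    using generalised_inverse[OF assms] by blast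
  then have "contraction K s (\<lambda>x. x - bd (s x) - s (bd x))"
    using assms by (intro contraction.intro) auto
  then show thesis by (rule that)
qed

section \<open>Reduction of tensor cycles to tensors of cycles\<close>

lemma tbd_tens_cyc: "x \<in> cyc K m \<Longrightarrow> y \<in> cyc L n \<Longrightarrow> tbd (tens x y) = 0"
  by (simp add: tbd_tens cyc_def)

context
  fixes K :: "'a set set" and L :: "'b set set" and s P :: "('a set \<Rightarrow>\<^sub>0 'f::field) \<Rightarrow> ('a set \<Rightarrow>\<^sub>0 'f)"
    and s' P' :: "('b set \<Rightarrow>\<^sub>0 'f) \<Rightarrow> ('b set \<Rightarrow>\<^sub>0 'f)"
  assumes cK: "contraction K s P" and cL: "contraction L s' P'"
begin

interpretation A: contraction K s P by (rule cK)
interpretation B: contraction L s' P' by (rule cL)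

text \<open>An instance of \<open>tensor_homotopy\<close>. The image of \<open>tmap P P'\<close>
  consists of combinations of tensors of cycles, so every tensor cycle is homologous to such a
  combination.\<close>

lemma tensor_retraction:
  assumes z: "z \<in> tsub K L n" and bz: "tbd z = 0"
  shows "\<exists>y\<in>tsub K L (Suc n). tbd y = z - tmap P P' z"
proof -
  let ?D = "\<lambda>z. tmap s (\<lambda>y. y) z + tmap (\<lambda>x. sgno (P x)) s' z"
  have linD: "lin ?D" by (intro lin_plus lin_tmap)
  have "tbd (?D z) + ?D (tbd z) = z - tmap P P' z"
  proof (rule lin_tsub_eq[OF _ _ z])
    show "lin (\<lambda>z. tbd (?D z) + ?D (tbd z))"
      by (intro lin_plus lin_comp[OF lin_tbd linD] lin_comp[OF lin_tmap lin_tbd])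
    show "lin (\<lambda>z. z - tmap P P' z)" by (intro lin_minus lin_ident lin_tmap)
    fix \<sigma> \<tau> assume "\<sigma> \<in> K" "\<tau> \<in> L"
    then have \<sigma>: "delta \<sigma> \<in> csub K (card \<sigma>)" by (simp add: delta_csub)
    have "P (delta \<sigma>) \<in> csub K (card \<sigma>)" "bd (P (delta \<sigma>)) = 0"
      using A.P_cyc[OF \<sigma>] by (simp_all add: cyc_def)
    from tensor_homotopy[where s = s and P = P and s' = s' and P' = P' and x = "delta \<sigma>" and y = "delta \<tau>",
        OF A.lin_s A.lin_P B.lin_s A.K \<sigma> A.s_csub[OF \<sigma>] this(1) A.homotopy[of "delta \<sigma>"] this(2) A.P_bd[OF \<sigma>] B.homotopy[of "delta \<tau>"]]
    show "tbd (?D (tens (delta \<sigma>) (delta \<tau>))) + ?D (tbd (tens (delta \<sigma>) (delta \<tau>))) =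
        tens (delta \<sigma>) (delta \<tau>) - tmap P P' (tens (delta \<sigma>) (delta \<tau>))"
      by (simp only: tmap_tens[OF A.lin_P B.lin_P])
  qed
  then have "tbd (?D z) = z - tmap P P' z"
    by (simp add: bz lin_0[OF linD] lin_0[OF lin_tmap])
  moreover have "?D z \<in> tsub K L (Suc n)"
  proof (rule lin_tsub_mem[OF linD subspace_tsub z])
    fix \<sigma> \<tau> assume "\<sigma> \<in> K" "\<tau> \<in> L" and c: "card \<sigma> + card \<tau> = n"
    then have \<sigma>: "delta \<sigma> \<in> csub K (card \<sigma>)" and \<tau>: "delta \<tau> \<in> csub L (card \<tau>)"
      by (simp_all add: delta_csub)
    have P: "P (delta \<sigma>) \<in> csub K (card \<sigma>)" using A.P_cyc[OF \<sigma>] by (simp add: cyc_def)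
    have "tens (s (delta \<sigma>)) (delta \<tau>) \<in> tsub K L (Suc (card \<sigma>) + card \<tau>)"
      by (rule tens_tsub[OF A.s_csub[OF \<sigma>] \<tau>])
    moreover have "tens (sgno (P (delta \<sigma>))) (s' (delta \<tau>)) \<in> tsub K L (card \<sigma> + Suc (card \<tau>))"
      unfolding sgno_csub[OF P] by (rule tens_tsub[OF fv.subspace_scale[OF subspace_csub P] B.s_csub[OF \<tau>]])
    ultimately show "?D (tens (delta \<sigma>) (delta \<tau>)) \<in> tsub K L (Suc n)"
      unfolding tmap_tens[OF A.lin_s lin_ident] tmap_tens[OF lin_comp[OF lin_sgno A.lin_P] B.lin_s]
      using c by (intro fv.subspace_add[OF subspace_tsub]) simp_all
  qed
  ultimately show ?thesis by blast
qed

text \<open>One bidegree of \<open>tmap P P' u\<close>, kept as a formal combination of pairs of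
  cycles; in this form it represents an element of a tensor product of homology spaces.\<close>

definition part :: "nat \<Rightarrow> ('a set \<times> 'b set \<Rightarrow>\<^sub>0 'f) \<Rightarrow> (('a set \<Rightarrow>\<^sub>0 'f) \<times> ('b set \<Rightarrow>\<^sub>0 'f) \<Rightarrow>\<^sub>0 'f)" where
  "part i u = lext (\<lambda>(\<sigma>, \<tau>). delta (P (delta \<sigma>), P' (delta \<tau>))) (restr {(\<sigma>, \<tau>). card \<sigma> = Suc i} u)"

lemma part_fsub:
  assumes u: "u \<in> tsub K L (Suc (Suc k))" and "i \<le> k"
  shows "part i u \<in> fsub (cyc K (Suc i) \<times> cyc L (Suc (k - i)))"
  unfolding part_def
proof (rule lin_fsub[OF lin_lext _ restr_fsub'[OF u[unfolded tsub_def]]])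
  fix b assume "b \<in> {(\<sigma>, \<tau>). \<sigma> \<in> K \<and> \<tau> \<in> L \<and> card \<sigma> + card \<tau> = Suc (Suc k)} \<inter> {(\<sigma>, \<tau>). card \<sigma> = Suc i}"
  then obtain \<sigma> \<tau> where b: "b = (\<sigma>, \<tau>)" "\<sigma> \<in> K" "\<tau> \<in> L" "card \<sigma> = Suc i" "card \<tau> = Suc (k - i)"
    using assms(2) by (cases b) auto
  then show "lext (\<lambda>(\<sigma>, \<tau>). delta (P (delta \<sigma>), P' (delta \<tau>))) (delta b) \<in> fsub (cyc K (Suc i) \<times> cyc L (Suc (k - i)))"
    using A.P_cyc[of "delta \<sigma>" "Suc i"] B.P_cyc[of "delta \<tau>" "Suc (k - i)"] by (simp add: delta_csub)
qed

lemma sum_part: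
  assumes u: "u \<in> tsub K L (Suc (Suc k))"
  shows "(\<Sum>i\<le>k. lext (\<lambda>(x, y). tens x y) (part i u)) = tmap P P' u"
proof -
  have *: "lext (\<lambda>(x, y). tens x y) (lext (\<lambda>(\<sigma>, \<tau>). delta (P (delta \<sigma>), P' (delta \<tau>))) q) = tmap P P' q" for q
    by (rule lin_eq[OF lin_comp[OF lin_lext lin_lext] lin_tmap]) (simp add: tmap_def case_prod_unfold)
  have "(\<Sum>i\<le>k. restr {(\<sigma>, \<tau>). card \<sigma> = Suc i} u) = u"
  proof (rule poly_mapping_eqI)
    fix b :: "'a set \<times> 'b set"
    obtain \<sigma> \<tau> where b: "b = (\<sigma>, \<tau>)" by (cases b)
    have "lookup (\<Sum>i\<le>k. restr {(\<sigma>, \<tau>). card \<sigma> = Suc i} u) b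
        = (\<Sum>i\<le>k. if card \<sigma> = Suc i then lookup u b else 0)"
      by (simp add: lookup_sum lookup_restr) (simp add: b)
    also have "\<dots> = lookup u b"
    proof (cases "lookup u b = 0")
      case False
      then have "\<sigma> \<in> K" "\<tau> \<in> L" "card \<sigma> + card \<tau> = Suc (Suc k)"
        using fsubD[OF u[unfolded tsub_def], of b] by (auto simp: b)
      moreover then have "0 < card \<sigma>" "0 < card \<tau>"
        using complex_finite[OF A.K] complex_finite[OF B.K] by auto
      \<comment> \<open>Both simplices are nonempty, so the left cardinality lies between 1 and
        \<open>Suc k\<close> and exactly one index contributes.\<close>
      ultimately have c: "card \<sigma> - 1 \<le> k" "\<And>i. card \<sigma> = Suc i \<longleftrightarrow> i = card \<sigma> - 1" by auto
      show ?thesis unfolding c(2) using c(1) by (simp add: sum.delta)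
    qed (auto intro!: sum.neutral)
    finally show "lookup (\<Sum>i\<le>k. restr {(\<sigma>, \<tau>). card \<sigma> = Suc i} u) b = lookup u b" .
  qed
  then show ?thesis
    unfolding part_def * by (metis lin_sum[OF lin_tmap])
qed

text \<open>\<open>\<beta>\<close> extends to a linear map \<open>q\<close> on the whole tensor
  complex by first projecting each factor to one degree and applying \<open>P\<close> or
  \<open>P'\<close>. These kill boundaries, so \<open>q\<close> kills tensor boundaries. On cycles
  they change the argument only by a boundary, which \<open>\<beta>\<close> ignores, so
  \<open>q\<close> reads off \<open>\<beta>\<close> on \<open>t i\<close>.\<close>

lemma bilinear_detects:
  fixes \<beta> :: "('a set \<Rightarrow>\<^sub>0 'f) \<Rightarrow> ('b set \<Rightarrow>\<^sub>0 'f) \<Rightarrow> ('d \<Rightarrow>\<^sub>0 'f)"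
  assumes t: "\<And>i. i \<le> k \<Longrightarrow> t i \<in> fsub (cyc K (Suc i) \<times> cyc L (Suc (k - i)))"
    and w: "w \<in> tsub K L n" "tbd w = (\<Sum>i\<le>k. lext (\<lambda>(x, y). tens x y) (t i))"
    and i: "i \<le> k" and \<beta>: "bilin (cyc K (Suc i)) (cyc L (Suc (k - i))) \<beta>"
    and \<beta>0: "\<And>x y. x \<in> bnd K (Suc i) \<Longrightarrow> y \<in> cyc L (Suc (k - i)) \<Longrightarrow> \<beta> x y = 0"
      "\<And>x y. x \<in> cyc K (Suc i) \<Longrightarrow> y \<in> bnd L (Suc (k - i)) \<Longrightarrow> \<beta> x y = 0"
  shows "lext (\<lambda>(x, y). \<beta> x y) (t i) = 0"
proof -
  let ?RA = "\<lambda>x. P (restr {\<sigma> \<in> K. card \<sigma> = Suc i} x)"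
  let ?RB = "\<lambda>y. P' (restr {\<tau> \<in> L. card \<tau> = Suc (k - i)} y)"
  have linR: "lin ?RA" "lin ?RB" by (intro lin_comp[OF A.lin_P] lin_comp[OF B.lin_P] lin_restr)+
  have RA: "?RA x \<in> cyc K (Suc i)" and RB: "?RB y \<in> cyc L (Suc (k - i))"
    for x :: "'a set \<Rightarrow>\<^sub>0 'f" and y :: "'b set \<Rightarrow>\<^sub>0 'f"
    by (intro A.P_cyc B.P_cyc; unfold csub_def; rule restr_fsub)+
  \<comment> \<open>\<open>\<beta>\<close> is bilinear on cycles only. After the two projections
    every argument is a cycle, so \<open>?g\<close> is bilinear on all chains.\<close>
  let ?g = "\<lambda>x y. \<beta> (?RA x) (?RB y)"
  have g: "\<And>y. lin (\<lambda>x. ?g x y)" "\<And>x. lin (?g x)"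
    using \<beta> RA RB by (auto intro!: linI simp: lin_add[OF linR(1)] lin_add[OF linR(2)]
        lin_scale[OF linR(1)] lin_scale[OF linR(2)] bilin_def)
  define q where "q = lext (\<lambda>(\<sigma>, \<tau>). ?g (delta \<sigma>) (delta \<tau>))"
  have linq: "lin q" unfolding q_def by (rule lin_lext)
  have q: "q (tens x y) = ?g x y" for x :: "'a set \<Rightarrow>\<^sub>0 'f" and y :: "'b set \<Rightarrow>\<^sub>0 'f"
    unfolding q_def by (rule lext_tens) (rule g)+
  have restr_other: "restr {\<sigma> \<in> C. card \<sigma> = m} x = (if m = n then x else 0)" if "x \<in> csub C n"
    for C :: "'x set set" and m n and x :: "'x set \<Rightarrow>\<^sub>0 'f"
  proof (cases "m = n")
    case True then show ?thesis using that by (simp add: csub_def restr_id)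
  next
    case False
    then have "{\<sigma> \<in> C. card \<sigma> = n} \<inter> {\<sigma> \<in> C. card \<sigma> = m} = {}" by auto
    then show ?thesis
      using restr_fsub'[OF that[unfolded csub_def], of "{\<sigma> \<in> C. card \<sigma> = m}"] False by (simp add: fsub_empty_iff)
  qed
  have RA_bd: "?RA (bd x) = 0" if x: "x \<in> csub K n" for x n
  proof (cases n)
    case 0 then show ?thesis
      using csub_0[OF A.K, of x] x by (simp add: lin_0[OF lin_bd] lin_0[OF lin_restr] lin_0[OF A.lin_P])
  next
    case (Suc m) then show ?thesis
      using restr_other[OF bd_csub[OF A.K, of x m], of "Suc i"] x A.P_bd[OF x] by (simp add: lin_0[OF A.lin_P])
  qed
  have RB_bd: "?RB (bd y) = 0" if y: "y \<in> csub L n" for y n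
  proof (cases n)
    case 0 then show ?thesis
      using csub_0[OF B.K, of y] y by (simp add: lin_0[OF lin_bd] lin_0[OF lin_restr] lin_0[OF B.lin_P])
  next
    case (Suc m) then show ?thesis
      using restr_other[OF bd_csub[OF B.K, of y m], of "Suc (k - i)"] y B.P_bd[OF y] by (simp add: lin_0[OF B.lin_P])
  qed
  have g0: "?g 0 y = 0" "?g x 0 = 0" for x y
    using lin_0[OF g(1)] lin_0[OF g(2)] by blast+
  have \<beta>00: "\<beta> 0 (?RB y) = 0" "\<beta> (?RA x) 0 = 0" for x y
    using g0 by (simp_all add: lin_0[OF linR(1)] lin_0[OF linR(2)])
  have "q (tbd w) = 0"
  proof (rule lin_tsub_eq[OF lin_comp[OF linq lin_tbd] lin_zero w(1)])
    fix \<sigma> \<tau> assume "\<sigma> \<in> K" "\<tau> \<in> L"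
    then have \<sigma>: "delta \<sigma> \<in> csub K (card \<sigma>)" and \<tau>: "delta \<tau> \<in> csub L (card \<tau>)"
      by (simp_all add: delta_csub)
    show "q (tbd (tens (delta \<sigma>) (delta \<tau>))) = 0"
      unfolding tbd_tens lin_add[OF linq] q RA_bd[OF \<sigma>] RB_bd[OF \<tau>] \<beta>00 by simp
  qed
  moreover have "q (lext (\<lambda>(x, y). tens x y) (t j)) = (if j = i then lext (\<lambda>(x, y). \<beta> x y) (t i) else 0)"
    if j: "j \<le> k" for j
  proof -
    have "q (lext (\<lambda>(x, y). tens x y) (t j)) = lext (\<lambda>(x, y). ?g x y) (t j)"
      by (simp add: lext_lin[OF linq] case_prod_unfold q)
    also have "\<dots> = lext (\<lambda>(x, y). if j = i then \<beta> x y else 0) (t j)"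
    proof (rule lext_cong[OF t[OF j]], clarify)
      fix x :: "'a set \<Rightarrow>\<^sub>0 'f" and y :: "'b set \<Rightarrow>\<^sub>0 'f"
      assume x: "x \<in> cyc K (Suc j)" and y: "y \<in> cyc L (Suc (k - j))"
      show "?g x y = (if j = i then \<beta> x y else 0)"
      proof (cases "j = i")
        case True
        have xy: "x \<in> cyc K (Suc i)" "y \<in> cyc L (Suc (k - i))" using x y True by simp_all
        then have R: "?RA x = P x" "?RB y = P' y"
          using restr_other[of x K "Suc i" "Suc i"] restr_other[of y L "Suc (k - i)" "Suc (k - i)"]
          by (simp_all add: cyc_def)
        have Pc: "P x \<in> cyc K (Suc i)" "P' y \<in> cyc L (Suc (k - i))"
          using xy A.P_cyc[of x "Suc i"] B.P_cyc[of y "Suc (k - i)"] by (simp_all add: cyc_def)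
        have "\<beta> (P x + (x - P x)) y = \<beta> (P x) y + \<beta> (x - P x) y"
          using \<beta> xy Pc A.P_cyc_bnd[OF xy(1)] bnd_cyc[OF A.K] unfolding bilin_def by blast
        moreover have "\<beta> (P x) (P' y + (y - P' y)) = \<beta> (P x) (P' y) + \<beta> (P x) (y - P' y)"
          using \<beta> xy Pc B.P_cyc_bnd[OF xy(2)] bnd_cyc[OF B.K] unfolding bilin_def by blast
        ultimately have "\<beta> x y = \<beta> (P x) (P' y)"
          using \<beta>0(1)[OF A.P_cyc_bnd[OF xy(1)] xy(2)] \<beta>0(2)[OF Pc(1) B.P_cyc_bnd[OF xy(2)]] by simp
        then show ?thesis using True R by simp
      next
        case False
        then have "restr {\<sigma> \<in> K. card \<sigma> = Suc i} x = 0"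
          using restr_other[of x K "Suc j" "Suc i"] x by (simp add: cyc_def)
        then show ?thesis using False by (simp add: lin_0[OF A.lin_P] \<beta>00)
      qed
    qed
    also have "\<dots> = (if j = i then lext (\<lambda>(x, y). \<beta> x y) (t i) else 0)"
      by (auto simp: lext_def case_prod_unfold)
    finally show ?thesis .
  qed
  ultimately have "(\<Sum>j\<le>k. if j = i then lext (\<lambda>(x, y). \<beta> x y) (t i) else 0) = 0"
    by (simp add: w(2) lin_sum[OF linq])
  then show ?thesis using i by simp
qed

end

section \<open>The cross product: cycles, surjectivity and kernel\<close>

context eilenberg_zilber
begin

definition cross :: "(('a set \<Rightarrow>\<^sub>0 'f) \<times> ('b set \<Rightarrow>\<^sub>0 'f) \<Rightarrow>\<^sub>0 'f) \<Rightarrow> (('a \<times> 'b) set \<Rightarrow>\<^sub>0 'f)" where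
  "cross = lext (\<lambda>(x, y). EZ (tens x y))"

lemma lin_cross: "lin cross"
  unfolding cross_def by (rule lin_lext)

lemma cross_eq: "cross t = EZ (lext (\<lambda>(x, y). tens x y) t)"
  by (simp add: cross_def lext_lin[OF lin_EZ] case_prod_unfold)

context
  fixes K :: "'a set set" and L :: "'b set set"
  assumes K: "sc_complex K" and L: "sc_complex L"
begin

lemma EZ_tens_cyc:
  assumes "x \<in> cyc K (Suc i)" "y \<in> cyc L (Suc j)"
  shows "EZ (tens x y) \<in> cyc (prodc K L) (Suc (i + j))"
proof -
  have "tens x y \<in> tsub K L (Suc (Suc (i + j)))"
    using tens_tsub[of x K "Suc i" y L "Suc j"] assms by (simp add: cyc_def)
  then show ?thesis
    using EZ_tsub[OF K L] bd_EZ[OF K L] tbd_tens_cyc[OF assms] by (simp add: cyc_def lin_0[OF lin_EZ])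
qed

lemma EZ_tens_bnd:
  "x \<in> bnd K (Suc i) \<Longrightarrow> y \<in> cyc L (Suc j) \<Longrightarrow> EZ (tens x y) \<in> bnd (prodc K L) (Suc (i + j))"
  "x \<in> cyc K (Suc i) \<Longrightarrow> y \<in> bnd L (Suc j) \<Longrightarrow> EZ (tens x y) \<in> bnd (prodc K L) (Suc (i + j))"
proof -
  assume "x \<in> bnd K (Suc i)" and y: "y \<in> cyc L (Suc j)"
  then obtain w where w: "w \<in> csub K (Suc (Suc i))" "x = bd w" by (auto simp: bnd_def)
  have ts: "tens w y \<in> tsub K L (Suc (Suc (Suc (i + j))))"
    using tens_tsub[OF w(1), of y L "Suc j"] y by (simp add: cyc_def)
  have "bd (EZ (tens w y)) = EZ (tens x y)"
    using bd_EZ[OF K L ts] y by (simp add: tbd_tens cyc_def w(2))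
  then show "EZ (tens x y) \<in> bnd (prodc K L) (Suc (i + j))"
    using bndI[OF EZ_tsub[OF K L ts]] by simp
next
  assume x: "x \<in> cyc K (Suc i)" and "y \<in> bnd L (Suc j)"
  then obtain w where w: "w \<in> csub L (Suc (Suc j))" "y = bd w" by (auto simp: bnd_def)
  have xc: "x \<in> csub K (Suc i)" "bd x = 0" using x by (simp_all add: cyc_def)
  have "tens x w \<in> tsub K L (Suc (Suc (Suc (i + j))))"
    using tens_tsub[OF xc(1) w(1)] by simp
  \<comment> \<open>The scalar compensates the sign of the Leibniz rule, since \<open>x\<close> has
    cardinality \<open>Suc i\<close>.\<close>
  then have ts: "smul ((- 1) ^ Suc i) (tens x w) \<in> tsub K L (Suc (Suc (Suc (i + j))))"
    by (rule fv.subspace_scale[OF subspace_tsub])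
  have "bd (EZ (smul ((- 1) ^ Suc i) (tens x w))) = EZ (tens x y)"
    unfolding bd_EZ[OF K L ts] lin_scale[OF lin_tbd] tbd_tens_csub[OF xc(1)] xc(2) w(2)
    by (simp add: sq_sign)
  then show "EZ (tens x y) \<in> bnd (prodc K L) (Suc (i + j))"
    using bndI[OF EZ_tsub[OF K L ts]] by simp
qed

lemma cross_cyc:
  assumes "t \<in> fsub (cyc K (Suc i) \<times> cyc L (Suc j))"
  shows "cross t \<in> cyc (prodc K L) (Suc (i + j))"
  by (rule lin_mem[OF lin_cross subspace_cyc _ assms]) (auto simp: cross_def EZ_tens_cyc)

text \<open>Modulo boundaries, \<open>z\<close> equals \<open>EZ (AW z)\<close> by the homotopy for
  that composite, and the tensor cycle \<open>AW z\<close> may be replaced by its image under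
  \<open>tmap P P'\<close>. The bidegree parts of the result are the required combinations.\<close>

lemma cross_surj:
  assumes z: "z \<in> cyc (prodc K L) (Suc k)"
  shows "\<exists>t. (\<forall>i\<le>k. t i \<in> fsub (cyc K (Suc i) \<times> cyc L (Suc (k - i)))) \<and>
    z - (\<Sum>i\<le>k. cross (t i)) \<in> bnd (prodc K L) (Suc k)"
proof (rule EZ_AW_homotopy)
  fix D :: "(('a \<times> 'b) set \<Rightarrow>\<^sub>0 'f) \<Rightarrow> (('a \<times> 'b) set \<Rightarrow>\<^sub>0 'f)"
  assume D: "lin D"
    "\<And>\<rho>. \<rho> \<in> nes \<Longrightarrow> D (delta \<rho>) \<in> csub (full_simplex (fst ` \<rho> \<times> snd ` \<rho>)) (Suc (card \<rho>))"
    "\<And>\<rho>. \<rho> \<in> nes \<Longrightarrow> bd (D (delta \<rho>)) + D (bd (delta \<rho>)) = delta \<rho> - EZ (AW (delta \<rho>))"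
  obtain s P where cK: "contraction K s (P :: ('a set \<Rightarrow>\<^sub>0 'f) \<Rightarrow> _)" using contraction_exists[OF K] by blast
  obtain s' P' where cL: "contraction L s' (P' :: ('b set \<Rightarrow>\<^sub>0 'f) \<Rightarrow> _)" using contraction_exists[OF L] by blast
  note KL = complex_prodc[OF K L]
  have zc: "z \<in> csub (prodc K L) (Suc k)" "bd z = 0" using z by (simp_all add: cyc_def)
  have "bd (D z) + D (bd z) = z - EZ (AW z)"
    by (rule lin_csub_eq[OF lin_plus[OF lin_comp[OF lin_bd D(1)] lin_comp[OF D(1) lin_bd]]
          lin_minus[OF lin_ident lin_comp[OF lin_EZ lin_AW]] _ zc(1)])
      (use D(3) complex_nes[OF KL] in auto)
  moreover have Dz: "D z \<in> csub (prodc K L) (Suc (Suc k))"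
  proof (rule lin_csub_mem[OF D(1) subspace_csub _ zc(1)])
    fix \<rho> assume \<rho>: "\<rho> \<in> prodc K L" "card \<rho> = Suc k"
    then have "fst ` \<rho> \<in> K" "snd ` \<rho> \<in> L" by (auto simp: prodc_def)
    then show "D (delta \<rho>) \<in> csub (prodc K L) (Suc (Suc k))"
      using csub_mono[OF D(2)[OF complex_nes[OF KL \<rho>(1)]] full_simplex_Times_prodc[OF K L]] \<rho>(2) by simp
  qed
  ultimately have 1: "z - EZ (AW z) \<in> bnd (prodc K L) (Suc k)"
    using bndI[OF Dz] by (simp add: zc(2) lin_0[OF D(1)])
  have u: "AW z \<in> tsub K L (Suc (Suc k))" "tbd (AW z) = 0"
    using AW_csub[OF K L zc(1)] tbd_AW[OF K L zc(1)] by (simp_all add: zc(2) lin_0[OF lin_AW])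
  obtain y where y: "y \<in> tsub K L (Suc (Suc (Suc k)))" "tbd y = AW z - tmap P P' (AW z)"
    using tensor_retraction[OF cK cL u] by blast
  have 2: "EZ (AW z) - EZ (tmap P P' (AW z)) \<in> bnd (prodc K L) (Suc k)"
    using bndI[OF EZ_tsub[OF K L y(1)]] bd_EZ[OF K L y(1)] by (simp add: y(2) lin_diff[OF lin_EZ])
  have "(\<Sum>i\<le>k. cross (part P P' i (AW z))) = EZ (tmap P P' (AW z))"
    by (simp add: cross_eq sum_part[OF cK cL u(1), symmetric] lin_sum[OF lin_EZ])
  then have "z - (\<Sum>i\<le>k. cross (part P P' i (AW z))) \<in> bnd (prodc K L) (Suc k)"
    using fv.subspace_add[OF subspace_bnd 1 2] by simp
  moreover have "\<forall>i\<le>k. part P P' i (AW z) \<in> fsub (cyc K (Suc i) \<times> cyc L (Suc (k - i)))"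
    using part_fsub[OF cK cL u(1)] by simp
  ultimately show ?thesis
    by (intro exI[of _ "\<lambda>i. part P P' i (AW z)"] conjI)
qed

text \<open>If the cross product bounds \<open>w\<close>, then \<open>AW w\<close> and the homotopy
  for \<open>AW\<close> after \<open>EZ\<close> together show that the underlying tensor cycle is a
  boundary in the tensor complex, where \<open>bilinear_detects\<close> applies.\<close>

lemma cross_kernel:
  fixes \<beta> :: "('a set \<Rightarrow>\<^sub>0 'f) \<Rightarrow> ('b set \<Rightarrow>\<^sub>0 'f) \<Rightarrow> ('d \<Rightarrow>\<^sub>0 'f)"
  assumes t: "\<And>i. i \<le> k \<Longrightarrow> t i \<in> fsub (cyc K (Suc i) \<times> cyc L (Suc (k - i)))"
    and b: "(\<Sum>i\<le>k. cross (t i)) \<in> bnd (prodc K L) (Suc k)"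
    and i: "i \<le> k" and \<beta>: "bilin (cyc K (Suc i)) (cyc L (Suc (k - i))) \<beta>"
    and \<beta>0: "\<And>x y. x \<in> bnd K (Suc i) \<Longrightarrow> y \<in> cyc L (Suc (k - i)) \<Longrightarrow> \<beta> x y = 0"
      "\<And>x y. x \<in> cyc K (Suc i) \<Longrightarrow> y \<in> bnd L (Suc (k - i)) \<Longrightarrow> \<beta> x y = 0"
  shows "lext (\<lambda>(x, y). \<beta> x y) (t i) = 0"
proof (rule AW_EZ_homotopy)
  fix D :: "('a set \<times> 'b set \<Rightarrow>\<^sub>0 'f) \<Rightarrow> ('a set \<times> 'b set \<Rightarrow>\<^sub>0 'f)"
  assume D: "lin D"
    "\<And>\<sigma> \<tau>. \<sigma> \<in> nes \<Longrightarrow> \<tau> \<in> nes \<Longrightarrow>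
      D (delta (\<sigma>, \<tau>)) \<in> tsub (full_simplex \<sigma>) (full_simplex \<tau>) (Suc (card \<sigma> + card \<tau>))"
    "\<And>\<sigma> \<tau>. \<sigma> \<in> nes \<Longrightarrow> \<tau> \<in> nes \<Longrightarrow>
      tbd (D (delta (\<sigma>, \<tau>))) + D (tbd (delta (\<sigma>, \<tau>))) = delta (\<sigma>, \<tau>) - AW (EZ (delta (\<sigma>, \<tau>)))"
  obtain s P where cK: "contraction K s (P :: ('a set \<Rightarrow>\<^sub>0 'f) \<Rightarrow> _)" using contraction_exists[OF K] by blast
  obtain s' P' where cL: "contraction L s' (P' :: ('b set \<Rightarrow>\<^sub>0 'f) \<Rightarrow> _)" using contraction_exists[OF L] by blast
  define u where "u = (\<Sum>i\<le>k. lext (\<lambda>(x, y). tens x y) (t i))"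
  have "lext (\<lambda>(x, y). tens x y) (t i) \<in> tsub K L (Suc (Suc k)) \<inter> {z. tbd z = 0}" if i: "i \<le> k" for i
  proof (rule lin_mem[OF lin_lext _ _ t[OF i]])
    show "fv.subspace (tsub K L (Suc (Suc k)) \<inter> {z. tbd z = 0})"
      using subspace_tsub[of K L "Suc (Suc k)"]
      by (auto simp: fv.subspace_def lin_add[OF lin_tbd] lin_scale[OF lin_tbd] lin_0[OF lin_tbd])
    fix b :: "('a set \<Rightarrow>\<^sub>0 'f) \<times> ('b set \<Rightarrow>\<^sub>0 'f)" assume "b \<in> cyc K (Suc i) \<times> cyc L (Suc (k - i))"
    then obtain x y where b: "b = (x, y)" "x \<in> cyc K (Suc i)" "y \<in> cyc L (Suc (k - i))" by auto
    have "tens x y \<in> tsub K L (Suc i + Suc (k - i))"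
      using b by (intro tens_tsub) (simp_all add: cyc_def)
    then show "lext (\<lambda>(x, y). tens x y) (delta b) \<in> tsub K L (Suc (Suc k)) \<inter> {z. tbd z = 0}"
      using i tbd_tens_cyc[OF b(2,3)] by (simp add: b(1))
  qed
  then have u: "u \<in> tsub K L (Suc (Suc k))" "tbd u = 0"
    unfolding u_def by (auto simp: lin_sum[OF lin_tbd] intro!: fv.subspace_sum[OF subspace_tsub] sum.neutral)
  have "EZ u \<in> bnd (prodc K L) (Suc k)"
    using b by (simp add: u_def lin_sum[OF lin_EZ] cross_eq)
  then obtain w where w: "w \<in> csub (prodc K L) (Suc (Suc k))" "EZ u = bd w" by (auto simp: bnd_def)
  have "tbd (D u) + D (tbd u) = u - AW (EZ u)"
    by (rule lin_tsub_eq[OF lin_plus[OF lin_comp[OF lin_tbd D(1)] lin_comp[OF D(1) lin_tbd]]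
          lin_minus[OF lin_ident lin_comp[OF lin_AW lin_EZ]] u(1)])
      (use D(3) complex_nes[OF K] complex_nes[OF L] in auto)
  then have "tbd (D u + AW w) = u"
    by (simp add: u(2) w(2) lin_0[OF D(1)] lin_add[OF lin_tbd] tbd_AW[OF K L w(1)])
  moreover have "D u \<in> tsub K L (Suc (Suc (Suc k)))"
  proof (rule lin_tsub_mem[OF D(1) subspace_tsub u(1)])
    fix \<sigma> \<tau> assume s: "\<sigma> \<in> K" "\<tau> \<in> L" "card \<sigma> + card \<tau> = Suc (Suc k)"
    show "D (tens (delta \<sigma>) (delta \<tau>)) \<in> tsub K L (Suc (Suc (Suc k)))"
      using tsub_mono[OF D(2)[OF complex_nes[OF K s(1)] complex_nes[OF L s(2)]]
          complex_simplex_le[OF K s(1)] complex_simplex_le[OF L s(2)]] s(3) by simp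
  qed
  ultimately have "D u + AW w \<in> tsub K L (Suc (Suc (Suc k)))"
      "tbd (D u + AW w) = (\<Sum>i\<le>k. lext (\<lambda>(x, y). tens x y) (t i))"
    using fv.subspace_add[OF subspace_tsub _ AW_csub[OF K L w(1)]] by (simp_all add: u_def)
  from bilinear_detects[OF cK cL t this i \<beta> \<beta>0] show ?thesis .
qed

end

end


section \<open>Homology as a presented module\<close>

lemma pullback_diff: "pullback \<iota> (p - q) = (\<lambda>vs. pullback \<iota> p vs - pullback \<iota> q vs)"
  by (auto simp: pullback_def alt_of_def lookup_minus algebra_simps)

lemma fspace_pullback:
  assumes "fv.subspace V"
  shows "fspace (pullback \<iota> ` V)"
proof (rule fspaceI)
  show "(\<lambda>_. 0) \<in> pullback \<iota> ` V"
    by (rule image_eqI[of _ _ 0]) (simp_all add: pullback_zero fv.subspace_0[OF assms])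
  show "(\<lambda>t. x t + y t) \<in> pullback \<iota> ` V" if xy: "x \<in> pullback \<iota> ` V" "y \<in> pullback \<iota> ` V" for x y
  proof -
    obtain p q where "p \<in> V" "q \<in> V" "x = pullback \<iota> p" "y = pullback \<iota> q" using xy by blast
    then show ?thesis
      by (intro image_eqI[of _ _ "p + q"]) (simp_all add: pullback_add fv.subspace_add[OF assms])
  qed
  show "(\<lambda>t. a * x t) \<in> pullback \<iota> ` V" if x: "x \<in> pullback \<iota> ` V" for a x
  proof -
    obtain p where "p \<in> V" "x = pullback \<iota> p" using x by blast
    then show ?thesis
      by (intro image_eqI[of _ _ "smul a p"]) (simp_all add: pullback_smul fv.subspace_scale[OF assms])
  qed
qed

lemma pullback_presentation:
  fixes V N :: "('c set \<Rightarrow>\<^sub>0 'f::field) set"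
  assumes inj: "inj \<iota>" and V: "fv.subspace V" and N: "fv.subspace N" and NV: "N \<subseteq> V"
    and V_sub: "V \<subseteq> fsub {\<sigma>. finite \<sigma> \<and> \<sigma> \<subseteq> range \<iota>}"
  shows "presentation V N (\<lambda>p. fcoset (pullback \<iota> ` N) (pullback \<iota> p))
    (quot_module (fun_module (pullback \<iota> ` V)) (pullback \<iota> ` N))"
proof
  note h = fspace_pullback[OF V, of \<iota>] fspace_pullback[OF N, of \<iota>] image_mono[OF NV, of "pullback \<iota>"]
  have inj_pb: "x = y" if "x \<in> V" "y \<in> V" "pullback \<iota> x = pullback \<iota> y" for x y
  proof -
    have "x - y \<in> V" using that V by (intro fv.subspace_diff)
    then have "x - y = 0"
      using V_sub that by (intro pullback_eq_zero[OF inj]) (auto simp: pullback_diff)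
    then show ?thesis by simp
  qed
  let ?M = "quot_module (fun_module (pullback \<iota> ` V)) (pullback \<iota> ` N)"
  show "fv.subspace V" "fv.subspace N" "N \<subseteq> V" by fact+
  show "(\<lambda>p. fcoset (pullback \<iota> ` N) (pullback \<iota> p)) ` V = carrier ?M"
    by (auto simp: carrier_quot[OF h])
  fix x y assume xy: "x \<in> V" "y \<in> V"
  show "fcoset (pullback \<iota> ` N) (pullback \<iota> (x + y)) =
      fcoset (pullback \<iota> ` N) (pullback \<iota> x) \<oplus>\<^bsub>?M\<^esub> fcoset (pullback \<iota> ` N) (pullback \<iota> y)"
    by (simp add: add_quot[OF h] pullback_add)
  have "(fcoset (pullback \<iota> ` N) (pullback \<iota> x) = fcoset (pullback \<iota> ` N) (pullback \<iota> y)) =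
      (pullback \<iota> (x - y) \<in> pullback \<iota> ` N)"
    by (simp add: fcoset_eq_iff[OF h] pullback_diff)
  also have "\<dots> = (x - y \<in> N)"
    using inj_pb[of "x - y"] NV xy fv.subspace_diff[OF V xy] by blast
  finally show "(fcoset (pullback \<iota> ` N) (pullback \<iota> x) = fcoset (pullback \<iota> ` N) (pullback \<iota> y)) = (x - y \<in> N)" .
next
  note h = fspace_pullback[OF V, of \<iota>] fspace_pullback[OF N, of \<iota>] image_mono[OF NV, of "pullback \<iota>"]
  fix a x assume "x \<in> V"
  show "fcoset (pullback \<iota> ` N) (pullback \<iota> (smul a x)) =
      a \<odot>\<^bsub>quot_module (fun_module (pullback \<iota> ` V)) (pullback \<iota> ` N)\<^esub> fcoset (pullback \<iota> ` N) (pullback \<iota> x)"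
    by (simp add: smult_quot[OF h] pullback_smul)
qed

lemma quot_map_id_pullback:
  assumes V: "fv.subspace V" and N: "fv.subspace N" "N \<subseteq> V" and N': "fv.subspace N'" "N \<subseteq> N'"
  shows "quot_map (fun_module V') (pullback \<iota> ` N') id (fcoset (pullback \<iota> ` N) (pullback \<iota> x)) =
    fcoset (pullback \<iota> ` N') (pullback \<iota> x)"
proof -
  note h = fspace_pullback[OF V, of \<iota>] fspace_pullback[OF N(1), of \<iota>] image_mono[OF N(2), of "pullback \<iota>"]
  have "quot_map (fun_module V') (pullback \<iota> ` N') id (fcoset (pullback \<iota> ` N) (pullback \<iota> x)) =
      fcoset (pullback \<iota> ` N') (id (pullback \<iota> x))"
    by (rule quot_map_fcoset[OF h fspace_pullback[OF N'(1)]])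
      (use N'(2) in \<open>auto simp: mem_fcoset_iff[OF h]\<close>)
  then show ?thesis by simp
qed

definition rcyc :: "'a set set \<Rightarrow> nat \<Rightarrow> ('a set \<Rightarrow>\<^sub>0 'f::field) set" where
  "rcyc K n = {p \<in> csub K n. abd p = 0}"

lemma subspace_rcyc: "fv.subspace (rcyc K n)"
  using subspace_csub[of K n]
  by (auto simp: fv.subspace_def rcyc_def lin_add[OF lin_abd] lin_scale[OF lin_abd] lin_0[OF lin_abd])

lemma bd_csub_eq_abd: "p \<in> csub K (Suc (Suc k)) \<Longrightarrow> bd p = abd p"
  by (rule bd_eq_abd) (auto simp: csub_def elim!: fsub_mono)

text \<open>Bounding chains in these degrees live on simplices with at least two vertices, where the
  two boundary operators agree. Reduced and unreduced homology therefore have the same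
  boundaries.\<close>

lemma bnd_abd: "bnd K (Suc k) = abd ` csub K (Suc (Suc k))"
  unfolding bnd_def by (rule image_cong[OF refl bd_csub_eq_abd])

lemma bnd_rcyc: "sc_complex K \<Longrightarrow> bnd K (Suc k) \<subseteq> rcyc K (Suc k)"
  using bnd_cyc[of K "Suc k"] by (auto simp: bnd_abd rcyc_def cyc_def abd_abd)

text \<open>The homology class in \<open>K\<close> of a cycle of \<open>(`) \<iota> ` K\<close>, a copy of \<open>K\<close> on another vertex set
  when \<open>\<iota>\<close> is injective.\<close>

definition cls :: "('a \<Rightarrow> 'c) \<Rightarrow> 'a set set \<Rightarrow> nat \<Rightarrow> ('c set \<Rightarrow>\<^sub>0 'f::field) \<Rightarrow> ('a list \<Rightarrow> 'f) set" where
  "cls \<iota> K k p = fcoset (boundaries K k) (pullback \<iota> p)"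

context
  fixes \<iota> :: "'a \<Rightarrow> 'c" and K :: "'a set set" and K' :: "'c set set"
  assumes inj: "inj \<iota>" and K: "sc_complex K" and K': "K' = (`) \<iota> ` K"
begin

lemma complex_image: "sc_complex K'"
  unfolding sc_complex_def
proof (intro conjI ballI allI impI)
  show "K' \<subseteq> nes" using K by (auto simp: K' sc_complex_def nes_def)
  fix \<sigma> \<tau> assume "\<sigma> \<in> K'" "\<tau> \<subseteq> \<sigma>" "\<tau> \<noteq> {}"
  then obtain \<rho> where \<rho>: "\<rho> \<in> K" "\<sigma> = \<iota> ` \<rho>" by (auto simp: K')
  obtain \<tau>' where \<tau>': "\<tau>' \<subseteq> \<rho>" "\<tau> = \<iota> ` \<tau>'"
    using \<open>\<tau> \<subseteq> \<sigma>\<close> \<rho>(2) by (metis subset_image_iff)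
  moreover have "\<tau>' \<noteq> {}" using \<open>\<tau> \<noteq> {}\<close> \<tau>'(2) by auto
  ultimately show "\<tau> \<in> K'" using complexD[OF K \<rho>(1)] by (auto simp: K')
qed

lemma csub_range: "csub K' n \<subseteq> fsub {\<sigma>. finite \<sigma> \<and> \<sigma> \<subseteq> range \<iota>}"
  unfolding csub_def
  by (rule subsetI, erule fsub_mono) (use complex_finite[OF K] in \<open>auto simp: K'\<close>)

lemma chains_pullback: "chains K k = pullback \<iota> ` csub K' (Suc k)"
  using pullback_chains[OF inj, of _ K k] pullback_chains_surj[OF inj, of _ K k] unfolding K' by blast

lemma boundary_pullback:
  assumes "p \<in> csub K' n"
  shows "boundary (pullback \<iota> p) = pullback \<iota> (abd p)"
proof -
  have "p \<in> fsub {\<sigma>. finite \<sigma> \<and> \<sigma> \<subseteq> range \<iota>}" using assms csub_range[of n] by (rule subsetD[rotated])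
  then have "p \<in> fsub {\<sigma>. \<sigma> \<subseteq> range \<iota>}" by (rule fsub_mono) auto
  then show ?thesis by (simp add: pullback_abd[OF inj])
qed

lemma boundaries_pullback: "boundaries K k = pullback \<iota> ` bnd K' (Suc k)"
  by (simp add: boundaries_def chains_pullback bnd_abd image_image boundary_pullback cong: image_cong)

lemma abd_csub_range: "p \<in> csub K' n \<Longrightarrow> abd p \<in> fsub {\<sigma>. finite \<sigma> \<and> \<sigma> \<subseteq> range \<iota>}"
  using csub_range[of n] by (intro abd_fsub[of p "{\<sigma>. finite \<sigma> \<and> \<sigma> \<subseteq> range \<iota>}"]) auto

lemma boundary_pullback_eq_0:
  "p \<in> csub K' n \<Longrightarrow> boundary (pullback \<iota> p) = (\<lambda>_. 0) \<longleftrightarrow> abd p = 0"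
  using pullback_eq_zero[OF inj abd_csub_range, of p n] by (auto simp: boundary_pullback pullback_zero)

lemma reduced_cycles_pullback: "reduced_cycles K k = pullback \<iota> ` rcyc K' (Suc k)"
  unfolding reduced_cycles_def rcyc_def chains_pullback using boundary_pullback_eq_0 by blast

text \<open>This matches \<open>cycles\<close>, which imposes no condition in degree 0: a single
  vertex has no nonempty proper face.\<close>

lemma cyc_1: "cyc K' (Suc 0) = csub K' (Suc 0)"
  using csub_0[OF complex_image bd_csub[OF complex_image]] by (auto simp: cyc_def)

lemma cyc_Suc: "cyc K' (Suc (Suc k)) = rcyc K' (Suc (Suc k))"
  by (auto simp: cyc_def rcyc_def bd_csub_eq_abd)

lemma cycles_pullback: "cycles K k = pullback \<iota> ` cyc K' (Suc k)"
proof (cases k)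
  case 0
  then show ?thesis by (simp add: cycles_def chains_pullback cyc_1)
next
  case (Suc m)
  then have "cycles K k = reduced_cycles K k" by (simp add: cycles_def reduced_cycles_def)
  then show ?thesis by (simp add: reduced_cycles_pullback Suc cyc_Suc)
qed

lemma homology_presentation:
  "presentation (cyc K' (Suc k)) (bnd K' (Suc k)) (cls \<iota> K k) (homology K k :: ('f::field, _) module)"
proof -
  have "cyc K' (Suc k) \<subseteq> fsub {\<sigma>. finite \<sigma> \<and> \<sigma> \<subseteq> range \<iota>}"
    using csub_range by (auto simp: cyc_def)
  from pullback_presentation[OF inj subspace_cyc subspace_bnd bnd_cyc[OF complex_image] this]
  show ?thesis
    by (simp add: homology_def cycles_pullback boundaries_pullback cls_def[abs_def])
qed

lemma reduced_homology_presentation: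
  "presentation (rcyc K' (Suc k)) (bnd K' (Suc k)) (cls \<iota> K k) (reduced_homology K k :: ('f::field, _) module)"
proof -
  have "rcyc K' (Suc k) \<subseteq> fsub {\<sigma>. finite \<sigma> \<and> \<sigma> \<subseteq> range \<iota>}"
    using csub_range by (auto simp: rcyc_def)
  from pullback_presentation[OF inj subspace_rcyc subspace_bnd bnd_rcyc[OF complex_image] this]
  show ?thesis
    by (simp add: reduced_homology_def reduced_cycles_pullback boundaries_pullback cls_def[abs_def])
qed

end

lemma bnd_mono: "K \<subseteq> L \<Longrightarrow> bnd K n \<subseteq> bnd L n"
  unfolding bnd_def by (intro image_mono subsetI) (rule csub_mono)

lemma cyc_mono: "K \<subseteq> L \<Longrightarrow> cyc K n \<subseteq> cyc L n"
  by (auto simp: cyc_def csub_mono)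

lemma rcyc_mono: "K \<subseteq> L \<Longrightarrow> rcyc K n \<subseteq> rcyc L n"
  by (auto simp: rcyc_def csub_mono)

lemma homology_incl_cls:
  assumes "inj \<iota>" "sc_complex K" "sc_complex L" "K \<subseteq> L"
  shows "homology_incl L k (cls \<iota> K k p) = cls \<iota> L k p"
  unfolding homology_incl_def cls_def
    boundaries_pullback[OF assms(1,2) refl] boundaries_pullback[OF assms(1,3) refl]
  by (rule quot_map_id_pullback[OF subspace_cyc subspace_bnd bnd_cyc subspace_bnd bnd_mono])
    (use assms complex_image[OF assms(1,2) refl] in auto)

lemma reduced_homology_incl_cls:
  assumes "inj \<iota>" "sc_complex K" "sc_complex L" "K \<subseteq> L"
  shows "reduced_homology_incl L k (cls \<iota> K k p) = cls \<iota> L k p"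
  unfolding reduced_homology_incl_def cls_def
    boundaries_pullback[OF assms(1,2) refl] boundaries_pullback[OF assms(1,3) refl]
  \<comment> \<open>Only cosets of boundaries are involved, so the unreduced cycles can serve as the
    ambient space here as well.\<close>
  by (rule quot_map_id_pullback[OF subspace_cyc subspace_bnd bnd_cyc subspace_bnd bnd_mono])
    (use assms complex_image[OF assms(1,2) refl] in auto)


section \<open>Vietoris--Rips complexes of products\<close>

text \<open>Over a nonempty finite set the supremum is a maximum, so strict bounds pass in both
  directions.\<close>

lemma mdiam_less_iff:
  assumes "finite S" "S \<noteq> {}"
  shows "mdiam X S < r \<longleftrightarrow> (\<forall>x\<in>S. \<forall>y\<in>S. mdist X x y < r)"
proof -
  have "finite ((\<lambda>(x, y). mdist X x y) ` (S \<times> S))" "(\<lambda>(x, y). mdist X x y) ` (S \<times> S) \<noteq> {}"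
    using assms by auto
  then show ?thesis
    by (auto simp: mdiam_def cSup_eq_Max)
qed

lemma VR_iff: "\<sigma> \<in> VR r X \<longleftrightarrow> finite \<sigma> \<and> \<sigma> \<noteq> {} \<and> \<sigma> \<subseteq> mspace X \<and> (\<forall>x\<in>\<sigma>. \<forall>y\<in>\<sigma>. mdist X x y < r)"
  using mdiam_less_iff[of \<sigma> X r] by (auto simp: VR_def)

lemma complex_VR: "sc_complex (VR r X)"
  unfolding sc_complex_def
proof (intro conjI ballI allI impI)
  show "VR r X \<subseteq> nes" by (auto simp: VR_iff nes_def)
  fix \<sigma> \<tau> assume s: "\<sigma> \<in> VR r X" "\<tau> \<subseteq> \<sigma>" "\<tau> \<noteq> {}"
  then have "finite \<tau>" by (auto simp: VR_iff intro: finite_subset)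
  moreover have "\<tau> \<subseteq> mspace X" "\<forall>x\<in>\<tau>. \<forall>y\<in>\<tau>. mdist X x y < r"
    using s unfolding VR_iff by blast+
  ultimately show "\<tau> \<in> VR r X" using s(3) by (simp add: VR_iff)
qed

lemma VR_mono: "r \<le> s \<Longrightarrow> VR r X \<subseteq> VR s X"
  by (force simp: VR_iff)

lemma VR_linf_product: "VR r (linf_product X Y) = prodc (VR r X) (VR r Y)"
proof -
  have "\<rho> \<in> VR r (linf_product X Y) \<longleftrightarrow> \<rho> \<in> prodc (VR r X) (VR r Y)" for \<rho>
  proof (cases "finite \<rho> \<and> \<rho> \<noteq> {}")
    case True
    have "\<rho> \<subseteq> mspace X \<times> mspace Y \<longleftrightarrow> fst ` \<rho> \<subseteq> mspace X \<and> snd ` \<rho> \<subseteq> mspace Y"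
      by (auto simp: subset_iff)
    moreover have "(\<forall>z\<in>\<rho>. \<forall>w\<in>\<rho>. mdist (linf_product X Y) z w < r) \<longleftrightarrow>
        (\<forall>x\<in>fst ` \<rho>. \<forall>x'\<in>fst ` \<rho>. mdist X x x' < r) \<and> (\<forall>y\<in>snd ` \<rho>. \<forall>y'\<in>snd ` \<rho>. mdist Y y y' < r)"
      by (simp add: case_prod_unfold) blast
    ultimately show ?thesis using True by (simp add: VR_iff prodc_def) blast
  qed (auto simp: VR_iff prodc_def)
  then show ?thesis by blast
qed

section \<open>Classes in tensor products of homology\<close>

context presentation2
begin

definition tcls :: "(('b \<Rightarrow>\<^sub>0 'f) \<times> ('c \<Rightarrow>\<^sub>0 'f) \<Rightarrow>\<^sub>0 'f) \<Rightarrow> ('v \<times> 'w \<Rightarrow> 'f) set" where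
  "tcls q = T.tcos (push q)"

lemma tcls_image: "tcls ` fsub (V \<times> V') = carrier (tensor_module M M')"
proof -
  have "push ` fsub (V \<times> V') = fsub (carrier M \<times> carrier M')"
  proof (rule subset_antisym; rule subsetI)
    fix p :: "'v \<times> 'w \<Rightarrow>\<^sub>0 'f" assume "p \<in> fsub (carrier M \<times> carrier M')"
    then show "p \<in> push ` fsub (V \<times> V')" by (rule push_surj) auto
  qed (auto simp: push_fsub)
  then have "T.tcos ` push ` fsub (V \<times> V') = carrier (tensor_module M M')"
    by (simp only: T.carrier_tensor)
  then show ?thesis
    by (simp only: tcls_def[abs_def] image_image)
qed

lemma tcls_add: "tcls (p + q) = tcls p \<oplus>\<^bsub>tensor_module M M'\<^esub> tcls q"
  by (simp add: tcls_def T.add_tensor lin_add[OF lin_push])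

lemma tcls_smul: "tcls (smul a p) = a \<odot>\<^bsub>tensor_module M M'\<^esub> tcls p"
  by (simp add: tcls_def T.smult_tensor lin_scale[OF lin_push])

lemma tcls_eq_iff: "tcls p = tcls q \<longleftrightarrow> push (p - q) \<in> tnull M M'"
  by (simp add: tcls_def T.tcos_eq_iff lin_diff[OF lin_push])

end

lemma tensor_map_tcls:
  assumes A: "presentation2 V K \<pi> M V' K' \<pi>' M'" and B: "presentation2 W J \<rho> N W' J' \<rho>' N'"
    and f: "\<And>x. x \<in> carrier M \<Longrightarrow> f x \<in> carrier N"
      "\<And>x y. x \<in> carrier M \<Longrightarrow> y \<in> carrier M \<Longrightarrow> f (x \<oplus>\<^bsub>M\<^esub> y) = f x \<oplus>\<^bsub>N\<^esub> f y"
      "\<And>a x. x \<in> carrier M \<Longrightarrow> f (a \<odot>\<^bsub>M\<^esub> x) = a \<odot>\<^bsub>N\<^esub> f x"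
    and g: "\<And>x. x \<in> carrier M' \<Longrightarrow> g x \<in> carrier N'"
      "\<And>x y. x \<in> carrier M' \<Longrightarrow> y \<in> carrier M' \<Longrightarrow> g (x \<oplus>\<^bsub>M'\<^esub> y) = g x \<oplus>\<^bsub>N'\<^esub> g y"
      "\<And>a x. x \<in> carrier M' \<Longrightarrow> g (a \<odot>\<^bsub>M'\<^esub> x) = a \<odot>\<^bsub>N'\<^esub> g x"
    and fg: "\<And>x. x \<in> V \<Longrightarrow> f (\<pi> x) = \<rho> x" "\<And>y. y \<in> V' \<Longrightarrow> g (\<pi>' y) = \<rho>' y"
    and q: "q \<in> fsub (V \<times> V')"
  shows "tensor_map N N' f g (presentation2.tcls \<pi> M \<pi>' M' q) = presentation2.tcls \<rho> N \<rho>' N' q"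
proof -
  interpret A: presentation2 V K \<pi> M V' K' \<pi>' M' by (rule A)
  interpret B: presentation2 W J \<rho> N W' J' \<rho>' N' by (rule B)
  have "lext (\<lambda>(m, n). delta (f m, g n)) (A.push q) = B.push q"
    by (rule lin_eq_on[OF lin_comp[OF lin_lext A.lin_push] B.lin_push _ q])
      (auto simp: A.push_def B.push_def fg)
  then show ?thesis
    using tensor_map_tcos[OF A.T.tensor_setting_axioms B.T.tensor_setting_axioms f g, of "A.push q"]
    by (simp add: A.tcls_def B.tcls_def)
qed

lemma direct_sum_simps:
  "carrier (direct_sum I M) = {x \<in> \<Pi>\<^sub>E i\<in>I. carrier (M i). finite {i \<in> I. x i \<noteq> \<zero>\<^bsub>M i\<^esub>}}"
  "x \<oplus>\<^bsub>direct_sum I M\<^esub> y = (\<lambda>i\<in>I. x i \<oplus>\<^bsub>M i\<^esub> y i)"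
  "a \<odot>\<^bsub>direct_sum I M\<^esub> x = (\<lambda>i\<in>I. a \<odot>\<^bsub>M i\<^esub> x i)"
  by (simp_all add: direct_sum_def mk_module_def)

context eilenberg_zilber
begin

context
  fixes K :: "'a set set" and L :: "'b set set"
  assumes K: "sc_complex K" and L: "sc_complex L"
begin

interpretation A: presentation "cyc K (Suc i)" "bnd K (Suc i)" "cls id K i" "homology K i :: ('f, _) module" for i
  by (rule homology_presentation[OF inj_on_id K]) simp

interpretation B: presentation "cyc L (Suc j)" "bnd L (Suc j)" "cls id L j" "homology L j :: ('f, _) module" for j
  by (rule homology_presentation[OF inj_on_id L]) simp

interpretation AB: presentation2 "cyc K (Suc i)" "bnd K (Suc i)" "cls id K i" "homology K i :: ('f, _) module"
    "cyc L (Suc j)" "bnd L (Suc j)" "cls id L j" "homology L j :: ('f, _) module" for i j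
  by unfold_locales

lemma bilin_EZ: "bilin (cyc K m) (cyc L n) (\<lambda>x y. EZ (tens x y))"
  by (simp add: bilin_def tens_add_left tens_add_right tens_smul_left tens_smul_right
      lin_add[OF lin_EZ] lin_scale[OF lin_EZ])

text \<open>The cross product has exactly the bilinearity relations and the boundaries as its
  kernel. In one direction the test map of \<open>push_null_test\<close> is fed to
  \<open>cross_kernel\<close>; in the other the universal property is used modulo boundaries of the
  product.\<close>

lemma cross_bnd_iff:
  assumes t: "\<And>i. i \<le> k \<Longrightarrow> t i \<in> fsub (cyc K (Suc i) \<times> cyc L (Suc (k - i)))"
  shows "(\<Sum>i\<le>k. cross (t i)) \<in> bnd (prodc K L) (Suc k) \<longleftrightarrow>
    (\<forall>i\<le>k. AB.push i (k - i) (t i) \<in> tnull (homology K i) (homology L (k - i)))"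
proof (intro iffI allI impI)
  fix i assume b: "(\<Sum>i\<le>k. cross (t i)) \<in> bnd (prodc K L) (Suc k)" and i: "i \<le> k"
  obtain \<beta> :: "('a set \<Rightarrow>\<^sub>0 'f) \<Rightarrow> ('b set \<Rightarrow>\<^sub>0 'f) \<Rightarrow> (('a list \<Rightarrow> 'f) set \<times> ('b list \<Rightarrow> 'f) set \<Rightarrow>\<^sub>0 'f)"
    where \<beta>: "bilin (cyc K (Suc i)) (cyc L (Suc (k - i))) \<beta>"
    "\<And>x y. x \<in> bnd K (Suc i) \<Longrightarrow> y \<in> cyc L (Suc (k - i)) \<Longrightarrow> \<beta> x y = 0"
    "\<And>x y. x \<in> cyc K (Suc i) \<Longrightarrow> y \<in> bnd L (Suc (k - i)) \<Longrightarrow> \<beta> x y = 0"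
    "\<And>t. lext (\<lambda>(x, y). \<beta> x y) t = 0 \<Longrightarrow> AB.push i (k - i) t \<in> tnull (homology K i) (homology L (k - i))"
    using AB.push_null_test[of i "k - i"] by blast
  show "AB.push i (k - i) (t i) \<in> tnull (homology K i) (homology L (k - i))"
    by (rule \<beta>(4)[OF cross_kernel[OF K L t b i \<beta>(1-3)]])
next
  assume *: "\<forall>i\<le>k. AB.push i (k - i) (t i) \<in> tnull (homology K i) (homology L (k - i))"
  show "(\<Sum>i\<le>k. cross (t i)) \<in> bnd (prodc K L) (Suc k)"
  proof (rule fv.subspace_sum[OF subspace_bnd])
    fix i assume "i \<in> {..k}"
    then have i: "i \<le> k" by simp
    have "lext (\<lambda>(x, y). EZ (tens x y)) (t i) \<in> bnd (prodc K L) (Suc k)"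
    proof (rule AB.push_null_imp[OF subspace_bnd bilin_EZ _ _ t[OF i]])
      show "EZ (tens x y) \<in> bnd (prodc K L) (Suc k)"
        if "x \<in> bnd K (Suc i)" "y \<in> cyc L (Suc (k - i))" for x y
        using EZ_tens_bnd(1)[OF K L that] i by simp
      show "EZ (tens x y) \<in> bnd (prodc K L) (Suc k)"
        if "x \<in> cyc K (Suc i)" "y \<in> bnd L (Suc (k - i))" for x y
        using EZ_tens_bnd(2)[OF K L that] i by simp
    qed (use * i in auto)
    then show "cross (t i) \<in> bnd (prodc K L) (Suc k)" by (simp only: cross_def)
  qed
qed

end

end

lemma homology_incl_linear:
  fixes K L :: "'a set set"
  assumes K: "sc_complex K" and L: "sc_complex L" and KL: "K \<subseteq> L"
  shows "x \<in> carrier (homology K k :: ('f::field, _) module) \<Longrightarrow> homology_incl L k x \<in> carrier (homology L k)"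
    and "x \<in> carrier (homology K k :: ('f, _) module) \<Longrightarrow> y \<in> carrier (homology K k) \<Longrightarrow>
      homology_incl L k (x \<oplus>\<^bsub>homology K k\<^esub> y) = homology_incl L k x \<oplus>\<^bsub>homology L k\<^esub> homology_incl L k y"
    and "x \<in> carrier (homology K k :: ('f, _) module) \<Longrightarrow>
      homology_incl L k (a \<odot>\<^bsub>homology K k\<^esub> x) = a \<odot>\<^bsub>homology L k\<^esub> homology_incl L k x"
proof -
  interpret A: presentation "cyc K (Suc k)" "bnd K (Suc k)" "cls id K k" "homology K k :: ('f, _) module"
    by (rule homology_presentation[OF inj_on_id K]) simp
  interpret B: presentation "cyc L (Suc k)" "bnd L (Suc k)" "cls id L k" "homology L k :: ('f, _) module"
    by (rule homology_presentation[OF inj_on_id L]) simp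
  note incl = homology_incl_cls[OF inj_on_id K L KL, of k]
  have sub: "p \<in> cyc K (Suc k) \<Longrightarrow> p \<in> cyc L (Suc k)" for p :: "'a set \<Rightarrow>\<^sub>0 'f"
    using cyc_mono[OF KL] by blast
  show "homology_incl L k x \<in> carrier (homology L k)" if "x \<in> carrier (homology K k :: ('f, _) module)" for x
    using that A.rep[of x] B.\<pi>_carrier[OF sub, of "A.rep x"] by (metis incl)
  show "homology_incl L k (x \<oplus>\<^bsub>homology K k\<^esub> y) = homology_incl L k x \<oplus>\<^bsub>homology L k\<^esub> homology_incl L k y"
    if "x \<in> carrier (homology K k :: ('f, _) module)" "y \<in> carrier (homology K k)" for x y
    using A.rep[OF that(1)] A.rep[OF that(2)] A.\<pi>_add[of "A.rep x" "A.rep y"]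
      B.\<pi>_add[OF sub sub, of "A.rep x" "A.rep y"] by (metis incl)
  show "homology_incl L k (a \<odot>\<^bsub>homology K k\<^esub> x) = a \<odot>\<^bsub>homology L k\<^esub> homology_incl L k x"
    if "x \<in> carrier (homology K k :: ('f, _) module)" for x
    using A.rep[OF that] A.\<pi>_smul[of "A.rep x" a] B.\<pi>_smul[OF sub, of "A.rep x" a] by (metis incl)
qed

lemma Kuenneth_VR:
  fixes X :: "'a metric" and Y :: "'b metric" and F :: "'f::field itself"
  shows "PH F (linf_product X Y) \<cong>\<^sub>P\<^sub>M PH F X \<otimes>\<^sub>P\<^sub>M PH F Y"
proof (rule eilenberg_zilber_exists)
  fix EZ :: "('a set \<times> 'b set \<Rightarrow>\<^sub>0 'f) \<Rightarrow> (('a \<times> 'b) set \<Rightarrow>\<^sub>0 'f)" and AW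
  assume "eilenberg_zilber EZ AW"
  then interpret eilenberg_zilber EZ AW .
  let ?K = "\<lambda>r. VR r X" and ?L = "\<lambda>r. VR r Y" and ?KL = "\<lambda>r. VR r (linf_product X Y)"
  \<comment> \<open>One formal combination of pairs of cycles for each bidegree. Values of
    \<open>t\<close> beyond \<open>k\<close> are unconstrained, but \<open>\<pi>\<close> and
    \<open>g\<close> read only indices up to \<open>k\<close>.\<close>
  define V :: "nat \<Rightarrow> real \<Rightarrow> (nat \<Rightarrow> ('a set \<Rightarrow>\<^sub>0 'f) \<times> ('b set \<Rightarrow>\<^sub>0 'f) \<Rightarrow>\<^sub>0 'f) set"
    where "V k r = {t. \<forall>i\<le>k. t i \<in> fsub (cyc (?K r) (Suc i) \<times> cyc (?L r) (Suc (k - i)))}" for k r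
  let ?I = "\<lambda>k. {(i, j). i + j = (k :: nat)}"
  let ?HX = "\<lambda>i r. homology (?K r) i :: ('f, ('a list \<Rightarrow> 'f) set) module"
  let ?HY = "\<lambda>j r. homology (?L r) j :: ('f, ('b list \<Rightarrow> 'f) set) module"
  define \<pi> where "\<pi> k r t = cls id (?KL r) k (\<Sum>i\<le>k. cross (t i))"
    for k r and t :: "nat \<Rightarrow> (('a set \<Rightarrow>\<^sub>0 'f) \<times> ('b set \<Rightarrow>\<^sub>0 'f) \<Rightarrow>\<^sub>0 'f)"
  let ?T = "\<lambda>i j r. presentation2.tcls (cls id (?K r) i) (?HX i r) (cls id (?L r) j) (?HY j r)"
  define g where "g k r t = (\<lambda>(i, j)\<in>?I k. ?T i j r (t i))"
    for k r and t :: "nat \<Rightarrow> (('a set \<Rightarrow>\<^sub>0 'f) \<times> ('b set \<Rightarrow>\<^sub>0 'f) \<Rightarrow>\<^sub>0 'f)"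
  have VD: "t i \<in> fsub (cyc (?K r) (Suc i) \<times> cyc (?L r) (Suc j))" if "t \<in> V k r" "i + j = k" for t k r i j
  proof -
    have i: "i \<le> k" "k - i = j" using that(2) by auto
    have "t i \<in> fsub (cyc (?K r) (Suc i) \<times> cyc (?L r) (Suc (k - i)))"
      using that(1) i(1) by (simp add: V_def)
    then show ?thesis by (simp only: i(2))
  qed
  have PKL: "presentation (cyc (?KL r) (Suc k)) (bnd (?KL r) (Suc k)) (cls id (?KL r) k) (homology (?KL r) k :: ('f, _) module)"
    for r k by (rule homology_presentation[OF inj_on_id complex_VR]) simp
  have PX: "presentation (cyc (?K r) (Suc k)) (bnd (?K r) (Suc k)) (cls id (?K r) k) (?HX k r)" for r k
    by (rule homology_presentation[OF inj_on_id complex_VR]) simp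
  have PY: "presentation (cyc (?L r) (Suc k)) (bnd (?L r) (Suc k)) (cls id (?L r) k) (?HY k r)" for r k
    by (rule homology_presentation[OF inj_on_id complex_VR]) simp
  have P2: "presentation2 (cyc (?K r) (Suc i)) (bnd (?K r) (Suc i)) (cls id (?K r) i) (?HX i r)
      (cyc (?L r) (Suc j)) (bnd (?L r) (Suc j)) (cls id (?L r) j) (?HY j r)" for i j r
    by (intro presentation2.intro PX PY)
  have sum_cyc: "(\<Sum>i\<le>k. cross (t i)) \<in> cyc (?KL r) (Suc k)" if "t \<in> V k r" for k r t
  proof (rule fv.subspace_sum[OF subspace_cyc])
    fix i assume "i \<in> {..k}"
    then show "cross (t i) \<in> cyc (?KL r) (Suc k)"
      using cross_cyc[OF complex_VR complex_VR, of "t i" r X i r Y "k - i"] that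
      by (simp add: V_def VR_linf_product)
  qed
  \<comment> \<open>A finite index set makes the finite-support condition of
    \<open>direct_sum\<close> automatic.\<close>
  have I: "finite (?I k)" for k
    by (rule finite_subset[of _ "{..k} \<times> {..k}"]) auto
  have diff: "(\<lambda>i. x i - y i) \<in> V k r" if "x \<in> V k r" "y \<in> V k r" for x y k r
    using that by (auto simp: V_def intro!: fsub_diff)
  have eq: "\<pi> k r x = \<pi> k r y \<longleftrightarrow> g k r x = g k r y" if xy: "x \<in> V k r" "y \<in> V k r" for k r x y
  proof -
    let ?d = "\<lambda>i. x i - y i"
    have "\<pi> k r x = \<pi> k r y \<longleftrightarrow> (\<Sum>i\<le>k. cross (?d i)) \<in> bnd (prodc (?K r) (?L r)) (Suc k)"
      unfolding \<pi>_def presentation.\<pi>_eq[OF PKL sum_cyc[OF xy(1)] sum_cyc[OF xy(2)]]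
      by (simp add: VR_linf_product sum_subtractf lin_diff[OF lin_cross])
    also have "\<dots> \<longleftrightarrow> (\<forall>i\<le>k. presentation2.push (cls id (?K r) i) (cls id (?L r) (k - i)) (?d i)
        \<in> tnull (?HX i r) (?HY (k - i) r))"
      using diff[OF xy] by (intro cross_bnd_iff[OF complex_VR complex_VR]) (auto simp: V_def)
    also have "\<dots> \<longleftrightarrow> (\<forall>i\<le>k. ?T i (k - i) r (x i) = ?T i (k - i) r (y i))"
      by (simp add: presentation2.tcls_eq_iff[OF P2])
    also have "\<dots> \<longleftrightarrow> g k r x = g k r y"
    proof
      assume *: "\<forall>i\<le>k. ?T i (k - i) r (x i) = ?T i (k - i) r (y i)"
      have "?T i j r (x i) = ?T i j r (y i)" if "i + j = k" for i j
        using *[rule_format, of i] that by auto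
      then show "g k r x = g k r y"
        unfolding g_def by (intro restrict_ext) auto
    next
      assume *: "g k r x = g k r y"
      have "?T i (k - i) r (x i) = ?T i (k - i) r (y i)" if "i \<le> k" for i
        using fun_cong[OF *, of "(i, k - i)"] that by (simp add: g_def)
      then show "\<forall>i\<le>k. ?T i (k - i) r (x i) = ?T i (k - i) r (y i)" by blast
    qed
    finally show ?thesis .
  qed
  show ?thesis
  proof (rule pm_isomorphic_cover[where V = V and \<pi> = \<pi> and g = g])
    fix k and r :: real assume "0 < r"
    show "\<pi> k r ` V k r = carrier (pm_obj (PH F (linf_product X Y)) k r)"
    proof (rule subset_antisym; rule subsetI)
      fix m assume "m \<in> \<pi> k r ` V k r"
      then show "m \<in> carrier (pm_obj (PH F (linf_product X Y)) k r)"
        using presentation.\<pi>_carrier[OF PKL sum_cyc] by (auto simp: PH_def \<pi>_def)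
    next
      fix m assume "m \<in> carrier (pm_obj (PH F (linf_product X Y)) k r)"
      then have "m \<in> cls id (?KL r) k ` cyc (?KL r) (Suc k)"
        by (simp add: PH_def presentation.\<pi>_surj[OF PKL])
      then obtain p where p: "p \<in> cyc (?KL r) (Suc k)" "m = cls id (?KL r) k p" by blast
      then obtain t where t: "\<forall>i\<le>k. t i \<in> fsub (cyc (?K r) (Suc i) \<times> cyc (?L r) (Suc (k - i)))"
        "p - (\<Sum>i\<le>k. cross (t i)) \<in> bnd (?KL r) (Suc k)"
        using cross_surj[OF complex_VR complex_VR, of p r X r Y k] unfolding VR_linf_product by blast
      have tV: "t \<in> V k r" using t(1) by (simp add: V_def)
      have "m = \<pi> k r t"
        unfolding p(2) \<pi>_def presentation.\<pi>_eq[OF PKL p(1) sum_cyc[OF tV]] by (rule t(2))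
      then show "m \<in> \<pi> k r ` V k r" using tV by blast
    qed
    show "g k r ` V k r = carrier (pm_obj (PH F X \<otimes>\<^sub>P\<^sub>M PH F Y) k r)"
    proof (rule subset_antisym; rule subsetI)
      fix m assume "m \<in> g k r ` V k r"
      then obtain t where t: "t \<in> V k r" "m = g k r t" by blast
      have "?T i j r (t i) \<in> carrier (tensor_module (?HX i r) (?HY j r))" if ij: "i + j = k" for i j
      proof -
        have "t i \<in> fsub (cyc (?K r) (Suc i) \<times> cyc (?L r) (Suc j))"
          by (rule VD[OF t(1) ij])
        then show ?thesis unfolding presentation2.tcls_image[OF P2, symmetric] by (rule imageI)
      qed
      then show "m \<in> carrier (pm_obj (PH F X \<otimes>\<^sub>P\<^sub>M PH F Y) k r)"
        unfolding t(2) using I[of k] by (auto simp: pm_tensor_def PH_def direct_sum_simps g_def)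
    next
      fix m assume "m \<in> carrier (pm_obj (PH F X \<otimes>\<^sub>P\<^sub>M PH F Y) k r)"
      then have m: "m \<in> (\<Pi>\<^sub>E (i, j)\<in>?I k. carrier (tensor_module (?HX i r) (?HY j r)))"
        by (simp add: pm_tensor_def PH_def direct_sum_simps case_prod_unfold)
      have "\<forall>i\<in>{..k}. \<exists>q. q \<in> fsub (cyc (?K r) (Suc i) \<times> cyc (?L r) (Suc (k - i))) \<and> m (i, k - i) = ?T i (k - i) r q"
      proof
        fix i assume "i \<in> {..k}"
        then have "m (i, k - i) \<in> carrier (tensor_module (?HX i r) (?HY (k - i) r))"
          using PiE_mem[OF m, of "(i, k - i)"] by simp
        then show "\<exists>q. q \<in> fsub (cyc (?K r) (Suc i) \<times> cyc (?L r) (Suc (k - i))) \<and> m (i, k - i) = ?T i (k - i) r q"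
          unfolding presentation2.tcls_image[OF P2, symmetric] by blast
      qed
      from bchoice[OF this] obtain t where t: "\<And>i. i \<le> k \<Longrightarrow> t i \<in> fsub (cyc (?K r) (Suc i) \<times> cyc (?L r) (Suc (k - i)))"
        "\<And>i. i \<le> k \<Longrightarrow> m (i, k - i) = ?T i (k - i) r (t i)" by auto
      have "m = g k r t"
      proof (rule ext)
        fix b :: "nat \<times> nat"
        obtain i j where b: "b = (i, j)" by (cases b)
        show "m b = g k r t b"
        proof (cases "i + j = k")
          case True
          then show ?thesis using t(2)[of i] by (auto simp: b g_def)
        next
          case False
          then show ?thesis using PiE_arb[OF m, of b] by (simp add: b g_def)
        qed
      qed
      moreover have "t \<in> V k r" using t(1) by (simp add: V_def)
      ultimately show "m \<in> g k r ` V k r" by blast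
    qed
    show "\<pi> k r x = \<pi> k r y \<longleftrightarrow> g k r x = g k r y" if "x \<in> V k r" "y \<in> V k r" for x y
      by (rule eq[OF that])
    show "\<exists>z\<in>V k r. \<pi> k r z = \<pi> k r x \<oplus>\<^bsub>pm_obj (PH F (linf_product X Y)) k r\<^esub> \<pi> k r y \<and>
        g k r z = g k r x \<oplus>\<^bsub>pm_obj (PH F X \<otimes>\<^sub>P\<^sub>M PH F Y) k r\<^esub> g k r y" if "x \<in> V k r" "y \<in> V k r" for x y
    proof (intro bexI conjI)
      show "(\<lambda>i. x i + y i) \<in> V k r" using that by (auto simp: V_def intro!: fsub_add)
      show "\<pi> k r (\<lambda>i. x i + y i) = \<pi> k r x \<oplus>\<^bsub>pm_obj (PH F (linf_product X Y)) k r\<^esub> \<pi> k r y"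
        using presentation.\<pi>_add[OF PKL sum_cyc[OF that(1)] sum_cyc[OF that(2)]]
        by (simp add: \<pi>_def PH_def lin_add[OF lin_cross] sum.distrib)
      show "g k r (\<lambda>i. x i + y i) = g k r x \<oplus>\<^bsub>pm_obj (PH F X \<otimes>\<^sub>P\<^sub>M PH F Y) k r\<^esub> g k r y"
        by (auto simp: g_def pm_tensor_def PH_def direct_sum_simps presentation2.tcls_add[OF P2] intro!: restrict_ext)
    qed
    show "\<exists>z\<in>V k r. \<pi> k r z = a \<odot>\<^bsub>pm_obj (PH F (linf_product X Y)) k r\<^esub> \<pi> k r x \<and>
        g k r z = a \<odot>\<^bsub>pm_obj (PH F X \<otimes>\<^sub>P\<^sub>M PH F Y) k r\<^esub> g k r x" if "x \<in> V k r" for a x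
    proof (intro bexI conjI)
      show "(\<lambda>i. smul a (x i)) \<in> V k r" using that by (auto simp: V_def intro!: fsub_smul)
      show "\<pi> k r (\<lambda>i. smul a (x i)) = a \<odot>\<^bsub>pm_obj (PH F (linf_product X Y)) k r\<^esub> \<pi> k r x"
        using presentation.\<pi>_smul[OF PKL sum_cyc[OF that], of a]
        by (simp add: \<pi>_def PH_def lin_scale[OF lin_cross] fv.scale_sum_right)
      show "g k r (\<lambda>i. smul a (x i)) = a \<odot>\<^bsub>pm_obj (PH F X \<otimes>\<^sub>P\<^sub>M PH F Y) k r\<^esub> g k r x"
        by (auto simp: g_def pm_tensor_def PH_def direct_sum_simps presentation2.tcls_smul[OF P2] intro!: restrict_ext)
    qed
    fix s assume rs: "r \<le> s"
    note mX = VR_mono[OF rs, of X] and mY = VR_mono[OF rs, of Y]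
    have sub: "cyc (?K r) m \<times> cyc (?L r) n \<subseteq> cyc (?K s) m \<times> cyc (?L s) n" for m n
      using cyc_mono[OF mX] cyc_mono[OF mY] by blast
    show "V k r \<subseteq> V k s"
      using fsub_mono[OF _ sub] by (auto simp: V_def)
    \<comment> \<open>\<open>EZ\<close> is the same at every parameter, so the representing cycle is
      unchanged and only its class is taken in a larger complex.\<close>
    show "pm_map (PH F (linf_product X Y)) k r s (\<pi> k r x) = \<pi> k s x" for x
      by (simp add: PH_def \<pi>_def homology_incl_cls[OF inj_on_id complex_VR complex_VR VR_mono[OF rs]])
    show "pm_map (PH F X \<otimes>\<^sub>P\<^sub>M PH F Y) k r s (g k r x) = g k s x" if x: "x \<in> V k r" for x
    proof -
      have "tensor_map (?HX i s) (?HY j s) (homology_incl (?K s) i) (homology_incl (?L s) j) (?T i j r (x i)) = ?T i j s (x i)"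
        if ij: "i + j = k" for i j
      proof (rule tensor_map_tcls[OF P2 P2 homology_incl_linear[OF complex_VR complex_VR mX] homology_incl_linear[OF complex_VR complex_VR mY]])
        show "x i \<in> fsub (cyc (?K r) (Suc i) \<times> cyc (?L r) (Suc j))"
          by (rule VD[OF x ij])
      qed (simp_all add: homology_incl_cls[OF inj_on_id complex_VR complex_VR] mX mY)
      then show ?thesis
        by (auto simp: pm_tensor_def PH_def g_def intro!: restrict_ext)
    qed
  qed
qed


section \<open>Gluing along a point\<close>

text \<open>The simplices of \<open>C\<close> that belong neither to \<open>A\<close> nor to \<open>B\<close> remain simplices after adding the
  common vertex \<open>v\<close>, so that coning with apex \<open>v\<close> removes them from cycles.\<close>

locale wedge =
  fixes A B C :: "'c set set" and v :: 'c
  assumes A: "sc_complex A" and B: "sc_complex B" and C: "sc_complex C"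
    and AC: "A \<subseteq> C" and BC: "B \<subseteq> C"
    and Int: "\<sigma> \<in> A \<Longrightarrow> \<sigma> \<in> B \<Longrightarrow> \<sigma> = {v}"
    and vA: "{v} \<in> A" and vB: "{v} \<in> B"
    and mixed: "\<sigma> \<in> C \<Longrightarrow> \<sigma> \<notin> A \<Longrightarrow> \<sigma> \<notin> B \<Longrightarrow> insert v \<sigma> \<in> C"
    and coneA: "\<sigma> \<in> A \<Longrightarrow> insert v \<sigma> \<in> C \<Longrightarrow> insert v \<sigma> \<in> A"
    and coneB: "\<sigma> \<in> B \<Longrightarrow> insert v \<sigma> \<in> C \<Longrightarrow> insert v \<sigma> \<in> B"
begin

abbreviation "AB \<equiv> A \<union> B"

lemma abd_restr_mixed:
  assumes "p \<in> csub AB n"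
  shows "restr (C - AB) (abd p) = 0"
proof -
  have "abd p \<in> fsub (AB \<union> {{}})"
  proof (rule abd_fsub[OF assms[unfolded csub_def]])
    fix \<sigma> w assume "\<sigma> \<in> {\<sigma> \<in> AB. card \<sigma> = n}"
    then show "\<sigma> - {w} \<in> AB \<union> {{}}"
      using complexD[OF A, of \<sigma> "\<sigma> - {w}"] complexD[OF B, of \<sigma> "\<sigma> - {w}"] by blast
  qed
  then have "restr (C - AB) (abd p) \<in> fsub ((AB \<union> {{}}) \<inter> (C - AB))"
    by (rule restr_fsub')
  moreover have "(AB \<union> {{}}) \<inter> (C - AB) = {}"
    using complex_finite[OF C] by auto
  ultimately show ?thesis by (simp add: fsub_empty_iff)
qed

text \<open>If \<open>m\<close> is the mixed part of \<open>w\<close>, subtracting the boundary of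
  its cone replaces \<open>m\<close> by the cone over \<open>abd m\<close>. By hypothesis the mixed
  faces cancel in \<open>abd m\<close>, and an unmixed face stays on its side when the apex is
  added. The condition covers cycles as well as chains with unmixed boundary; the first case yields
  surjectivity, the second injectivity.\<close>

lemma homologous_unmixed:
  fixes w :: "'c set \<Rightarrow>\<^sub>0 'f::field"
  assumes w: "w \<in> csub C (Suc n)" and bw: "restr (C - AB) (abd w) = 0"
  shows "\<exists>y\<in>csub C (Suc (Suc n)). w - abd y \<in> csub AB (Suc n)"
proof -
  let ?M = "C - AB"
  define m where "m = restr ?M w"
  have "w \<in> fsub {\<sigma> \<in> C. card \<sigma> = Suc n}" using w by (simp add: csub_def)
  then have m: "m \<in> fsub {\<sigma> \<in> ?M. card \<sigma> = Suc n}"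
    unfolding m_def by (rule restr_fsub'[THEN fsub_mono]) auto
  have wm: "w - m \<in> csub AB (Suc n)"
    unfolding csub_def
  proof (rule fsubI)
    fix \<sigma> assume "lookup (w - m) \<sigma> \<noteq> 0"
    then have "lookup w \<sigma> \<noteq> 0" "\<sigma> \<notin> ?M"
      by (auto simp: m_def lookup_minus lookup_restr split: if_splits)
    then show "\<sigma> \<in> {\<sigma> \<in> AB. card \<sigma> = Suc n}"
      using w by (auto simp: csub_def dest: fsubD)
  qed
  have "abd w = abd m + abd (w - m)" by (simp add: lin_diff[OF lin_abd])
  then have bm0: "restr ?M (abd m) = 0"
    using bw abd_restr_mixed[OF wm] by (simp add: lin_add[OF lin_restr])
  have fin: "m \<in> fsub {\<sigma>. finite \<sigma>}"
    using m by (rule fsub_mono) (use complex_finite[OF C] in auto)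
  \<comment> \<open>Adding the apex to a face of a mixed simplex gives a simplex of
    \<open>C\<close>, because it is a face of the coned mixed simplex. The empty face can occur when
    \<open>n = 0\<close>.\<close>
  let ?F = "{\<tau>. card \<tau> = n \<and> finite \<tau> \<and> (\<tau> = {} \<or> \<tau> \<in> C) \<and> (\<tau> \<noteq> {} \<longrightarrow> insert v \<tau> \<in> C)}"
  have "abd m \<in> fsub ?F"
  proof (rule abd_fsub[OF m])
    fix \<sigma> u assume s: "\<sigma> \<in> {\<sigma> \<in> ?M. card \<sigma> = Suc n}" "finite \<sigma>" "u \<in> \<sigma>"
    have "insert v (\<sigma> - {u}) \<subseteq> insert v \<sigma>" by blast
    then have "insert v (\<sigma> - {u}) \<in> C"
      using s(1) complexD[OF C mixed[of \<sigma>], of "insert v (\<sigma> - {u})"] by auto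
    moreover have "\<sigma> - {u} = {} \<or> \<sigma> - {u} \<in> C"
      using s(1) complexD[OF C, of \<sigma> "\<sigma> - {u}"] by auto
    ultimately show "\<sigma> - {u} \<in> ?F" using s by simp
  qed
  then have "abd m \<in> fsub (?F - ?M)"
    using bm0 by (auto simp: poly_mapping_eq_iff fun_eq_iff lookup_restr intro!: fsubI dest: fsubD)
      (metis lookup_restr lookup_zero)
  then have sm: "scone v (abd m) \<in> csub AB (Suc n)"
    unfolding csub_def
  proof (rule scone_fsub)
    fix \<tau> assume t: "\<tau> \<in> ?F - ?M" "v \<notin> \<tau>"
    have "insert v \<tau> \<in> AB"
    proof (cases "\<tau> = {}")
      case True then show ?thesis using vA by simp
    next
      case False
      then have "\<tau> \<in> A \<or> \<tau> \<in> B" "insert v \<tau> \<in> C" using t(1) by auto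
      then show ?thesis using coneA coneB by blast
    qed
    then show "insert v \<tau> \<in> {\<sigma> \<in> AB. card \<sigma> = Suc n}" using t by simp
  qed
  have "w - abd (scone v m) = (w - m) + scone v (abd m)"
    using abd_scone[OF fin, of v] by (simp add: algebra_simps)
  then have "w - abd (scone v m) \<in> csub AB (Suc n)"
    using fv.subspace_add[OF subspace_csub wm sm] by (simp only:)
  moreover have "scone v m \<in> csub C (Suc (Suc n))"
    unfolding csub_def by (rule scone_fsub[OF m]) (auto intro: mixed)
  ultimately show ?thesis by blast
qed

lemma csub_AB_split:
  assumes "p \<in> csub AB n"
  obtains x y where "x \<in> csub A n" "y \<in> csub B n" "p = x + y"
proof
  have p: "p \<in> fsub {\<sigma> \<in> AB. card \<sigma> = n}" using assms by (simp add: csub_def)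
  show "restr A p \<in> csub A n"
    unfolding csub_def by (rule fsub_mono[OF restr_fsub'[OF p]]) auto
  show "restr (- A) p \<in> csub B n"
    unfolding csub_def by (rule fsub_mono[OF restr_fsub'[OF p]]) auto
  show "p = restr A p + restr (- A) p" by (rule restr_split)
qed

lemma csub_Int:
  assumes "p \<in> csub A n" "p \<in> csub B n"
  shows "p = smul (lookup p {v}) (delta {v})"
proof -
  have "p \<in> fsub {{v}}"
  proof (rule fsubI)
    fix \<sigma> assume "lookup p \<sigma> \<noteq> 0"
    then have "\<sigma> \<in> A" "\<sigma> \<in> B" using assms by (auto simp: csub_def dest: fsubD)
    then show "\<sigma> \<in> {{v}}" using Int by blast
  qed
  then show ?thesis by (simp only: fsub_singleton)
qed

text \<open>\<open>point v\<close> is some multiple of \<open>delta {v}\<close> and has boundary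
  \<open>delta {}\<close>, so the boundary of \<open>delta {v}\<close> cannot vanish; its
  coefficient need not be computed.\<close>

lemma abd_vertex_nonzero: "abd (smul a (delta {v})) = (0 :: 'c set \<Rightarrow>\<^sub>0 'f::field) \<Longrightarrow> a = 0"
proof -
  assume a: "abd (smul a (delta {v})) = (0 :: 'c set \<Rightarrow>\<^sub>0 'f)"
  obtain c :: 'f where c: "point v = smul c (delta {v})"
    using point_fsub[of v] by (simp only: fsub_singleton) blast
  have "smul a (delta {}) = smul a (abd (smul c (delta {v})) :: 'c set \<Rightarrow>\<^sub>0 'f)"
    by (simp add: c[symmetric] abd_point)
  also have "\<dots> = smul c (abd (smul a (delta {v})))"
    by (simp add: lin_scale[OF lin_abd] mult.commute)
  finally have "smul a (delta {}) = (0 :: 'c set \<Rightarrow>\<^sub>0 'f)" using a by simp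
  then show "a = 0" by (simp add: delta_nonzero)
qed

text \<open>After the cycle is moved into the union and cut into \<open>x + y\<close>, the
  boundaries of the two halves are opposite and lie on both sides. In positive degree they are then
  a multiple of the base point, and a cycle for the augmented boundary, hence zero.\<close>

lemma rcyc_split:
  fixes z :: "'c set \<Rightarrow>\<^sub>0 'f::field"
  assumes z: "z \<in> rcyc C (Suc k)"
  shows "\<exists>x\<in>rcyc A (Suc k). \<exists>y\<in>rcyc B (Suc k). z - (x + y) \<in> bnd C (Suc k)"
proof -
  have zc: "z \<in> csub C (Suc k)" "abd z = 0" using z by (auto simp: rcyc_def)
  obtain u where u: "u \<in> csub C (Suc (Suc k))" "z - abd u \<in> csub AB (Suc k)"
    using homologous_unmixed[OF zc(1)] zc(2) by (auto simp: lin_0[OF lin_restr])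
  obtain x y where xy: "x \<in> csub A (Suc k)" "y \<in> csub B (Suc k)" "z - abd u = x + y"
    using csub_AB_split[OF u(2)] by blast
  have sum0: "abd x + abd y = 0"
    using zc(2) by (simp add: lin_add[OF lin_abd, symmetric] xy(3)[symmetric] lin_diff[OF lin_abd] abd_abd)
  \<comment> \<open>In degree 0 the halves may have opposite nonzero augmentations. A multiple of
    the base point, which lies on both sides, is moved from \<open>x\<close> to \<open>y\<close> to
    correct this.\<close>
  have "\<exists>a. abd (x - smul a (point v)) = 0 \<and> abd (y + smul a (point v)) = 0 \<and>
    (a = 0 \<or> k = 0)"
  proof (cases k)
    case 0
    have "abd x \<in> fsub {{}}"
      by (rule abd_fsub[OF xy(1)[unfolded csub_def]]) (auto simp: 0 card_Suc_eq)
    then obtain a where "abd x = smul a (delta {})" by (simp only: fsub_singleton)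
    moreover from this have "abd y = - smul a (delta {})" using sum0 by (simp add: add_eq_0_iff)
    ultimately show ?thesis
      by (intro exI[of _ a]) (simp add: 0 lin_diff[OF lin_abd] lin_add[OF lin_abd] lin_scale[OF lin_abd] abd_point)
  next
    case (Suc k')
    have faces: "abd p \<in> csub K (Suc k')" if "sc_complex K" "p \<in> csub K (Suc k)" for K and p :: "'c set \<Rightarrow>\<^sub>0 'f"
      using bd_csub[OF that(1), of p "Suc k'"] that(2) Suc by (simp add: bd_csub_eq_abd)
    have "abd x = - abd y" using sum0 by (simp add: add_eq_0_iff2)
    then have "abd x \<in> csub B (Suc k')"
      using fv.subspace_neg[OF subspace_csub faces[OF B xy(2)]] by simp
    from csub_Int[OF faces[OF A xy(1)] this] obtain a where a: "abd x = smul a (delta {v})" by blast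
    then have "a = 0" using abd_vertex_nonzero[of a] abd_abd[of x] by simp
    then show ?thesis using a sum0 by (intro exI[of _ 0]) simp
  qed
  then obtain a where a: "abd (x - smul a (point v)) = 0" "abd (y + smul a (point v)) = 0" "a = 0 \<or> k = 0" by blast
  have pt: "smul a (point v) \<in> csub K (Suc k)" if "{v} \<in> K" for K
  proof -
    have "point v \<in> csub K (Suc 0)"
      unfolding csub_def by (rule fsub_mono[OF point_fsub]) (use that in auto)
    then show ?thesis using a(3) by (auto simp: fv.subspace_0[OF subspace_csub] intro: fv.subspace_scale[OF subspace_csub])
  qed
  have "x - smul a (point v) \<in> rcyc A (Suc k)" "y + smul a (point v) \<in> rcyc B (Suc k)"
    using a(1,2) fv.subspace_diff[OF subspace_csub xy(1) pt[OF vA]] fv.subspace_add[OF subspace_csub xy(2) pt[OF vB]]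
    by (simp_all add: rcyc_def)
  moreover have "z - ((x - smul a (point v)) + (y + smul a (point v))) = abd u"
    using xy(3) by (simp add: algebra_simps)
  moreover have "abd u \<in> bnd C (Suc k)" using u(1) by (auto simp: bnd_abd)
  ultimately show ?thesis by metis
qed

text \<open>The Mayer-Vietoris argument for injectivity: a bounding chain is moved into the union
  and cut into \<open>a + b\<close>. Then \<open>x - abd a\<close> lies on both sides, so it is a
  multiple of the base point, and it vanishes because its augmented boundary does.\<close>

lemma bnd_sum_iff:
  fixes x y :: "'c set \<Rightarrow>\<^sub>0 'f::field"
  assumes x: "x \<in> rcyc A (Suc k)" and y: "y \<in> rcyc B (Suc k)"
  shows "x + y \<in> bnd C (Suc k) \<longleftrightarrow> x \<in> bnd A (Suc k) \<and> y \<in> bnd B (Suc k)"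
proof
  assume "x \<in> bnd A (Suc k) \<and> y \<in> bnd B (Suc k)"
  then show "x + y \<in> bnd C (Suc k)"
    using bnd_mono[OF AC] bnd_mono[OF BC] by (blast intro: fv.subspace_add[OF subspace_bnd])
next
  assume "x + y \<in> bnd C (Suc k)"
  then obtain w where w: "w \<in> csub C (Suc (Suc k))" "abd w = x + y" by (auto simp: bnd_abd)
  have xc: "x \<in> csub A (Suc k)" "abd x = 0" and yc: "y \<in> csub B (Suc k)" "abd y = 0"
    using x y by (auto simp: rcyc_def)
  have "restr (C - AB) (x + y) = 0"
  proof -
    have "x + y \<in> fsub AB"
      using xc(1) yc(1) by (intro fsub_add) (auto simp: csub_def elim!: fsub_mono)
    then have "restr (C - AB) (x + y) \<in> fsub (AB \<inter> (C - AB))" by (rule restr_fsub')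
    moreover have "AB \<inter> (C - AB) = {}" by blast
    ultimately show ?thesis by (simp only: fsub_empty_iff)
  qed
  then obtain u where u: "u \<in> csub C (Suc (Suc (Suc k)))" "w - abd u \<in> csub AB (Suc (Suc k))"
    using homologous_unmixed[OF w(1)] w(2) by auto
  obtain a b where ab: "a \<in> csub A (Suc (Suc k))" "b \<in> csub B (Suc (Suc k))" "w - abd u = a + b"
    using csub_AB_split[OF u(2)] by blast
  have "abd (w - abd u) = x + y" by (simp add: lin_diff[OF lin_abd] abd_abd w(2))
  then have e: "x - abd a = - (y - abd b)"
    by (simp add: ab(3) lin_add[OF lin_abd] algebra_simps)
  have faces: "abd p \<in> csub K (Suc k)" if "sc_complex K" "p \<in> csub K (Suc (Suc k))" for K and p :: "'c set \<Rightarrow>\<^sub>0 'f"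
    using bd_csub[OF that(1,2)] by (simp add: bd_csub_eq_abd[OF that(2)])
  have "x - abd a \<in> csub A (Suc k)" "y - abd b \<in> csub B (Suc k)"
    by (rule fv.subspace_diff[OF subspace_csub xc(1) faces[OF A ab(1)]]
        fv.subspace_diff[OF subspace_csub yc(1) faces[OF B ab(2)]])+
  moreover from this(2) have "x - abd a \<in> csub B (Suc k)"
    unfolding e by (rule fv.subspace_neg[OF subspace_csub])
  ultimately obtain c where c: "x - abd a = smul c (delta {v})" using csub_Int by blast
  have "abd (x - abd a) = 0" by (simp add: lin_diff[OF lin_abd] abd_abd xc(2))
  then have "c = 0" using abd_vertex_nonzero[of c] by (simp only: c)
  then have "x = abd a" "y = abd b" using c e by simp_all
  then show "x \<in> bnd A (Suc k) \<and> y \<in> bnd B (Suc k)"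
    using ab(1,2) by (auto simp: bnd_abd)
qed

end


section \<open>The Vietoris--Rips complex of a gluing\<close>

text \<open>The equivalence classes of \<open>Inl x\<close> and \<open>Inr y\<close>; outside the metric spaces the values are only
  chosen to make the maps injective.\<close>

definition glue_inl :: "'a \<Rightarrow> 'b \<Rightarrow> 'a \<Rightarrow> ('a + 'b) set" where
  "glue_inl p q x = (if x = p then {Inl p, Inr q} else {Inl x})"

definition glue_inr :: "'a \<Rightarrow> 'b \<Rightarrow> 'b \<Rightarrow> ('a + 'b) set" where
  "glue_inr p q y = (if y = q then {Inl p, Inr q} else {Inr y})"

lemma inj_glue_inl: "inj (glue_inl p q)" and inj_glue_inr: "inj (glue_inr p q)"
  by (auto simp: inj_def glue_inl_def glue_inr_def split: if_splits)

lemma glue_inl_mem: "Inl x \<in> glue_inl p q x" and glue_inr_mem: "Inr y \<in> glue_inr p q y"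
  by (auto simp: glue_inl_def glue_inr_def)

context
  fixes X :: "'a metric" and Y :: "'b metric" and p q
  assumes p: "p \<in> mspace X" and q: "q \<in> mspace Y"
begin

lemma glue_space_eq: "glue_space X p Y q = glue_inl p q ` mspace X \<union> glue_inr p q ` mspace Y"
proof -
  have 1: "glue_rel X p Y q `` {Inl x} = glue_inl p q x" if "x \<in> mspace X" for x
    using that p q by (auto simp: glue_rel_def glue_inl_def)
  have 2: "glue_rel X p Y q `` {Inr y} = glue_inr p q y" if "y \<in> mspace Y" for y
    using that p q by (auto simp: glue_rel_def glue_inr_def)
  have "glue_space X p Y q = (\<lambda>z. glue_rel X p Y q `` {z}) ` (Inl ` mspace X \<union> Inr ` mspace Y)"
    by (auto simp: glue_space_def quotient_def Plus_def)
  then show ?thesis by (simp add: image_Un image_image 1 2 cong: image_cong)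
qed

lemma mspace_glue: "mspace (metric_gluing X p Y q) = glue_inl p q ` mspace X \<union> glue_inr p q ` mspace Y"
  by (simp add: mspace_metric_gluing[OF p q] glue_space_eq)

lemma mdist_glue:
  "x \<in> mspace X \<Longrightarrow> x' \<in> mspace X \<Longrightarrow> mdist (metric_gluing X p Y q) (glue_inl p q x) (glue_inl p q x') = mdist X x x'"
  "y \<in> mspace Y \<Longrightarrow> y' \<in> mspace Y \<Longrightarrow> mdist (metric_gluing X p Y q) (glue_inr p q y) (glue_inr p q y') = mdist Y y y'"
  "x \<in> mspace X \<Longrightarrow> y \<in> mspace Y \<Longrightarrow>
    mdist (metric_gluing X p Y q) (glue_inl p q x) (glue_inr p q y) = mdist X x p + mdist Y y q"
  unfolding mdist_metric_gluing[OF p q]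
  by (subst glue_dist_eq[OF p q _ glue_inl_mem _ glue_inl_mem] glue_dist_eq[OF p q _ glue_inr_mem _ glue_inr_mem]
      glue_dist_eq[OF p q _ glue_inl_mem _ glue_inr_mem]; simp add: glue_space_eq)+

lemma glue_inl_inr_eq: "glue_inl p q x = glue_inr p q y \<longleftrightarrow> x = p \<and> y = q"
  by (auto simp: glue_inl_def glue_inr_def split: if_splits)

lemma glue_point: "glue_inr p q q = glue_inl p q p"
  by (simp add: glue_inl_def glue_inr_def)

text \<open>The embedding is isometric, so its image is the full subcomplex on the vertices of that
  side.\<close>

lemma VR_glue_inl_iff:
  "\<sigma> \<in> (`) (glue_inl p q) ` VR r X \<longleftrightarrow> \<sigma> \<in> VR r (metric_gluing X p Y q) \<and> \<sigma> \<subseteq> glue_inl p q ` mspace X"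
proof
  assume "\<sigma> \<in> (`) (glue_inl p q) ` VR r X"
  then obtain \<tau> where "\<tau> \<in> VR r X" "\<sigma> = glue_inl p q ` \<tau>" by blast
  then show "\<sigma> \<in> VR r (metric_gluing X p Y q) \<and> \<sigma> \<subseteq> glue_inl p q ` mspace X"
    by (auto simp: VR_iff mspace_glue mdist_glue subset_iff)
next
  assume s: "\<sigma> \<in> VR r (metric_gluing X p Y q) \<and> \<sigma> \<subseteq> glue_inl p q ` mspace X"
  then obtain \<tau> where t: "\<tau> \<subseteq> mspace X" "\<sigma> = glue_inl p q ` \<tau>" by (meson subset_imageE)
  have "finite (glue_inl p q ` \<tau>)" using s t(2) by (simp add: VR_iff)
  then have "finite \<tau>" by (rule finite_imageD) (rule inj_on_subset[OF inj_glue_inl subset_UNIV])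
  then have "\<tau> \<in> VR r X"
    using s t by (auto simp: VR_iff mdist_glue subset_iff)
  then show "\<sigma> \<in> (`) (glue_inl p q) ` VR r X" using t(2) by blast
qed

lemma VR_glue_inr_iff:
  "\<sigma> \<in> (`) (glue_inr p q) ` VR r Y \<longleftrightarrow> \<sigma> \<in> VR r (metric_gluing X p Y q) \<and> \<sigma> \<subseteq> glue_inr p q ` mspace Y"
proof
  assume "\<sigma> \<in> (`) (glue_inr p q) ` VR r Y"
  then obtain \<tau> where "\<tau> \<in> VR r Y" "\<sigma> = glue_inr p q ` \<tau>" by blast
  then show "\<sigma> \<in> VR r (metric_gluing X p Y q) \<and> \<sigma> \<subseteq> glue_inr p q ` mspace Y"
    by (auto simp: VR_iff mspace_glue mdist_glue subset_iff)
next
  assume s: "\<sigma> \<in> VR r (metric_gluing X p Y q) \<and> \<sigma> \<subseteq> glue_inr p q ` mspace Y"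
  then obtain \<tau> where t: "\<tau> \<subseteq> mspace Y" "\<sigma> = glue_inr p q ` \<tau>" by (meson subset_imageE)
  have "finite (glue_inr p q ` \<tau>)" using s t(2) by (simp add: VR_iff)
  then have "finite \<tau>" by (rule finite_imageD) (rule inj_on_subset[OF inj_glue_inr subset_UNIV])
  then have "\<tau> \<in> VR r Y"
    using s t by (auto simp: VR_iff mdist_glue subset_iff)
  then show "\<sigma> \<in> (`) (glue_inr p q) ` VR r Y" using t(2) by blast
qed

lemma wedge_VR:
  assumes r: "0 < r"
  shows "wedge ((`) (glue_inl p q) ` VR r X) ((`) (glue_inr p q) ` VR r Y)
    (VR r (metric_gluing X p Y q)) (glue_inl p q p)"
proof
  let ?Z = "metric_gluing X p Y q" and ?v = "glue_inl p q p"
  let ?A = "(`) (glue_inl p q) ` VR r X" and ?B = "(`) (glue_inr p q) ` VR r Y"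
  have vZ: "?v \<in> mspace ?Z" "?v \<in> glue_inl p q ` mspace X" "?v \<in> glue_inr p q ` mspace Y"
    using p q glue_point by (auto simp: mspace_glue)
  show "sc_complex ?A" by (rule complex_image[OF inj_glue_inl complex_VR refl])
  show "sc_complex ?B" by (rule complex_image[OF inj_glue_inr complex_VR refl])
  show "sc_complex (VR r ?Z)" by (rule complex_VR)
  show "?A \<subseteq> VR r ?Z" "?B \<subseteq> VR r ?Z"
    by (simp_all only: subset_iff VR_glue_inl_iff VR_glue_inr_iff) simp_all
  have "mdist ?Z ?v ?v = 0" using mdist_zero[OF vZ(1) vZ(1)] by simp
  \<comment> \<open>Positivity of the parameter enters here: the base point alone has diameter 0 and
    must be a simplex.\<close>
  then have vv: "mdist ?Z ?v ?v < r" using r by linarith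
  then have "{?v} \<in> VR r ?Z" using vZ(1) r by (simp add: VR_iff)
  then show "{?v} \<in> ?A" "{?v} \<in> ?B"
    using vZ by (simp_all add: VR_glue_inl_iff VR_glue_inr_iff)
  fix \<sigma>
  show "\<sigma> = {?v}" if "\<sigma> \<in> ?A" "\<sigma> \<in> ?B"
  proof -
    have "z = ?v" if z: "z \<in> \<sigma>" for z
    proof -
      obtain x y where "z = glue_inl p q x" "z = glue_inr p q y"
        using z \<open>\<sigma> \<in> ?A\<close> \<open>\<sigma> \<in> ?B\<close> unfolding VR_glue_inl_iff VR_glue_inr_iff by blast
      then show ?thesis using glue_inl_inr_eq[of x y] by simp
    qed
    moreover have "\<sigma> \<noteq> {}" using that by (auto simp: VR_iff)
    ultimately show ?thesis by blast
  qed
  show "insert ?v \<sigma> \<in> ?A" if "\<sigma> \<in> ?A" "insert ?v \<sigma> \<in> VR r ?Z"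
    using that vZ(2) unfolding VR_glue_inl_iff by simp
  show "insert ?v \<sigma> \<in> ?B" if "\<sigma> \<in> ?B" "insert ?v \<sigma> \<in> VR r ?Z"
    using that vZ(3) unfolding VR_glue_inr_iff by simp
  show "insert ?v \<sigma> \<in> VR r ?Z" if s: "\<sigma> \<in> VR r ?Z" "\<sigma> \<notin> ?A" "\<sigma> \<notin> ?B"
  proof -
    have sub: "\<sigma> \<subseteq> glue_inl p q ` mspace X \<union> glue_inr p q ` mspace Y"
      using s(1) by (simp add: VR_iff mspace_glue)
    have d: "mdist ?Z a b < r" if "a \<in> \<sigma>" "b \<in> \<sigma>" for a b
      using s(1) that by (simp add: VR_iff)
    \<comment> \<open>A simplex contained in neither side has a vertex on each of them.\<close>
    obtain y where y: "y \<in> mspace Y" "glue_inr p q y \<in> \<sigma>"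
      using s(1,2) sub unfolding VR_glue_inl_iff by blast
    obtain x where x: "x \<in> mspace X" "glue_inl p q x \<in> \<sigma>"
      using s(1,3) sub unfolding VR_glue_inr_iff by blast
    have *: "mdist ?Z z ?v < r" if z: "z \<in> \<sigma>" for z
    proof -
      from z sub consider x' where "x' \<in> mspace X" "z = glue_inl p q x'"
        | y' where "y' \<in> mspace Y" "z = glue_inr p q y'" by blast
      then show ?thesis
      proof cases
        case 1
        then have "mdist X x' p + mdist Y y q < r"
          using d[OF z y(2)] y(1) by (simp add: mdist_glue)
        then show ?thesis
          using 1 p mdist_nonneg[of Y y q] by (simp add: mdist_glue del: mdist_nonneg)
      next
        case 2
        then have "mdist X x p + mdist Y y' q < r"
          using d[OF x(2) z] x(1) by (simp add: mdist_glue)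
        then show ?thesis
          using 2 q mdist_nonneg[of X x p] by (simp add: mdist_glue glue_point[symmetric] del: mdist_nonneg)
      qed
    qed
    have "mdist ?Z ?v z < r" if "z \<in> \<sigma>" for z
      using *[OF that] by (simp add: mdist_commute)
    then show ?thesis
      using s(1) vZ(1) vv d * by (auto simp: VR_iff)
  qed
qed

end

lemma direct_sum2_simps:
  "carrier (direct_sum2 M N) = carrier M \<times> carrier N"
  "(x, y) \<oplus>\<^bsub>direct_sum2 M N\<^esub> (x', y') = (x \<oplus>\<^bsub>M\<^esub> x', y \<oplus>\<^bsub>N\<^esub> y')"
  "a \<odot>\<^bsub>direct_sum2 M N\<^esub> (x, y) = (a \<odot>\<^bsub>M\<^esub> x, a \<odot>\<^bsub>N\<^esub> y)"
  by (simp_all add: direct_sum2_def mk_module_def)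

lemma gluing_VR:
  fixes X :: "'a metric" and Y :: "'b metric" and F :: "'f::field itself"
  assumes p: "p \<in> mspace X" and q: "q \<in> mspace Y"
  shows "reduced_PH F (metric_gluing X p Y q) \<cong>\<^sub>P\<^sub>M reduced_PH F X \<oplus>\<^sub>P\<^sub>M reduced_PH F Y"
proof -
  let ?Z = "metric_gluing X p Y q"
  let ?i = "glue_inl p q" and ?j = "glue_inr p q"
  let ?A = "\<lambda>r. (`) ?i ` VR r X" and ?B = "\<lambda>r. (`) ?j ` VR r Y" and ?C = "\<lambda>r. VR r ?Z"
  \<comment> \<open>Both cycles have vertices in the glued space, so they can be added there; their
    classes in \<open>X\<close> and \<open>Y\<close> are taken through the vertex
    injections.\<close>
  define V :: "nat \<Rightarrow> real \<Rightarrow> ((('a + 'b) set set \<Rightarrow>\<^sub>0 'f) \<times> (('a + 'b) set set \<Rightarrow>\<^sub>0 'f)) set"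
    where "V k r = rcyc (?A r) (Suc k) \<times> rcyc (?B r) (Suc k)" for k r
  define \<pi> :: "nat \<Rightarrow> real \<Rightarrow> _ \<times> _ \<Rightarrow> (('a + 'b) set list \<Rightarrow> 'f) set"
    where "\<pi> k r t = cls id (?C r) k (fst t + snd t)" for k r t
  define g :: "nat \<Rightarrow> real \<Rightarrow> _ \<times> _ \<Rightarrow> ('a list \<Rightarrow> 'f) set \<times> ('b list \<Rightarrow> 'f) set"
    where "g k r t = (cls ?i (VR r X) k (fst t), cls ?j (VR r Y) k (snd t))" for k r t
  have PC: "presentation (rcyc (?C r) (Suc k)) (bnd (?C r) (Suc k)) (cls id (?C r) k) (reduced_homology (?C r) k :: ('f, _) module)"
    for r k by (rule reduced_homology_presentation[OF inj_on_id complex_VR]) simp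
  have PA: "presentation (rcyc (?A r) (Suc k)) (bnd (?A r) (Suc k)) (cls ?i (VR r X) k) (reduced_homology (VR r X) k :: ('f, _) module)"
    for r k by (rule reduced_homology_presentation[OF inj_glue_inl complex_VR refl])
  have PB: "presentation (rcyc (?B r) (Suc k)) (bnd (?B r) (Suc k)) (cls ?j (VR r Y) k) (reduced_homology (VR r Y) k :: ('f, _) module)"
    for r k by (rule reduced_homology_presentation[OF inj_glue_inr complex_VR refl])
  show ?thesis
  proof (rule pm_isomorphic_cover[where V = V and \<pi> = \<pi> and g = g])
    fix k and r :: real assume r: "0 < r"
    interpret wedge "?A r" "?B r" "?C r" "?i p" by (rule wedge_VR[OF p q r])
    interpret PC: presentation "rcyc (?C r) (Suc k)" "bnd (?C r) (Suc k)" "cls id (?C r) k"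
      "reduced_homology (?C r) k :: ('f, _) module" by (rule PC)
    interpret PA: presentation "rcyc (?A r) (Suc k)" "bnd (?A r) (Suc k)" "cls ?i (VR r X) k"
      "reduced_homology (VR r X) k :: ('f, _) module" by (rule PA)
    interpret PB: presentation "rcyc (?B r) (Suc k)" "bnd (?B r) (Suc k)" "cls ?j (VR r Y) k"
      "reduced_homology (VR r Y) k :: ('f, _) module" by (rule PB)
    have sum: "fst t + snd t \<in> rcyc (?C r) (Suc k)" if "t \<in> V k r" for t
    proof -
      have "fst t \<in> rcyc (?C r) (Suc k)" "snd t \<in> rcyc (?C r) (Suc k)"
        using that rcyc_mono[OF AC, of "Suc k"] rcyc_mono[OF BC, of "Suc k"] by (auto simp: V_def)
      then show ?thesis by (rule fv.subspace_add[OF subspace_rcyc])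
    qed
    show "\<pi> k r ` V k r = carrier (pm_obj (reduced_PH F ?Z) k r)"
    proof (rule subset_antisym; rule subsetI)
      fix m assume "m \<in> \<pi> k r ` V k r"
      then show "m \<in> carrier (pm_obj (reduced_PH F ?Z) k r)"
        using PC.\<pi>_carrier[OF sum] by (auto simp: \<pi>_def reduced_PH_def)
    next
      fix m assume "m \<in> carrier (pm_obj (reduced_PH F ?Z) k r)"
      then obtain z where z: "z \<in> rcyc (?C r) (Suc k)" "m = cls id (?C r) k z"
        using PC.\<pi>_surj by (auto simp: reduced_PH_def)
      obtain x y where xy: "x \<in> rcyc (?A r) (Suc k)" "y \<in> rcyc (?B r) (Suc k)" "z - (x + y) \<in> bnd (?C r) (Suc k)"
        using rcyc_split[OF z(1)] by blast
      have V: "(x, y) \<in> V k r" using xy by (simp add: V_def)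
      have "m = \<pi> k r (x, y)"
        using PC.\<pi>_eq[OF z(1) sum[OF V]] xy(3) by (simp add: z(2) \<pi>_def)
      then show "m \<in> \<pi> k r ` V k r" using V by blast
    qed
    show "g k r ` V k r = carrier (pm_obj (reduced_PH F X \<oplus>\<^sub>P\<^sub>M reduced_PH F Y) k r)"
    proof -
      have "g k r ` V k r = cls ?i (VR r X) k ` rcyc (?A r) (Suc k) \<times> cls ?j (VR r Y) k ` rcyc (?B r) (Suc k)"
        by (force simp: g_def V_def)
      then show ?thesis
        by (simp add: pm_direct_sum_def reduced_PH_def direct_sum2_simps PA.\<pi>_surj PB.\<pi>_surj)
    qed
    show "\<pi> k r t = \<pi> k r u \<longleftrightarrow> g k r t = g k r u" if t: "t \<in> V k r" and u: "u \<in> V k r" for t u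
    proof -
      have tu: "fst t \<in> rcyc (?A r) (Suc k)" "fst u \<in> rcyc (?A r) (Suc k)"
        "snd t \<in> rcyc (?B r) (Suc k)" "snd u \<in> rcyc (?B r) (Suc k)"
        using t u by (auto simp: V_def)
      have "\<pi> k r t = \<pi> k r u \<longleftrightarrow> (fst t - fst u) + (snd t - snd u) \<in> bnd (?C r) (Suc k)"
        using PC.\<pi>_eq[OF sum[OF t] sum[OF u]] by (simp add: \<pi>_def algebra_simps)
      also have "\<dots> \<longleftrightarrow> fst t - fst u \<in> bnd (?A r) (Suc k) \<and> snd t - snd u \<in> bnd (?B r) (Suc k)"
        by (intro bnd_sum_iff fv.subspace_diff[OF subspace_rcyc] tu)
      also have "\<dots> \<longleftrightarrow> g k r t = g k r u"
        using PA.\<pi>_eq[OF tu(1,2)] PB.\<pi>_eq[OF tu(3,4)] by (simp add: g_def)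
      finally show ?thesis .
    qed
    show "\<exists>z\<in>V k r. \<pi> k r z = \<pi> k r t \<oplus>\<^bsub>pm_obj (reduced_PH F ?Z) k r\<^esub> \<pi> k r u \<and>
        g k r z = g k r t \<oplus>\<^bsub>pm_obj (reduced_PH F X \<oplus>\<^sub>P\<^sub>M reduced_PH F Y) k r\<^esub> g k r u"
      if t: "t \<in> V k r" and u: "u \<in> V k r" for t u
    proof (intro bexI[of _ "(fst t + fst u, snd t + snd u)"] conjI)
      have tu: "fst t \<in> rcyc (?A r) (Suc k)" "fst u \<in> rcyc (?A r) (Suc k)"
        "snd t \<in> rcyc (?B r) (Suc k)" "snd u \<in> rcyc (?B r) (Suc k)"
        using t u by (auto simp: V_def)
      show "(fst t + fst u, snd t + snd u) \<in> V k r"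
        using tu by (simp add: V_def fv.subspace_add[OF subspace_rcyc])
      show "\<pi> k r (fst t + fst u, snd t + snd u) = \<pi> k r t \<oplus>\<^bsub>pm_obj (reduced_PH F ?Z) k r\<^esub> \<pi> k r u"
        using PC.\<pi>_add[OF sum[OF t] sum[OF u]] by (simp add: \<pi>_def reduced_PH_def add_ac)
      show "g k r (fst t + fst u, snd t + snd u) =
          g k r t \<oplus>\<^bsub>pm_obj (reduced_PH F X \<oplus>\<^sub>P\<^sub>M reduced_PH F Y) k r\<^esub> g k r u"
        by (simp add: g_def pm_direct_sum_def reduced_PH_def direct_sum2_simps PA.\<pi>_add[OF tu(1,2)] PB.\<pi>_add[OF tu(3,4)])
    qed
    show "\<exists>z\<in>V k r. \<pi> k r z = a \<odot>\<^bsub>pm_obj (reduced_PH F ?Z) k r\<^esub> \<pi> k r t \<and>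
        g k r z = a \<odot>\<^bsub>pm_obj (reduced_PH F X \<oplus>\<^sub>P\<^sub>M reduced_PH F Y) k r\<^esub> g k r t"
      if t: "t \<in> V k r" for a t
    proof (intro bexI[of _ "(smul a (fst t), smul a (snd t))"] conjI)
      have tu: "fst t \<in> rcyc (?A r) (Suc k)" "snd t \<in> rcyc (?B r) (Suc k)"
        using t by (auto simp: V_def)
      show "(smul a (fst t), smul a (snd t)) \<in> V k r"
        using tu by (simp add: V_def fv.subspace_scale[OF subspace_rcyc])
      show "\<pi> k r (smul a (fst t), smul a (snd t)) = a \<odot>\<^bsub>pm_obj (reduced_PH F ?Z) k r\<^esub> \<pi> k r t"
        using PC.\<pi>_smul[OF sum[OF t], of a] by (simp add: \<pi>_def reduced_PH_def fv.scale_right_distrib)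
      show "g k r (smul a (fst t), smul a (snd t)) =
          a \<odot>\<^bsub>pm_obj (reduced_PH F X \<oplus>\<^sub>P\<^sub>M reduced_PH F Y) k r\<^esub> g k r t"
        by (simp add: g_def pm_direct_sum_def reduced_PH_def direct_sum2_simps PA.\<pi>_smul[OF tu(1)] PB.\<pi>_smul[OF tu(2)])
    qed
    fix s assume rs: "r \<le> s"
    note mX = VR_mono[OF rs, of X] and mY = VR_mono[OF rs, of Y]
    show "V k r \<subseteq> V k s"
      unfolding V_def by (intro Sigma_mono rcyc_mono image_mono mX mY)
    show "pm_map (reduced_PH F ?Z) k r s (\<pi> k r t) = \<pi> k s t" for t
      by (simp add: \<pi>_def reduced_PH_def reduced_homology_incl_cls[OF inj_on_id complex_VR complex_VR VR_mono[OF rs]])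
    show "pm_map (reduced_PH F X \<oplus>\<^sub>P\<^sub>M reduced_PH F Y) k r s (g k r t) = g k s t" for t
      by (simp add: g_def pm_direct_sum_def reduced_PH_def
          reduced_homology_incl_cls[OF inj_glue_inl complex_VR complex_VR mX]
          reduced_homology_incl_cls[OF inj_glue_inr complex_VR complex_VR mY])
  qed
qed

theorem theorem9:
  fixes X :: "'a metric" and Y :: "'b metric" and F :: "'f::field itself"
  shows "PH F (linf_product X Y) \<cong>\<^sub>P\<^sub>M PH F X \<otimes>\<^sub>P\<^sub>M PH F Y \<and>
    (\<forall>p\<in>mspace X. \<forall>q\<in>mspace Y.
       reduced_PH F (metric_gluing X p Y q) \<cong>\<^sub>P\<^sub>M reduced_PH F X \<oplus>\<^sub>P\<^sub>M reduced_PH F Y)"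
  by (intro conjI ballI Kuenneth_VR gluing_VR)

end
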